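(* Let $A_6$ be the alternating group of degree 6. The following d-identities form a basis of d-identities of $A_6$; that is, each of them holds in $A_6$, and every group in which all of them hold is isomorphic to a section (a quotient of a subgroup) of $A_6$: (1) $\omega_{360}=\bigvee_{0\le i<j\le 360}(x_i=x_j)$; (2) $(x^3=1)\vee(x^4=1)\vee(x^5=1)$; (3) in variables $x_1,\dots,x_9$, with $i,j$ ranging over $\{1,\dots,9\}$: $\Big[\bigvee_{i} x_i^{20}=1\Big]\vee\Big[\bigvee_{i<j}x_i=x_j\Big]\vee\Big[\bigvee_{i<j}(x_ix_j)^{20}=1\Big]\vee\Big[\bigvee_{i<j}(x_ix_j^2)^{20}=1\Big]$; (4) $(x_1^{30}=1)\vee(x_2^{30}=1)\vee((x_1x_2)^{15}=1)\vee((x_1x_2^2)^{15}=1)\vee((x_1x_2^3)^{15}=1)$; (5) in variables $x_1,x_2,x_3$, with $i,j$ ranging over $\{1,2,3\}$: $\theta(x_1,x_2,x_3)\vee\Big[\bigvee_i x_i^{15}=1\Big]\vee\Big[\bigvee_{i\ne j}(x_ix_j)^{15}=1\Big]\vee\Big[\bigvee_{i\ne j}(x_ix_j^2)^{15}=1\Big]\vee\Big[\bigvee_{i\ne j}(x_ix_j^3)^{15}=1\Big]$; (6) $(x_1^{12}=1)\vee(x_2^{30}=1)\vee\big((x_1\,x_2^{-1}x_1x_2)^{12}=1\big)\vee\big((x_1\,x_2^{-1}x_1^3x_2)^{12}=1\big)\vee\big((x_1^2\,x_2^{-1}x_1x_2)^{12}=1\big)$; (7) $(x_1^{12}=1)\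vee(x_2^{12}=1)\vee\bigvee_{d=1}^{4}\big((x_1x_2^d)^{12}=1\big)$.
   Context: A d-identity (disjunctive identity) is a universally quantified formula $\forall x_1\dots x_k\,[(f_1=1)\vee\dots\vee(f_n=1)]$ with the $f_i$ words in the free group on the variables; an equation $u=v$ abbreviates $uv^{-1}=1$. A group satisfies it if it is true for all assignments of group elements. For a group $G$, $\mathrm{dvar}(G)$ is the class of groups satisfying every d-identity satisfied by $G$; for finite $G$ it is exactly the class of groups isomorphic to sections of $G$. A set of d-identities is a basis of d-identities of $G$ if all its members hold in $G$ and every group satisfying them lies in $\mathrm{dvar}(G)$. Notation: "$u\in\langle v\rangle$" abbreviates $(u=1)\vee(u=v)\vee(u=v^2)\vee(u=v^3)$, and $\theta(z_1,z_2,z_3)$ denotes $\Big[\bigvee_{i\ne j} z_i\in\langle z_j\rangle\Big]\vee\Big[\bigvee_{\sigma\in S_3} z_{\sigma(1)}\in\langle z_{\sigma(2)}z_{\sigma(3)}\rangle\Big]\vee\Big[\bigvee_{\sigma\in S_3} z_{\sigma(1)}z_{\sigma(2)}\in\langle z_{\sigma(2)}z_{\sigma(3)}\rangle\Big]$ with $i,j\in\{1,2,3\}$. *)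

theory Defs
  imports "HOL-Algebra.Algebra"
begin

definition is_section_of :: "('a, 'c) monoid_scheme \<Rightarrow> ('b, 'd) monoid_scheme \<Rightarrow> bool" where
  "is_section_of G A \<longleftrightarrow>
     (\<exists>K N. subgroup K A \<and> normal N (A\<lparr>carrier := K\<rparr>) \<and> G \<cong> (A\<lparr>carrier := K\<rparr>) Mod N)"

definition in_pow3 :: "('a, 'b) monoid_scheme \<Rightarrow> 'a \<Rightarrow> 'a \<Rightarrow> bool" where
  "in_pow3 G u v \<longleftrightarrow> u = \<one>\<^bsub>G\<^esub> \<or> u = v \<or> u = v [^]\<^bsub>G\<^esub> (2::nat) \<or> u = v [^]\<^bsub>G\<^esub> (3::nat)"

text \<open>theta(z1,z2,z3); permutations sigma of {1,2,3} are encoded as triples (i,j,k)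
  of pairwise distinct indices with sigma(1)=i, sigma(2)=j, sigma(3)=k.\<close>
definition theta :: "('a, 'b) monoid_scheme \<Rightarrow> (nat \<Rightarrow> 'a) \<Rightarrow> bool" where
  "theta G z \<longleftrightarrow>
     (\<exists>i\<in>{1..3::nat}. \<exists>j\<in>{1..3}. i \<noteq> j \<and> in_pow3 G (z i) (z j)) \<or>
     (\<exists>i\<in>{1..3::nat}. \<exists>j\<in>{1..3}. \<exists>k\<in>{1..3}. i \<noteq> j \<and> i \<noteq> k \<and> j \<noteq> k \<and>
        in_pow3 G (z i) (z j \<otimes>\<^bsub>G\<^esub> z k)) \<or>
     (\<exists>i\<in>{1..3::nat}. \<exists>j\<in>{1..3}. \<exists>k\<in>{1..3}. i \<noteq> j \<and> i \<noteq> k \<and> j \<noteq> k \<and>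
        in_pow3 G (z i \<otimes>\<^bsub>G\<^esub> z j) (z j \<otimes>\<^bsub>G\<^esub> z k))"

definition dId1 :: "('a, 'b) monoid_scheme \<Rightarrow> bool" where
  "dId1 G \<longleftrightarrow> (\<forall>x :: nat \<Rightarrow> 'a. (\<forall>i\<le>360. x i \<in> carrier G) \<longrightarrow>
      (\<exists>i j. i < j \<and> j \<le> 360 \<and> x i = x j))"

definition dId2 :: "('a, 'b) monoid_scheme \<Rightarrow> bool" where
  "dId2 G \<longleftrightarrow> (\<forall>x\<in>carrier G. x [^]\<^bsub>G\<^esub> (3::nat) = \<one>\<^bsub>G\<^esub> \<or>
      x [^]\<^bsub>G\<^esub> (4::nat) = \<one>\<^bsub>G\<^esub> \<or> x [^]\<^bsub>G\<^esub> (5::nat) = \<one>\<^bsub>G\<^esub>)"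

definition dId3 :: "('a, 'b) monoid_scheme \<Rightarrow> bool" where
  "dId3 G \<longleftrightarrow> (\<forall>x :: nat \<Rightarrow> 'a. (\<forall>i\<in>{1..9}. x i \<in> carrier G) \<longrightarrow>
      (\<exists>i\<in>{1..9}. x i [^]\<^bsub>G\<^esub> (20::nat) = \<one>\<^bsub>G\<^esub>) \<or>
      (\<exists>i\<in>{1..9}. \<exists>j\<in>{1..9}. i < j \<and> x i = x j) \<or>
      (\<exists>i\<in>{1..9}. \<exists>j\<in>{1..9}. i < j \<and> (x i \<otimes>\<^bsub>G\<^esub> x j) [^]\<^bsub>G\<^esub> (20::nat) = \<one>\<^bsub>G\<^esub>) \<or>
      (\<exists>i\<in>{1..9}. \<exists>j\<in>{1..9}. i < j \<and>
          (x i \<otimes>\<^bsub>G\<^esub> x j [^]\<^bsub>G\<^esub> (2::nat)) [^]\<^bsub>G\<^esub> (20::nat) = \<one>\<^bsub>G\<^esub>))"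

definition dId4 :: "('a, 'b) monoid_scheme \<Rightarrow> bool" where
  "dId4 G \<longleftrightarrow> (\<forall>x1\<in>carrier G. \<forall>x2\<in>carrier G.
      x1 [^]\<^bsub>G\<^esub> (30::nat) = \<one>\<^bsub>G\<^esub> \<or> x2 [^]\<^bsub>G\<^esub> (30::nat) = \<one>\<^bsub>G\<^esub> \<or>
      (x1 \<otimes>\<^bsub>G\<^esub> x2) [^]\<^bsub>G\<^esub> (15::nat) = \<one>\<^bsub>G\<^esub> \<or>
      (x1 \<otimes>\<^bsub>G\<^esub> x2 [^]\<^bsub>G\<^esub> (2::nat)) [^]\<^bsub>G\<^esub> (15::nat) = \<one>\<^bsub>G\<^esub> \<or>
      (x1 \<otimes>\<^bsub>G\<^esub> x2 [^]\<^bsub>G\<^esub> (3::nat)) [^]\<^bsub>G\<^esub> (15::nat) = \<one>\<^bsub>G\<^esub>)"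

definition dId5 :: "('a, 'b) monoid_scheme \<Rightarrow> bool" where
  "dId5 G \<longleftrightarrow> (\<forall>x :: nat \<Rightarrow> 'a. (\<forall>i\<in>{1..3}. x i \<in> carrier G) \<longrightarrow>
      theta G x \<or>
      (\<exists>i\<in>{1..3}. x i [^]\<^bsub>G\<^esub> (15::nat) = \<one>\<^bsub>G\<^esub>) \<or>
      (\<exists>i\<in>{1..3}. \<exists>j\<in>{1..3}. i \<noteq> j \<and> (x i \<otimes>\<^bsub>G\<^esub> x j) [^]\<^bsub>G\<^esub> (15::nat) = \<one>\<^bsub>G\<^esub>) \<or>
      (\<exists>i\<in>{1..3}. \<exists>j\<in>{1..3}. i \<noteq> j \<and>
          (x i \<otimes>\<^bsub>G\<^esub> x j [^]\<^bsub>G\<^esub> (2::nat)) [^]\<^bsub>G\<^esub> (15::nat) = \<one>\<^bsub>G\<^esub>) \<or>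
      (\<exists>i\<in>{1..3}. \<exists>j\<in>{1..3}. i \<noteq> j \<and>
          (x i \<otimes>\<^bsub>G\<^esub> x j [^]\<^bsub>G\<^esub> (3::nat)) [^]\<^bsub>G\<^esub> (15::nat) = \<one>\<^bsub>G\<^esub>))"

definition dId6 :: "('a, 'b) monoid_scheme \<Rightarrow> bool" where
  "dId6 G \<longleftrightarrow> (\<forall>x1\<in>carrier G. \<forall>x2\<in>carrier G.
      x1 [^]\<^bsub>G\<^esub> (12::nat) = \<one>\<^bsub>G\<^esub> \<or> x2 [^]\<^bsub>G\<^esub> (30::nat) = \<one>\<^bsub>G\<^esub> \<or>
      (x1 \<otimes>\<^bsub>G\<^esub> inv\<^bsub>G\<^esub> x2 \<otimes>\<^bsub>G\<^esub> x1 \<otimes>\<^bsub>G\<^esub> x2) [^]\<^bsub>G\<^esub> (12::nat) = \<one>\<^bsub>G\<^esub> \<or>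
      (x1 \<otimes>\<^bsub>G\<^esub> inv\<^bsub>G\<^esub> x2 \<otimes>\<^bsub>G\<^esub> x1 [^]\<^bsub>G\<^esub> (3::nat) \<otimes>\<^bsub>G\<^esub> x2) [^]\<^bsub>G\<^esub> (12::nat) = \<one>\<^bsub>G\<^esub> \<or>
      (x1 [^]\<^bsub>G\<^esub> (2::nat) \<otimes>\<^bsub>G\<^esub> inv\<^bsub>G\<^esub> x2 \<otimes>\<^bsub>G\<^esub> x1 \<otimes>\<^bsub>G\<^esub> x2) [^]\<^bsub>G\<^esub> (12::nat) = \<one>\<^bsub>G\<^esub>)"

definition dId7 :: "('a, 'b) monoid_scheme \<Rightarrow> bool" where
  "dId7 G \<longleftrightarrow> (\<forall>x1\<in>carrier G. \<forall>x2\<in>carrier G.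
      x1 [^]\<^bsub>G\<^esub> (12::nat) = \<one>\<^bsub>G\<^esub> \<or> x2 [^]\<^bsub>G\<^esub> (12::nat) = \<one>\<^bsub>G\<^esub> \<or>
      (\<exists>d::nat\<in>{1..4}. (x1 \<otimes>\<^bsub>G\<^esub> x2 [^]\<^bsub>G\<^esub> d) [^]\<^bsub>G\<^esub> (12::nat) = \<one>\<^bsub>G\<^esub>))"

definition A6_basis :: "('a, 'b) monoid_scheme \<Rightarrow> bool" where
  "A6_basis G \<longleftrightarrow> dId1 G \<and> dId2 G \<and> dId3 G \<and> dId4 G \<and> dId5 G \<and> dId6 G \<and> dId7 G"

end

theory Submission
  imports Defs
begin

text \<open>
  By Cayley's theorem the group is realized by bijections of a set, a type on which the group laws hold
  unconditionally. Identity (1) makes it finite and (2) bounds the element orders by 5, so commuting nontrivial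
  elements have orders that are powers of the same prime. Identities (4) and (5) bound the Sylow 2-subgroups by 8
  (dihedral in that case), (3) bounds the Sylow 3-subgroups by 9 and (7) the Sylow 5-subgroups by 5; hence the order
  divides 360. Identity (6) excludes the Frobenius group of order 20, so the normalizer of a Sylow 5-subgroup has
  order 5 or 10, and Sylow counting leaves few orders. The 2-groups and the groups of orders 3, 6, 5, 10, 9, 18, 36
  are split extensions embedded step by step; those of orders 12 and 24 act faithfully on their 4 Sylow 3-subgroups,
  those of order 60 on their 6 Sylow 5-subgroups.

  A group of order 360 acts on its 10 Sylow 3-subgroups like on the projective line over the field with 9 elements:
  the stabilizer of a point is generated by the translations and a multiplication of order 4, and the admissible element
  orders single out one involution that swaps zero and infinity. So any two groups of order 360 satisfying the
  identities are isomorphic, and the alternating group is one of them. That the identities hold there is a finite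
  check, with one variable taken up to conjugation in the symmetric group.
\<close>

text \<open>The exponents encode element orders. In a group satisfying (2),
  \<open>x ^ 12 = 1\<close> fails exactly for order 5, \<open>x ^ 20 = 1\<close> exactly for order
  3, \<open>x ^ 15 = 1\<close> exactly for even order, and \<open>x ^ 30 = 1\<close> exactly for
  order 4. So each of (3) to (7) forbids a configuration: for instance (7) forbids two elements of
  order 5 all of whose products \<open>x1 * x2 ^ d\<close> with d from 1 to 4 have order 5. A group
  is restricted by exhibiting a forbidden configuration in it, and the alternating group is checked
  by searching for one. Order 360 is the obstacle: Sylow counting produces no set of 6 points to act
  on, only one of 10. No embedding into degree 6 is therefore built from the action; the
  permutations of degree 10 are pinned down so explicitly that the alternating group, which
  satisfies the identities as well, must yield the same ones. In every case the group turns out to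
  be isomorphic to a subgroup of the alternating group, so the sections that occur have a trivial
  normal subgroup.\<close>

hide_const (open) Divisibility.prime Multiset.mult

subsection \<open>Groups as a type class\<close>

class group_mult = monoid_mult + inverse +
  assumes left_inverse_mult [simp]: "inverse a * a = 1"
    and divide_inverse_mult: "a / b = a * inverse b"
begin

lemma left_cancel_inverse [simp]: "inverse a * (a * b) = b"
  by (metis left_inverse_mult mult.assoc mult_1_left)

lemma mult_left_cancel_group [simp]: "a * b = a * c \<longleftrightarrow> b = c"
  by (metis left_cancel_inverse)

lemma right_inverse_mult [simp]: "a * inverse a = 1"
  by (metis left_cancel_inverse left_inverse_mult mult_1_right)

lemma right_cancel_inverse [simp]: "a * (inverse a * b) = b"
  by (metis right_inverse_mult mult.assoc mult_1_left)

lemma mult_right_cancel_group [simp]: "b * a = c * a \<longleftrightarrow> b = c"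
  by (metis right_inverse_mult mult.assoc mult_1_right)

lemma inverse_inverse_mult [simp]: "inverse (inverse a) = a"
  by (metis left_inverse_mult right_inverse_mult mult_right_cancel_group)

lemma inverse_mult_distrib_group [simp]: "inverse (a * b) = inverse b * inverse a"
proof -
  have "(a * b) * (inverse b * inverse a) = (a * b) * inverse (a * b)"
    by (simp add: mult.assoc)
  then show ?thesis by (metis mult_left_cancel_group)
qed

lemma inverse_one_group [simp]: "inverse 1 = 1"
  by (metis left_inverse_mult mult_1_right)

lemma inverse_eq_group [simp]: "inverse a = inverse b \<longleftrightarrow> a = b"
  by (metis inverse_inverse_mult)

lemma inverse_eq_one_group [simp]: "inverse a = 1 \<longleftrightarrow> a = 1"
  by (metis inverse_inverse_mult inverse_one_group)

lemma mult_eq_self_group [simp]: "a * b = a \<longleftrightarrow> b = 1" "b * a = a \<longleftrightarrow> b = 1"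
  by (metis mult_1_right mult_left_cancel_group, metis mult_1_left mult_right_cancel_group)

lemma mult_eq_one_iff: "a * b = 1 \<longleftrightarrow> b = inverse a"
  by (metis right_inverse_mult mult_left_cancel_group)

lemma eq_mult_inverse_iff: "a = b * inverse c \<longleftrightarrow> a * c = b"
  by (metis mult.assoc left_inverse_mult mult_1_right mult_right_cancel_group)

lemma eq_inverse_mult_iff: "a = inverse c * b \<longleftrightarrow> c * a = b"
  by (metis left_cancel_inverse right_cancel_inverse)

lemma inverse_power_group: "inverse (a ^ n) = inverse a ^ n"
  by (induct n) (simp_all add: power_commutes)

end

abbreviation conj_by :: "'a::group_mult \<Rightarrow> 'a \<Rightarrow> 'a" where
  "conj_by g x \<equiv> g * x * inverse g"

lemma conj_by_power: "conj_by g x ^ n = conj_by g (x ^ n)"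
  by (induct n) (simp_all add: mult.assoc)

lemma conj_by_eq_iff: "conj_by g x = conj_by g y \<longleftrightarrow> x = y"
  by simp

text \<open>Bezout in the form \<open>m * a = n * b + 1\<close>, which keeps all exponents natural
  numbers; this form requires \<open>m\<close> to be nonzero, whence the case split.\<close>

lemma power_coprime_eq_1:
  fixes x :: "'a::group_mult"
  assumes "x ^ m = 1" "x ^ n = 1" "coprime m n" shows "x = 1"
proof (cases "m = 0")
  case True
  then have "n = 1" using assms(3) by simp
  then show ?thesis using assms(2) by simp
next
  case False
  then obtain a b where "m * a = n * b + gcd m n" using bezout_nat by blast
  then have e: "m * a = n * b + 1" using assms(3) by simp
  have "x ^ (m * a) = 1" "x ^ (n * b + 1) = x"
    by (simp only: power_mult assms power_one, simp only: power_add power_mult assms power_one) simp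
  then show ?thesis using e by simp
qed

lemma power_mod_order:
  fixes x :: "'a::group_mult"
  assumes "x ^ n = 1" shows "x ^ (m mod n) = x ^ m"
proof -
  have "x ^ m = x ^ (n * (m div n) + m mod n)" by simp
  also have "\<dots> = x ^ (m mod n)" by (simp only: power_add power_mult assms) simp
  finally show ?thesis by simp
qed

lemma commute_power: "x * y = y * x \<Longrightarrow> x ^ m * y ^ n = y ^ n * (x::'a::group_mult) ^ m"
  by (metis power_commuting_commutes)

subsection \<open>Finite subgroups and actions\<close>

text \<open>Finiteness is built in: only finite groups matter by (1), and there nonemptiness and
  closure under products already characterize subgroups.\<close>

definition sgp :: "'a::group_mult set \<Rightarrow> bool" where
  "sgp H \<longleftrightarrow> finite H \<and> 1 \<in> H \<and> (\<forall>x\<in>H. \<forall>y\<in>H. x * y \<in> H) \<and> (\<forall>x\<in>H. inverse x \<in> H)"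

lemma sgpD:
  assumes "sgp H"
  shows "finite H" "1 \<in> H" "x \<in> H \<Longrightarrow> y \<in> H \<Longrightarrow> x * y \<in> H" "x \<in> H \<Longrightarrow> inverse x \<in> H"
  using assms by (auto simp: sgp_def)

lemma sgp_power: "sgp H \<Longrightarrow> x \<in> H \<Longrightarrow> x ^ n \<in> H"
  by (induct n) (auto simp: sgp_def)

lemma sgp_card_pos: "sgp H \<Longrightarrow> card H > 0"
  by (auto simp: sgp_def card_gt_0_iff)

lemma sgp_conj: "sgp H \<Longrightarrow> g \<in> H \<Longrightarrow> x \<in> H \<Longrightarrow> conj_by g x \<in> H"
  by (simp add: sgpD)

lemma sgp_mult_iff:
  assumes "sgp H" "x \<in> H"
  shows "x * y \<in> H \<longleftrightarrow> y \<in> H" "y * x \<in> H \<longleftrightarrow> y \<in> H"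
proof -
  show "x * y \<in> H \<longleftrightarrow> y \<in> H"
    using sgpD[OF assms(1)] assms(2) by (metis left_cancel_inverse)
  show "y * x \<in> H \<longleftrightarrow> y \<in> H"
    using sgpD[OF assms(1)] assms(2) by (metis mult.assoc right_inverse_mult mult_1_right)
qed

lemma sgp_inverse_iff: "sgp H \<Longrightarrow> inverse x \<in> H \<longleftrightarrow> x \<in> H"
  using sgpD(4) by fastforce

text \<open>Left translations are injective self-maps of a finite set, hence surjective.\<close>
lemma sgp_finite_closed:
  fixes H :: "'a::group_mult set"
  assumes "finite H" "H \<noteq> {}" and cl: "\<And>x y. x \<in> H \<Longrightarrow> y \<in> H \<Longrightarrow> x * y \<in> H"
  shows "sgp H"
proof -
  have sur: "(*) x ` H = H" if "x \<in> H" for x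
    using that assms by (intro endo_inj_surj) (auto simp: inj_on_def)
  obtain x where x: "x \<in> H" using assms by blast
  then obtain e where "e \<in> H" "x * e = x" using sur[OF x] by (metis imageE)
  then have one: "1 \<in> H" by simp
  have "inverse y \<in> H" if y: "y \<in> H" for y
  proof -
    obtain z where "z \<in> H" "y * z = 1" using sur[OF y] one by (metis imageE)
    then show ?thesis by (simp add: mult_eq_one_iff)
  qed
  then show ?thesis using assms one by (simp add: sgp_def)
qed

definition group_of :: "'a::group_mult set \<Rightarrow> 'a monoid" where
  "group_of H = \<lparr>carrier = H, mult = (*), one = 1\<rparr>"

lemma group_group_of: assumes "sgp H" shows "group (group_of H)"
proof (rule groupI)
  fix x assume "x \<in> carrier (group_of H)"
  then show "\<exists>y\<in>carrier (group_of H). y \<otimes>\<^bsub>group_of H\<^esub> x = \<one>\<^bsub>group_of H\<^esub>"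
    using assms by (auto simp: group_of_def sgp_def intro!: bexI[of _ "inverse x"])
qed (use assms in \<open>auto simp: group_of_def sgp_def mult.assoc\<close>)

lemma subgroup_group_of_iff:
  assumes "sgp H" shows "subgroup K (group_of H) \<longleftrightarrow> sgp K \<and> K \<subseteq> H"
proof
  assume K: "subgroup K (group_of H)"
  then have "K \<subseteq> H" "1 \<in> K" "\<And>x y. x \<in> K \<Longrightarrow> y \<in> K \<Longrightarrow> x * y \<in> K"
    by (auto simp: subgroup_def group_of_def)
  then show "sgp K \<and> K \<subseteq> H" using assms sgp_finite_closed[of K] finite_subset[of K H] by (auto simp: sgp_def)
next
  assume K: "sgp K \<and> K \<subseteq> H"
  have "inv\<^bsub>group_of H\<^esub> x = inverse x" if "x \<in> K" for x
    using that K group.inv_equality[OF group_group_of[OF assms], of "inverse x" x] sgpD(4)[OF assms]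
    by (auto simp: group_of_def)
  then show "subgroup K (group_of H)" using K by (auto simp: subgroup_def group_of_def sgp_def)
qed

lemma exists_sylow:
  fixes H :: "'a::group_mult set"
  assumes "sgp H" "prime p" "p ^ k dvd card H"
  obtains K where "sgp K" "K \<subseteq> H" "card K = p ^ k"
proof -
  obtain m where "card H = p ^ k * m" using assms(3) by blast
  then have "\<exists>K. subgroup K (group_of H) \<and> card K = p ^ k"
    using assms group_group_of[OF assms(1)]
    by (intro sylow_thm) (auto simp: order_def group_of_def sgp_def)
  then show thesis using that subgroup_group_of_iff[OF assms(1)] by blast
qed

section \<open>Orbits, stabilizers and the fixed-point congruence\<close>

locale action =
  fixes H :: "'a::group_mult set" and \<Omega> :: "'b set" and act :: "'a \<Rightarrow> 'b \<Rightarrow> 'b"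
  assumes sgp: "sgp H" and fin: "finite \<Omega>"
    and act_in: "g \<in> H \<Longrightarrow> x \<in> \<Omega> \<Longrightarrow> act g x \<in> \<Omega>"
    and act_one: "x \<in> \<Omega> \<Longrightarrow> act 1 x = x"
    and act_mult: "g \<in> H \<Longrightarrow> h \<in> H \<Longrightarrow> x \<in> \<Omega> \<Longrightarrow> act (g * h) x = act g (act h x)"
begin

lemma act_inverse: "g \<in> H \<Longrightarrow> x \<in> \<Omega> \<Longrightarrow> act (inverse g) (act g x) = x"
  using act_mult[of "inverse g" g x] act_one sgpD(4)[OF sgp] by simp

lemma act_eq_iff: "g \<in> H \<Longrightarrow> h \<in> H \<Longrightarrow> x \<in> \<Omega> \<Longrightarrow> act g x = act h x \<longleftrightarrow> act (inverse g * h) x = x"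
  by (metis act_inverse act_mult act_in sgpD(4) sgp inverse_inverse_mult)

definition stab :: "'b \<Rightarrow> 'a set" where "stab x = {g\<in>H. act g x = x}"
definition orb :: "'b \<Rightarrow> 'b set" where "orb x = (\<lambda>g. act g x) ` H"
definition fixed :: "'b set" where "fixed = {x\<in>\<Omega>. \<forall>g\<in>H. act g x = x}"

lemma sgp_stab: assumes "x \<in> \<Omega>" shows "sgp (stab x)"
  using sgpD(1-3)[OF sgp] act_one[of x] act_mult[of _ _ x] assms
  by (intro sgp_finite_closed) (auto simp: stab_def)

lemma orb_subset: "x \<in> \<Omega> \<Longrightarrow> orb x \<subseteq> \<Omega>"
  by (auto simp: orb_def act_in)

lemma orb_self: "x \<in> \<Omega> \<Longrightarrow> x \<in> orb x"
  using act_one sgpD(2)[OF sgp] by (force simp: orb_def)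

lemma orb_eq: assumes "x \<in> \<Omega>" "y \<in> orb x" shows "orb y = orb x"
proof -
  obtain g where g: "g \<in> H" "y = act g x" using assms by (auto simp: orb_def)
  have "orb y \<subseteq> orb x"
    using g assms sgpD[OF sgp] by (auto simp: orb_def simp flip: act_mult)
  moreover have "orb x \<subseteq> orb y"
  proof
    fix z assume "z \<in> orb x"
    then obtain h where h: "h \<in> H" "z = act h x" by (auto simp: orb_def)
    then have "z = act (h * inverse g) y"
      using g assms sgpD[OF sgp] by (simp add: act_mult act_inverse act_in)
    then show "z \<in> orb y" using g h sgpD[OF sgp] by (auto simp: orb_def)
  qed
  ultimately show ?thesis by blast
qed

lemma orbit_stabilizer: assumes x: "x \<in> \<Omega>" shows "card (orb x) * card (stab x) = card H"
proof -
  \<comment> \<open>The fibres of \<open>g \<mapsto> act g x\<close> over the orbit are the left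
    cosets of the stabilizer.\<close>
  have fib: "card {g\<in>H. act g x = y} = card (stab x)" if y: "y \<in> orb x" for y
  proof -
    obtain k where k: "k \<in> H" "y = act k x" using y by (auto simp: orb_def)
    have "bij_betw ((*) k) (stab x) {g\<in>H. act g x = y}"
    proof (rule bij_betw_byWitness[where f' = "(*) (inverse k)"])
      show "(*) (inverse k) ` {g \<in> H. act g x = y} \<subseteq> stab x"
        using k x sgpD[OF sgp] by (auto simp: stab_def act_mult act_inverse)
      show "(*) k ` stab x \<subseteq> {g \<in> H. act g x = y}"
        using k x sgpD[OF sgp] by (auto simp: stab_def act_mult)
    qed auto
    then show ?thesis by (metis bij_betw_same_card)
  qed
  have "card H = (\<Sum>y\<in>orb x. card {g\<in>H. act g x = y})"
    using sum.image_gen[of H "\<lambda>_. 1::nat" "\<lambda>g. act g x"] sgpD(1)[OF sgp] by (simp add: orb_def)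
  also have "\<dots> = card (orb x) * card (stab x)" using fib by simp
  finally show ?thesis by simp
qed

lemma orb_singleton_iff: "x \<in> \<Omega> \<Longrightarrow> card (orb x) = 1 \<longleftrightarrow> x \<in> fixed"
proof -
  assume x: "x \<in> \<Omega>"
  show ?thesis
  proof
    assume "card (orb x) = 1"
    then obtain y where "orb x = {y}" by (meson card_1_singletonE)
    then have "orb x = {x}" using orb_self[OF x] by auto
    then show "x \<in> fixed" using x by (auto simp: fixed_def orb_def)
  next
    assume "x \<in> fixed"
    then have "orb x = {x}" using sgpD[OF sgp] by (auto simp: fixed_def orb_def)
    then show "card (orb x) = 1" by simp
  qed
qed

text \<open>An orbit outside \<open>fixed\<close> has a size that divides \<open>p ^ k\<close> and
  is not 1, hence a multiple of \<open>p\<close>. Sylow conjugacy, the commutativity of groups of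
  order 9 and several later existence arguments come from this congruence.\<close>

lemma card_fixed_cong:
  assumes p: "prime p" and cH: "card H = p ^ k"
  shows "card \<Omega> mod p = card fixed mod p"
proof -
  let ?C = "orb ` (\<Omega> - fixed)"
  have un: "\<Union> ?C = \<Omega> - fixed"
  proof
    show "\<Union> ?C \<subseteq> \<Omega> - fixed"
    proof
      fix y assume "y \<in> \<Union> ?C"
      then obtain x where x: "x \<in> \<Omega>" "x \<notin> fixed" "y \<in> orb x" by auto
      then have "y \<in> \<Omega>" using orb_subset by blast
      moreover have "y \<notin> fixed" using orb_eq[OF x(1,3)] x orb_singleton_iff \<open>y \<in> \<Omega>\<close> by metis
      ultimately show "y \<in> \<Omega> - fixed" by simp
    qed
    show "\<Omega> - fixed \<subseteq> \<Union> ?C" using orb_self by (auto simp del: not_ex)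
  qed
  have "p dvd card (\<Union> ?C)"
  proof (rule dvd_partition)
    show "finite (\<Union> ?C)" unfolding un using fin by simp
    show "\<forall>c\<in>?C. p dvd card c"
    proof
      fix c assume "c \<in> ?C"
      then obtain x where x: "x \<in> \<Omega>" "x \<notin> fixed" "c = orb x" by auto
      have "card c dvd p ^ k" using orbit_stabilizer[OF x(1)] unfolding x(3) cH[symmetric] by (intro dvdI[of _ _ "card (stab x)"]) simp
      then obtain i where "card c = p ^ i" using divides_primepow_nat[OF p] by blast
      moreover have "card c \<noteq> 1" using orb_singleton_iff x by blast
      ultimately show "p dvd card c" by (cases i) auto
    qed
    show "\<forall>c1\<in>?C. \<forall>c2\<in>?C. c1 \<noteq> c2 \<longrightarrow> c1 \<inter> c2 = {}"
    proof (intro ballI impI, rule ccontr)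
      fix c1 c2 assume c: "c1 \<in> ?C" "c2 \<in> ?C" "c1 \<noteq> c2" "c1 \<inter> c2 \<noteq> {}"
      then obtain x1 x2 y where "x1 \<in> \<Omega>" "x2 \<in> \<Omega>" "c1 = orb x1" "c2 = orb x2" "y \<in> orb x1" "y \<in> orb x2"
        by blast
      then show False using orb_eq[of x1 y] orb_eq[of x2 y] c(3) by simp
    qed
  qed
  then obtain k where d: "card (\<Omega> - fixed) = p * k" unfolding un by blast
  have "fixed \<subseteq> \<Omega>" by (auto simp: fixed_def)
  then have "card \<Omega> = card (\<Omega> - fixed) + card fixed"
    using fin finite_subset[of fixed \<Omega>] by (simp add: card_Diff_subset card_mono)
  then show ?thesis using d by simp
qed

end

lemma pow_group_of: "x [^]\<^bsub>group_of H\<^esub> (n::nat) = x ^ n"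
  by (induct n) (simp_all add: group_of_def nat_pow_def power_commutes)

lemma power_card_eq_1: assumes "sgp H" "x \<in> H" shows "x ^ card H = 1"
  using group.pow_order_eq_1[OF group_group_of[OF assms(1)], of x] assms(2)
  unfolding pow_group_of by (simp add: group_of_def order_def)

lemma left_mult_action:
  assumes "sgp H" "R \<subseteq> H" "sgp R" "Q \<subseteq> H"
  shows "action R ((\<lambda>g. (*) g ` Q) ` H) (\<lambda>g. (`) ((*) g))"
proof
  show "finite ((\<lambda>g. (*) g ` Q) ` H)" using sgpD(1)[OF assms(1)] by simp
  fix g x assume "g \<in> R" "x \<in> (\<lambda>g. (*) g ` Q) ` H"
  then obtain h where h: "h \<in> H" "x = (*) h ` Q" by auto
  then have "(*) g ` x = (*) (g * h) ` Q" by (auto simp: image_image mult.assoc)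
  moreover have "g * h \<in> H" using h \<open>g \<in> R\<close> assms sgpD(3) by blast
  ultimately show "(*) g ` x \<in> (\<lambda>g. (*) g ` Q) ` H" by blast
qed (use assms in \<open>auto simp: image_image mult.assoc\<close>)

lemma left_coset_eq_self_iff:
  assumes "sgp K" shows "(*) g ` K = K \<longleftrightarrow> g \<in> K"
proof
  assume "(*) g ` K = K"
  then show "g \<in> K" using sgpD(2)[OF assms] by (metis imageI mult_1_right)
next
  assume g: "g \<in> K"
  show "(*) g ` K = K"
    by (rule endo_inj_surj) (use g sgpD[OF assms] in \<open>auto simp: inj_on_def\<close>)
qed

text \<open>Orbit-stabilizer for left translation of cosets: the stabilizer of the coset
  \<open>K\<close> is \<open>K\<close> itself.\<close>

lemma card_cosets:
  assumes "sgp H" "sgp K" "K \<subseteq> H"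
  shows "card ((\<lambda>g. (*) g ` K) ` H) * card K = card H"
proof -
  interpret action H "(\<lambda>g. (*) g ` K) ` H" "\<lambda>g. (`) ((*) g)"
    using left_mult_action[OF assms(1) subset_refl assms(1,3)] .
  have K: "K \<in> (\<lambda>g. (*) g ` K) ` H"
    using sgpD(2)[OF assms(1)] by (force intro!: image_eqI[of _ _ 1])
  have "stab K = K" using assms by (auto simp: stab_def left_coset_eq_self_iff)
  then show ?thesis using orbit_stabilizer[OF K] by (simp add: orb_def)
qed

lemma lagrange_sgp: "sgp H \<Longrightarrow> sgp K \<Longrightarrow> K \<subseteq> H \<Longrightarrow> card K dvd card H"
  by (metis card_cosets dvd_triv_right)

lemma sgp_eq_if_card_eq: "sgp H \<Longrightarrow> K \<subseteq> H \<Longrightarrow> card K = card H \<Longrightarrow> K = H"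
  by (simp add: card_subset_eq sgpD(1))

lemma exists_prime_order:
  fixes H :: "'a::group_mult set"
  assumes "sgp H" "prime p" "p dvd card H"
  obtains x where "x \<in> H" "x \<noteq> 1" "x ^ p = 1"
proof -
  obtain K where K: "sgp K" "K \<subseteq> H" "card K = p ^ 1"
    using exists_sylow[of H p 1] assms by auto
  have "\<not> K \<subseteq> {1}"
  proof
    assume "K \<subseteq> {1}"
    then have "card K \<le> 1" using card_mono[of "{1}" K] by simp
    then show False using K(3) prime_gt_1_nat[OF assms(2)] by simp
  qed
  then obtain x where "x \<in> K" "x \<noteq> 1" by auto
  then show thesis using that K power_card_eq_1[OF K(1)] by auto
qed

lemma card_decompose:
  fixes H :: "'a::group_mult set"
  assumes "sgp H" "prime p"
  obtains m where "card H = m * p ^ multiplicity p (card H)" "\<not> p dvd m"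
proof -
  have "card H \<noteq> 0" "\<not> is_unit p" using sgp_card_pos[OF assms(1)] assms(2) by auto
  then show thesis using multiplicity_decompose'[of "card H" p] that by (metis mult.commute)
qed

text \<open>Another prime divisor of the order would yield, by Cauchy, an element of that order,
  which the exponent rules out.\<close>

lemma card_prime_power:
  fixes H :: "'a::group_mult set"
  assumes "sgp H" "prime p" and pow: "\<And>x. x \<in> H \<Longrightarrow> x ^ (p ^ j) = 1"
  obtains k where "card H = p ^ k"
proof -
  obtain m where m: "card H = m * p ^ multiplicity p (card H)" "\<not> p dvd m"
    using card_decompose[OF assms(1,2)] .
  have "m = 1"
  proof (rule ccontr)
    assume "m \<noteq> 1"
    then obtain q where q: "prime q" "q dvd m" using prime_factor_nat by blast
    then obtain x where x: "x \<in> H" "x \<noteq> 1" "x ^ q = 1"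
      using exists_prime_order[OF assms(1) q(1)] m(1) by (metis dvd_mult2)
    have "q \<noteq> p" using q m by auto
    then have "coprime q (p ^ j)" using q(1) assms(2) by (simp add: primes_coprime)
    then show False using power_coprime_eq_1 x pow by blast
  qed
  then show thesis using m(1) that by simp
qed

text \<open>Natural exponents give the whole cyclic subgroup, because it is used for elements of
  finite order.\<close>

definition powers :: "'a::group_mult \<Rightarrow> 'a set" where
  "powers x = range (\<lambda>n::nat. x ^ n)"

lemma powers_self: "x \<in> powers x"
  unfolding powers_def by (metis power_one_right rangeI)

lemma powers_subset: "sgp H \<Longrightarrow> x \<in> H \<Longrightarrow> powers x \<subseteq> H"
  using sgp_power by (auto simp: powers_def)

lemma sgp_powers: assumes "sgp H" "x \<in> H" shows "sgp (powers x)"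
proof (rule sgp_finite_closed)
  show "finite (powers x)" using powers_subset[OF assms] sgpD(1)[OF assms(1)] by (rule finite_subset)
  show "powers x \<noteq> {}" using powers_self[of x] by blast
  show "\<And>y z. y \<in> powers x \<Longrightarrow> z \<in> powers x \<Longrightarrow> y * z \<in> powers x"
    by (auto simp: powers_def simp flip: power_add)
qed

lemma powers_eq: assumes "x ^ n = 1" "n > 0" shows "powers x = (\<lambda>i. x ^ i) ` {..<n}"
proof
  show "powers x \<subseteq> (\<lambda>i. x ^ i) ` {..<n}"
  proof
    fix y assume "y \<in> powers x"
    then obtain i where "y = x ^ i" by (auto simp: powers_def)
    then have "y = x ^ (i mod n)" using power_mod_order[OF assms(1)] by simp
    then show "y \<in> (\<lambda>i. x ^ i) ` {..<n}" using assms(2) by simp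
  qed
qed (auto simp: powers_def)

lemma power_eq_imp_mod:
  fixes x :: "'a::group_mult"
  assumes "x ^ i = x ^ j" "i \<le> j" shows "x ^ (j - i) = 1"
  using assms by (metis le_add_diff_inverse mult_eq_self_group(1) power_add)

lemma card_powers_prime:
  assumes "prime p" "x ^ p = 1" "x \<noteq> 1" shows "card (powers x) = p"
proof -
  have "inj_on (\<lambda>i. x ^ i) {..<p}"
  proof (rule linorder_inj_onI)
    fix i j assume ij: "i < j" "i \<in> {..<p}" "j \<in> {..<p}"
    show "x ^ i \<noteq> x ^ j"
    proof
      assume "x ^ i = x ^ j"
      then have "x ^ (j - i) = 1" using ij(1) by (intro power_eq_imp_mod) auto
      moreover have "coprime (j - i) p"
        using ij assms(1) by (metis coprime_commute diff_is_0_eq less_imp_diff_less lessThan_iff not_le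
            prime_imp_coprime dvd_imp_le zero_less_diff)
      ultimately show False using power_coprime_eq_1 assms by blast
    qed
  qed auto
  then show ?thesis using powers_eq[OF assms(2)] prime_gt_0_nat[OF assms(1)] by (simp add: card_image)
qed

subsection \<open>Conjugation and Sylow subgroups\<close>

definition conj_set :: "'a::group_mult \<Rightarrow> 'a set \<Rightarrow> 'a set" where
  "conj_set g S = conj_by g ` S"

lemma conj_set_one [simp]: "conj_set 1 S = S"
  by (simp add: conj_set_def)

lemma conj_set_mult: "conj_set (g * h) S = conj_set g (conj_set h S)"
  by (auto simp: conj_set_def image_image mult.assoc)

lemma conj_set_inverse [simp]: "conj_set (inverse g) (conj_set g S) = S" "conj_set g (conj_set (inverse g) S) = S"
  by (simp_all flip: conj_set_mult)

lemma mem_conj_set: "x \<in> conj_set g S \<longleftrightarrow> inverse g * x * g \<in> S"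
proof
  assume "inverse g * x * g \<in> S"
  then have "conj_by g (inverse g * x * g) \<in> conj_set g S" unfolding conj_set_def by (rule imageI)
  then show "x \<in> conj_set g S" by (simp add: mult.assoc)
qed (auto simp: conj_set_def mult.assoc)

lemma conj_by_mem_conj_set [simp]: "conj_by g x \<in> conj_set g S \<longleftrightarrow> x \<in> S"
  by (simp add: mem_conj_set mult.assoc)

lemma card_conj_set [simp]: "card (conj_set g S) = card S"
  unfolding conj_set_def by (rule card_image) (simp add: inj_on_def)

lemma sgp_conj_set: assumes "sgp S" shows "sgp (conj_set g S)"
proof (rule sgp_finite_closed)
  show "finite (conj_set g S)" "conj_set g S \<noteq> {}" using sgpD[OF assms] by (auto simp: conj_set_def)
  fix x y assume "x \<in> conj_set g S" "y \<in> conj_set g S"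
  then have "(inverse g * x * g) * (inverse g * y * g) \<in> S"
    using sgpD(3)[OF assms] by (simp add: mem_conj_set)
  then show "x * y \<in> conj_set g S" by (simp add: mem_conj_set mult.assoc)
qed

lemma conj_set_subset: "sgp H \<Longrightarrow> g \<in> H \<Longrightarrow> S \<subseteq> H \<Longrightarrow> conj_set g S \<subseteq> H"
  using sgp_conj by (auto simp: conj_set_def)

lemma conj_set_self: assumes "sgp S" "g \<in> S" shows "conj_set g S = S"
  using conj_set_subset[OF assms subset_refl] card_conj_set[of g S] sgp_eq_if_card_eq[OF assms(1)] by blast

definition nrm :: "'a::group_mult set \<Rightarrow> 'a set \<Rightarrow> 'a set" where
  "nrm H S = {g\<in>H. conj_set g S = S}"

lemma nrm_subset: "nrm H S \<subseteq> H"
  by (auto simp: nrm_def)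

lemma sgp_nrm: assumes "sgp H" shows "sgp (nrm H S)"
  using sgpD[OF assms] by (intro sgp_finite_closed) (auto simp: nrm_def conj_set_mult intro: exI[of _ 1])

lemma subset_nrm: "sgp Q \<Longrightarrow> Q \<subseteq> H \<Longrightarrow> Q \<subseteq> nrm H Q"
  by (auto simp: nrm_def conj_set_self)

definition cent :: "'a::group_mult set \<Rightarrow> 'a \<Rightarrow> 'a set" where
  "cent H x = {g\<in>H. g * x = x * g}"

lemma sgp_cent: assumes "sgp H" shows "sgp (cent H x)"
proof (rule sgp_finite_closed)
  show "finite (cent H x)" "cent H x \<noteq> {}" using sgpD[OF assms] by (auto simp: cent_def intro: exI[of _ 1])
  fix a b assume "a \<in> cent H x" "b \<in> cent H x"
  then have "a * b \<in> H" "a * x = x * a" "b * x = x * b" using sgpD[OF assms] by (auto simp: cent_def)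
  then show "a * b \<in> cent H x" by (auto simp: cent_def) (metis mult.assoc)
qed

definition sylows :: "nat \<Rightarrow> 'a::group_mult set \<Rightarrow> 'a set set" where
  "sylows p H = {Q. sgp Q \<and> Q \<subseteq> H \<and> card Q = p ^ multiplicity p (card H)}"

lemma sylows_conj: "sgp H \<Longrightarrow> Q \<in> sylows p H \<Longrightarrow> g \<in> H \<Longrightarrow> conj_set g Q \<in> sylows p H"
  by (simp add: sylows_def sgp_conj_set conj_set_subset)

lemma finite_sylows: "sgp H \<Longrightarrow> finite (sylows p H)"
  using sgpD(1)[of H] by (auto simp: sylows_def intro: finite_subset[of _ "Pow H"])

lemma sylows_nonempty: "sgp H \<Longrightarrow> prime p \<Longrightarrow> sylows p H \<noteq> {}"
  using exists_sylow[of H p "multiplicity p (card H)"] multiplicity_dvd[of p "card H"]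
  by (auto simp: sylows_def)

lemma conj_action:
  assumes "sgp H" "R \<subseteq> H" "sgp R"
  shows "action R (sylows p H) conj_set"
  using assms sylows_conj[OF assms(1)] by unfold_locales (auto simp: finite_sylows conj_set_mult)

text \<open>\<open>R\<close> acts by left translation on the cosets of \<open>Q\<close>. Their
  number is prime to \<open>p\<close>, so some coset \<open>gQ\<close> is fixed, which says that
  \<open>R\<close> lies in the conjugate of \<open>Q\<close> by \<open>g\<close>.\<close>

lemma subset_sylow:
  assumes H: "sgp H" and p: "prime p" and Q: "Q \<in> sylows p H"
    and R: "sgp R" "R \<subseteq> H" "card R = p ^ k"
  obtains g where "g \<in> H" "R \<subseteq> conj_set g Q"
proof -
  have Q': "sgp Q" "Q \<subseteq> H" "card Q = p ^ multiplicity p (card H)" using Q by (auto simp: sylows_def)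
  let ?\<Omega> = "(\<lambda>g. (*) g ` Q) ` H"
  interpret action R ?\<Omega> "\<lambda>g. (`) ((*) g)" using left_mult_action[OF H R(2,1) Q'(2)] .
  obtain m where m: "card H = m * p ^ multiplicity p (card H)" "\<not> p dvd m"
    using card_decompose[OF H p] .
  have "card ?\<Omega> * card Q = m * card Q" using card_cosets[OF H Q'(1,2)] m Q'(3) by simp
  then have "card ?\<Omega> = m" using sgp_card_pos[OF Q'(1)] by simp
  then have "card fixed mod p \<noteq> 0" using card_fixed_cong[OF p R(3)] m(2) by (simp add: dvd_eq_mod_eq_0)
  then have "fixed \<noteq> {}" by auto
  then obtain S where "S \<in> fixed" by blast
  then have S: "S \<in> ?\<Omega>" "\<And>r. r \<in> R \<Longrightarrow> (*) r ` S = S" by (simp_all add: fixed_def)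
  from S(1) obtain g where g: "g \<in> H" "S = (*) g ` Q" by auto
  have "inverse g * r * g \<in> Q" if "r \<in> R" for r
  proof -
    have "g * 1 \<in> S" using g(2) sgpD(2)[OF Q'(1)] by blast
    then have "r * g \<in> (*) g ` Q" using S(2)[OF that] g(2) by (metis imageI mult_1_right)
    then show ?thesis by (auto simp: mult.assoc)
  qed
  then have "R \<subseteq> conj_set g Q" by (auto simp: mem_conj_set)
  then show thesis using that g(1) by blast
qed

lemma sylows_conjugate:
  assumes H: "sgp H" and p: "prime p" and Q: "Q \<in> sylows p H" "R \<in> sylows p H"
  obtains g where "g \<in> H" "R = conj_set g Q"
proof -
  have R: "sgp R" "R \<subseteq> H" "card R = p ^ multiplicity p (card H)" using Q(2) by (auto simp: sylows_def)
  obtain g where g: "g \<in> H" "R \<subseteq> conj_set g Q" using subset_sylow[OF H p Q(1) R] .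
  have "card R = card (conj_set g Q)" using R Q by (auto simp: sylows_def)
  moreover have "finite (conj_set g Q)" using Q by (auto simp: sylows_def sgpD(1) sgp_conj_set)
  ultimately have "R = conj_set g Q" using g(2) card_subset_eq by blast
  then show thesis using that g(1) by blast
qed

text \<open>\<open>Q\<close> is a Sylow subgroup of its own normalizer, where it coincides with all
  its conjugates; \<open>subset_sylow\<close> applied inside the normalizer gives the
  inclusion.\<close>

lemma p_subgroup_normalizing:
  assumes H: "sgp H" and p: "prime p" and Q: "Q \<in> sylows p H"
    and R: "sgp R" "R \<subseteq> nrm H Q" "card R = p ^ k"
  shows "R \<subseteq> Q"
proof -
  have Q': "sgp Q" "Q \<subseteq> H" "card Q = p ^ multiplicity p (card H)" using Q by (auto simp: sylows_def)
  have N: "sgp (nrm H Q)" using sgp_nrm[OF H] .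
  have QN: "Q \<subseteq> nrm H Q" using subset_nrm Q' by blast
  have "card Q dvd card (nrm H Q)" "card (nrm H Q) dvd card H"
    using lagrange_sgp N H Q' QN nrm_subset by metis+
  then have "multiplicity p (card (nrm H Q)) = multiplicity p (card H)"
    using Q'(3) sgp_card_pos[OF N] sgp_card_pos[OF H] p
    by (intro antisym dvd_imp_multiplicity_le multiplicity_geI) auto
  then have "Q \<in> sylows p (nrm H Q)" using Q' QN by (simp add: sylows_def)
  then obtain g where "g \<in> nrm H Q" "R \<subseteq> conj_set g Q" using subset_sylow[OF N p _ R] by blast
  then show ?thesis by (simp add: nrm_def)
qed

lemma p_element_normalizing:
  assumes H: "sgp H" and p: "prime p" and Q: "Q \<in> sylows p H"
    and x: "x \<in> nrm H Q" "x ^ (p ^ j) = 1"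
  shows "x \<in> Q"
proof -
  have P: "sgp (powers x)" using sgp_powers[OF sgp_nrm[OF H] x(1)] .
  have "y ^ (p ^ j) = 1" if "y \<in> powers x" for y
    using that x(2) by (auto simp: powers_def) (metis mult.commute power_mult power_one)
  then obtain k where "card (powers x) = p ^ k" using card_prime_power[OF P p] by blast
  then have "powers x \<subseteq> Q"
    using p_subgroup_normalizing[OF H p Q P powers_subset[OF sgp_nrm[OF H] x(1)]] by blast
  then show ?thesis using powers_self by blast
qed

text \<open>The equation is orbit-stabilizer for the transitive conjugation action. For the
  congruence \<open>Q\<close> itself acts: a Sylow subgroup fixed by \<open>Q\<close> is normalized
  by it, hence equal to it, so \<open>Q\<close> is the only fixed point.\<close>

lemma card_sylows:
  assumes H: "sgp H" and p: "prime p" and Q: "Q \<in> sylows p H"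
  shows "card (sylows p H) * card (nrm H Q) = card H" "card (sylows p H) mod p = 1"
proof -
  have Q': "sgp Q" "Q \<subseteq> H" "card Q = p ^ multiplicity p (card H)" using Q by (auto simp: sylows_def)
  interpret A: action H "sylows p H" conj_set using conj_action[OF H _ H] by simp
  have "A.orb Q = sylows p H"
    using A.orb_subset[OF Q] by (auto simp: A.orb_def elim: sylows_conjugate[OF H p Q])
  moreover have "A.stab Q = nrm H Q" by (simp add: A.stab_def nrm_def)
  ultimately show "card (sylows p H) * card (nrm H Q) = card H" using A.orbit_stabilizer[OF Q] by simp
  interpret B: action Q "sylows p H" conj_set using conj_action[OF H Q'(2,1)] .
  have "B.fixed = {Q}"
  proof
    show "{Q} \<subseteq> B.fixed" using Q conj_set_self[OF Q'(1)] by (auto simp: B.fixed_def)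
    show "B.fixed \<subseteq> {Q}"
    proof
      fix R assume R: "R \<in> B.fixed"
      then have R': "R \<in> sylows p H" "Q \<subseteq> nrm H R" using Q'(2) by (auto simp: B.fixed_def nrm_def)
      then have "Q \<subseteq> R" using p_subgroup_normalizing[OF H p R'(1) Q'(1) _ Q'(3)] by blast
      then show "R \<in> {Q}" using R'(1) Q'(3) by (auto simp: sylows_def dest: sgp_eq_if_card_eq)
    qed
  qed
  then show "card (sylows p H) mod p = 1"
    using B.card_fixed_cong[OF p Q'(3)] prime_gt_1_nat[OF p] by simp
qed

subsection \<open>Local structure forced by the identities\<close>

definition good :: "'a::group_mult set \<Rightarrow> bool" where
  "good H \<longleftrightarrow> sgp H \<and> A6_basis (group_of H)"

lemma good_sgp: "good H \<Longrightarrow> sgp H"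
  by (simp add: good_def)

lemma group_of_simps [simp]:
  "carrier (group_of H) = H" "x \<otimes>\<^bsub>group_of H\<^esub> y = x * y" "\<one>\<^bsub>group_of H\<^esub> = 1"
  by (simp_all add: group_of_def)

lemma inv_group_of: "sgp H \<Longrightarrow> x \<in> H \<Longrightarrow> inv\<^bsub>group_of H\<^esub> x = inverse x"
  by (rule group.inv_equality[OF group_group_of]) (simp_all add: sgpD)

lemma good_subgroup:
  assumes "good H" "sgp K" "K \<subseteq> H" shows "good K"
proof -
  have sub: "\<And>x. x \<in> K \<Longrightarrow> x \<in> H" using assms(3) by blast
  have H: "sgp H" "A6_basis (group_of H)" using assms(1) by (auto simp: good_def)
  note u = group_of_simps pow_group_of theta_def in_pow3_def
  have d: "dId1 (group_of H)" "dId2 (group_of H)" "dId3 (group_of H)" "dId4 (group_of H)"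
    "dId5 (group_of H)" "dId6 (group_of H)" "dId7 (group_of H)"
    using H(2) by (simp_all add: A6_basis_def)
  have "dId1 (group_of K)"
    unfolding dId1_def u
  proof (intro allI impI)
    fix x :: "nat \<Rightarrow> 'a" assume "\<forall>i\<le>360. x i \<in> K"
    then have "\<forall>i\<le>360. x i \<in> H" using sub by blast
    then show "\<exists>i j. i < j \<and> j \<le> 360 \<and> x i = x j"
      by (rule d(1)[unfolded dId1_def u, THEN spec, THEN mp])
  qed
  moreover have "dId3 (group_of K)"
    unfolding dId3_def u
    by (intro allI impI d(3)[unfolded dId3_def u, THEN spec, THEN mp]) (use sub in blast)
  moreover have "dId5 (group_of K)"
    unfolding dId5_def u
    by (intro allI impI d(5)[unfolded dId5_def u, THEN spec, THEN mp]) (use sub in blast)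
  moreover have "dId2 (group_of K)" using d(2) sub unfolding dId2_def u by blast
  moreover have "dId4 (group_of K)" using d(4) sub unfolding dId4_def u by blast
  moreover have "dId7 (group_of K)" using d(7) sub unfolding dId7_def u by blast
  \<comment> \<open>(6) is the only identity with an inverse, and \<open>inv\<close> refers to the
    carrier; in both groups its value is \<open>inverse\<close>.\<close>
  moreover have "dId6 (group_of K)"
    unfolding dId6_def u
  proof (intro ballI)
    fix x y assume "x \<in> K" "y \<in> K"
    then show "x ^ 12 = 1 \<or> y ^ 30 = 1 \<or> (x * inv\<^bsub>group_of K\<^esub> y * x * y) ^ 12 = 1 \<or>
        (x * inv\<^bsub>group_of K\<^esub> y * x ^ 3 * y) ^ 12 = 1 \<or> (x ^ 2 * inv\<^bsub>group_of K\<^esub> y * x * y) ^ 12 = 1"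
      using d(6)[unfolded dId6_def u, rule_format, of x y] sub inv_group_of[OF H(1), of y]
        inv_group_of[OF assms(2), of y] by simp
  qed
  ultimately show ?thesis using assms(2) by (simp add: good_def A6_basis_def)
qed

lemma good_ord: "good H \<Longrightarrow> x \<in> H \<Longrightarrow> x ^ 3 = 1 \<or> x ^ 4 = 1 \<or> x ^ 5 = 1"
  by (simp add: good_def A6_basis_def dId2_def pow_group_of)

lemma power_3_4: "x ^ 3 = 1 \<Longrightarrow> x ^ 4 = 1 \<Longrightarrow> x = (1::'a::group_mult)"
  by (rule power_coprime_eq_1[of x 3 4]) (simp_all add: coprime_iff_gcd_eq_1 gcd_non_0_nat)

lemma power_3_5: "x ^ 3 = 1 \<Longrightarrow> x ^ 5 = 1 \<Longrightarrow> x = (1::'a::group_mult)"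
  by (rule power_coprime_eq_1[of x 3 5]) (simp_all add: coprime_iff_gcd_eq_1 gcd_non_0_nat)

lemma power_4_15: "x ^ 4 = 1 \<Longrightarrow> x ^ 15 = 1 \<Longrightarrow> x = (1::'a::group_mult)"
  by (rule power_coprime_eq_1[of x 4 15]) (simp_all add: coprime_iff_gcd_eq_1 gcd_non_0_nat)

lemma power_5_12: "x ^ 5 = 1 \<Longrightarrow> x ^ 12 = 1 \<Longrightarrow> x = (1::'a::group_mult)"
  by (rule power_coprime_eq_1[of x 5 12]) (simp_all add: coprime_iff_gcd_eq_1 gcd_non_0_nat)

lemma power_3_20: "x ^ 3 = 1 \<Longrightarrow> x ^ 20 = 1 \<Longrightarrow> x = (1::'a::group_mult)"
  by (rule power_coprime_eq_1[of x 3 20]) (simp_all add: coprime_iff_gcd_eq_1 gcd_non_0_nat)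

lemma power_4_30: assumes "x ^ 4 = 1" "x ^ 30 = 1" shows "x ^ 2 = (1::'a::group_mult)"
  using power_mod_order[OF assms(1), of 30] assms(2) by simp

lemma good_order_5_pair:
  assumes "good H" "x \<in> H" "x ^ 5 = 1" "x \<noteq> 1" "y \<in> H" "y ^ 5 = 1" "y \<noteq> 1"
  obtains d where "d \<in> {1..4}" "(x * y ^ d) ^ 12 = 1"
proof -
  have "x ^ 12 \<noteq> 1" "y ^ 12 \<noteq> 1" using power_5_12 assms by blast+
  moreover have "dId7 (group_of H)" using assms(1) by (simp add: good_def A6_basis_def)
  ultimately show thesis using assms(2,5) that by (force simp: dId7_def pow_group_of)
qed

lemma good_order_5_4:
  assumes "good H" "f \<in> H" "f ^ 5 = 1" "f \<noteq> 1" "t \<in> H" "t ^ 4 = 1" "t ^ 2 \<noteq> 1"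
  shows "(f * inverse t * f * t) ^ 12 = 1 \<or> (f * inverse t * f ^ 3 * t) ^ 12 = 1 \<or>
    (f ^ 2 * inverse t * f * t) ^ 12 = 1"
proof -
  have "f ^ 12 \<noteq> 1" "t ^ 30 \<noteq> 1" using power_5_12 power_4_30 assms by blast+
  moreover have d: "dId6 (group_of H)" using assms(1) by (simp add: good_def A6_basis_def)
  ultimately show ?thesis
    using bspec[OF bspec[OF d[unfolded dId6_def group_of_simps pow_group_of] assms(2)] assms(5)]
    by (simp add: inv_group_of[OF good_sgp[OF assms(1)] assms(5)])
qed

lemma good_order_4_pair:
  assumes "good H" "x \<in> H" "x ^ 4 = 1" "x ^ 2 \<noteq> 1" "y \<in> H" "y ^ 4 = 1" "y ^ 2 \<noteq> 1"
  shows "(x * y) ^ 15 = 1 \<or> (x * y ^ 2) ^ 15 = 1 \<or> (x * y ^ 3) ^ 15 = 1"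
proof -
  have "x ^ 30 \<noteq> 1" "y ^ 30 \<noteq> 1" using power_4_30 assms by blast+
  moreover have "dId4 (group_of H)" using assms(1) by (simp add: good_def A6_basis_def)
  ultimately show ?thesis using assms(2,5) by (auto simp: dId4_def pow_group_of)
qed

lemma involution_powers:
  fixes u :: "'a::group_mult" assumes "u ^ 2 = 1" shows "u ^ 3 = u" "u ^ 15 = u"
  using power_mod_order[OF assms, of 3] power_mod_order[OF assms, of 15] by simp_all

lemma commuting_power_mult:
  fixes x y :: "'a::monoid_mult" assumes "x * y = y * x" shows "(x * y) ^ n = x ^ n * y ^ n"
proof (induct n)
  case (Suc n)
  have "y * x ^ n = x ^ n * y" using power_commuting_commutes[OF assms, of n] by simp
  then show ?case using Suc by (simp add: mult.assoc) (simp flip: mult.assoc)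
qed simp

text \<open>Three independent commuting involutions contradict (5). The powers of an involution up
  to the third are 1 and itself, so every disjunct of \<open>theta\<close> would express a
  dependence among \<open>x\<close>, \<open>y\<close>, \<open>z\<close>; and an involution is its
  own 15th power.\<close>

lemma good_no_rank_3:
  assumes "good H" and H: "x \<in> H" "y \<in> H" "z \<in> H"
    and sq: "x ^ 2 = 1" "y ^ 2 = 1" "z ^ 2 = 1"
    and com: "x * y = y * x" "x * z = z * x" "y * z = z * y"
    and ne: "x \<noteq> 1" "y \<noteq> 1" "x \<noteq> y" "z \<notin> {1, x, y, x * y}"
  shows False
proof -
  \<comment> \<open>The catch-all value \<open>z\<close> stands for index 3; the indices outside 1
    to 3 are never read.\<close>
  define w where "w = (\<lambda>i::nat. if i = 1 then x else if i = 2 then y else z)"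
  have w: "w 1 = x" "w (Suc 0) = x" "w 2 = y" "w 3 = z" by (simp_all add: w_def)
  have inv: "inverse x = x" "inverse y = y" "inverse z = z"
    using sq by (simp_all add: power2_eq_square mult_eq_one_iff)
  have pr: "(x * y) ^ 2 = 1" "(x * z) ^ 2 = 1" "(y * z) ^ 2 = 1"
    using com sq by (simp_all add: commuting_power_mult)
  have d: "dId5 (group_of H)" using assms(1) by (simp add: good_def A6_basis_def)
  have s: "{1..3::nat} = {1,2,3}" by auto
  have ne': "x \<noteq> z" "y \<noteq> z" "z \<noteq> x * y" using ne by auto
  moreover have "x \<noteq> y * z" "y \<noteq> x * z" "x * y \<noteq> y * z"
    using ne' com eq_inverse_mult_iff[of x y z] eq_inverse_mult_iff[of y x z] inv by auto
  moreover have "x * y \<noteq> 1" "x * z \<noteq> 1" "y * z \<noteq> 1"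
    using ne ne' inv by (auto simp: mult_eq_one_iff)
  ultimately have "\<not> theta (group_of H) w"
    unfolding theta_def in_pow3_def s
    using ne sq pr com[symmetric] involution_powers[OF sq(1)] involution_powers[OF sq(2)] involution_powers[OF sq(3)]
      involution_powers[OF pr(1)] involution_powers[OF pr(2)] involution_powers[OF pr(3)]
    by (simp add: pow_group_of w)
  moreover have "x ^ 15 \<noteq> 1" "y ^ 15 \<noteq> 1" "z ^ 15 \<noteq> 1" "(x * y) ^ 15 \<noteq> 1" "(x * z) ^ 15 \<noteq> 1" "(y * z) ^ 15 \<noteq> 1"
    using ne involution_powers[OF sq(1)] involution_powers[OF sq(2)] involution_powers[OF sq(3)]
      involution_powers[OF pr(1)] involution_powers[OF pr(2)] involution_powers[OF pr(3)]
    by (auto simp: mult_eq_one_iff inv)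
  ultimately show False
    using d H unfolding dId5_def s
    by (auto simp: pow_group_of w sq involution_powers com[symmetric] dest!: spec[of _ w])
qed

subsubsection \<open>Element orders and Sylow subgroups\<close>

text \<open>The exponents 3, 4, 5 are pairwise coprime, so the product of commuting nontrivial
  elements with different exponents would have an order excluded by (2). In
  \<open>(x * y) ^ k = 1\<close> one factor disappears if \<open>k = n\<close>; otherwise raising to
  the power \<open>m\<close> isolates \<open>y\<close>.\<close>

lemma good_commute:
  assumes "good H" "x \<in> H" "y \<in> H" "x * y = y * x" "x \<noteq> 1" "y \<noteq> 1"
    and mn: "x ^ m = 1" "y ^ n = 1" "m \<in> {3,4,5}" "n \<in> {3,4,5}"
  shows "m = n"
proof (rule ccontr)
  assume "m \<noteq> n"
  have cop: "coprime i j" if "i \<in> {3,4,5}" "j \<in> {3,4,5}" "i \<noteq> j" for i j :: nat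
    using that by (auto simp: coprime_iff_gcd_eq_1 gcd_non_0_nat)
  have "x * y \<in> H" using assms by (simp add: sgpD good_sgp)
  then obtain k where k: "k \<in> {3,4,5::nat}" "(x * y) ^ k = 1" using good_ord[OF assms(1)] by blast
  then have e: "x ^ k * y ^ k = 1" using commuting_power_mult[OF assms(4)] by simp
  show False
  proof (cases "k = n")
    case True
    then have "x ^ n = 1" using e mn by simp
    then show False using power_coprime_eq_1[OF mn(1) _ cop[OF mn(3,4) \<open>m \<noteq> n\<close>]] assms by blast
  next
    case False
    have "(x ^ k * y ^ k) ^ m = x ^ (k * m) * y ^ (k * m)"
      using commuting_power_mult[OF commute_power[OF assms(4)]] by (simp add: power_mult)
    then have "y ^ (k * m) = 1" using e mn(1) by (simp add: mult.commute[of k m] power_mult)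
    moreover have "coprime n (k * m)" using cop mn k \<open>m \<noteq> n\<close> False by (metis coprime_mult_right_iff)
    ultimately show False using power_coprime_eq_1[OF mn(2)] assms by blast
  qed
qed

text \<open>For an element of \<open>p\<close>-power order only one of the three exponents in (2)
  remains, since \<open>p\<close> is prime to the other two.\<close>

lemma prime_power_order:
  assumes "good H" "x \<in> H" "x ^ (p ^ k) = 1" "(p, n) \<in> {(2, 4), (3, 3), (5, 5)}"
  shows "x ^ n = 1"
proof -
  have "coprime (p ^ k) m" if "m \<in> {3,4,5}" "m \<noteq> n" for m
  proof -
    have "coprime p m" using that assms(4) by (auto simp: coprime_iff_gcd_eq_1 gcd_non_0_nat)
    then show ?thesis by simp
  qed
  then show ?thesis
    using good_ord[OF assms(1,2)] power_coprime_eq_1[OF assms(3)] by (metis insertCI power_one)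
qed

text \<open>If some \<open>u\<close> in \<open>Q\<close> outside \<open>powers t\<close> had order
  4, (4) would make one of \<open>t * u\<close>, \<open>t * u ^ 2\<close>, \<open>t * u ^ 3\<close>
  an element with 15th and fourth power 1, hence trivial; each case contradicts the choice of
  \<open>u\<close> or the order of \<open>t\<close>. Applied to \<open>y\<close> and to
  \<open>y * t\<close>, this gives \<open>(y * t) ^ 2 = 1\<close> and \<open>y ^ 2 = 1\<close>, so
  \<open>y\<close> inverts \<open>t\<close>.\<close>

lemma order_4_unique:
  assumes "good H" "sgp Q" "Q \<subseteq> H" and Q: "\<And>x. x \<in> Q \<Longrightarrow> x ^ 4 = 1"
    and t: "t \<in> Q" "t ^ 2 \<noteq> 1" and y: "y \<in> Q" "y \<notin> powers t"
  shows "y ^ 2 = 1" "conj_by y t = inverse t"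
proof -
  have key: "u ^ 2 = 1" if u: "u \<in> Q" "u \<notin> powers t" for u
  proof (rule ccontr)
    assume "u ^ 2 \<noteq> 1"
    then have "(t * u) ^ 15 = 1 \<or> (t * u ^ 2) ^ 15 = 1 \<or> (t * u ^ 3) ^ 15 = 1"
      using good_order_4_pair[OF assms(1)] t u Q assms(3) by blast
    moreover have "t * u \<in> Q" "t * u ^ 2 \<in> Q" "t * u ^ 3 \<in> Q"
      using t u assms(2) by (simp_all add: sgpD sgp_power)
    ultimately have c: "t * u = 1 \<or> t * u ^ 2 = 1 \<or> t * u ^ 3 = 1" using Q power_4_15 by metis
    have t4: "t ^ 4 = 1" and u4: "u ^ 4 = 1" using Q t u by auto
    have "t * t ^ 3 = 1" using t4 by (simp flip: power_Suc)
    then have ti: "inverse t = t ^ 3" by (simp add: mult_eq_one_iff)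
    from c show False
    proof (elim disjE)
      assume "t * u = 1"
      then have "u = t ^ 3" by (simp add: mult_eq_one_iff ti)
      then show False using u by (auto simp: powers_def)
    next
      assume "t * u ^ 2 = 1"
      then have "u ^ 2 = inverse t" by (simp add: mult_eq_one_iff)
      then have "(u ^ 2) ^ 2 = inverse (t ^ 2)" by (simp add: inverse_power_group)
      then show False using u4 t by (simp flip: power_mult)
    next
      assume "t * u ^ 3 = 1"
      moreover have "u ^ 3 * u = 1" using u4 by (simp flip: power_Suc2)
      ultimately have "t = u" by (metis mult.assoc mult_1_left mult_1_right)
      then show False using u powers_self by blast
    qed
  qed
  show y2: "y ^ 2 = 1" using key y by blast
  have "y * t \<notin> powers t"
    using sgp_mult_iff(2)[OF sgp_powers[OF assms(2) t(1)] powers_self] y by blast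
  then have "(y * t) ^ 2 = 1" using key y t sgpD[OF assms(2)] by blast
  then have "y * t * (y * t) = 1" by (simp add: power2_eq_square)
  then have "y * t * y = inverse t" by (metis mult.assoc mult_eq_one_iff inverse_mult_distrib_group inverse_inverse_mult
    eq_mult_inverse_iff mult_1_left)
  moreover have "inverse y = y" using y2 by (simp add: power2_eq_square mult_eq_one_iff)
  ultimately show "conj_by y t = inverse t" by simp
qed

text \<open>Exponent 2 would allow three independent involutions, so some \<open>t\<close> has order
  4. All elements of \<open>Q\<close> outside \<open>powers t\<close> invert \<open>t\<close>, which
  makes \<open>powers t\<close> a subgroup of index at most 2.\<close>

lemma two_group_card:
  assumes "good H" "sgp Q" "Q \<subseteq> H" and Q: "\<And>x. x \<in> Q \<Longrightarrow> x ^ 4 = 1" and c: "card Q \<ge> 8"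
  obtains t y where "t \<in> Q" "t ^ 2 \<noteq> 1" "y \<in> Q" "y \<notin> powers t" "card Q = 8"
proof -
  have "\<exists>t\<in>Q. t ^ 2 \<noteq> 1"
  proof (rule ccontr)
    assume "\<not> (\<exists>t\<in>Q. t ^ 2 \<noteq> 1)"
    then have inv: "x ^ 2 = 1" if "x \<in> Q" for x using that by blast
    have com: "x * y = y * x" if "x \<in> Q" "y \<in> Q" for x y
    proof -
      have "inverse u = u" if "u \<in> Q" for u
        using inv[OF that] by (simp add: power2_eq_square mult_eq_one_iff)
      from this[of "x * y"] this[of x] this[of y] show ?thesis using that sgpD(3)[OF assms(2)] by simp
    qed
    \<comment> \<open>Three independent involutions are picked greedily: the subgroup generated so
      far never has 8 elements.\<close>
    have ex: "\<exists>z\<in>Q. z \<notin> S" if S: "finite S" "card S < 8" for S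
    proof (rule ccontr)
      assume "\<not> (\<exists>z\<in>Q. z \<notin> S)"
      then have "Q \<subseteq> S" by blast
      then have "card Q \<le> card S" by (rule card_mono[OF S(1)])
      then show False using S(2) c by simp
    qed
    obtain x where x: "x \<in> Q" "x \<notin> {1}" using ex[of "{1}"] by auto
    have "card {1, x} < 8" by (simp add: card_insert_if)
    then obtain y where y: "y \<in> Q" "y \<notin> {1, x}" using ex[of "{1, x}"] by auto
    have "card {1, x, y, x * y} < 8" by (simp add: card_insert_if) 
    then obtain z where z: "z \<in> Q" "z \<notin> {1, x, y, x * y}" using ex[of "{1, x, y, x * y}"] by auto
    show False
      using good_no_rank_3[OF assms(1), of x y z] x y z assms(3) inv com by blast
  qed
  then obtain t where t: "t \<in> Q" "t ^ 2 \<noteq> 1" by blast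
  have P: "sgp (powers t)" "powers t \<subseteq> Q" using sgp_powers powers_subset assms(2) t by blast+
  have P4: "card (powers t) \<le> 4"
    using powers_eq[of t 4] Q t card_image_le[of "{..<4::nat}" "\<lambda>i. t ^ i"] by simp
  have "\<not> Q \<subseteq> powers t"
  proof
    assume "Q \<subseteq> powers t"
    then have "card Q \<le> card (powers t)" by (rule card_mono[OF sgpD(1)[OF P(1)]])
    then show False using P4 c by simp
  qed
  then obtain y where y: "y \<in> Q" "y \<notin> powers t" by blast
  have "Q \<subseteq> powers t \<union> (*) y ` powers t"
  proof
    fix z assume z: "z \<in> Q"
    have "z \<in> (*) y ` powers t" if nz: "z \<notin> powers t"
    proof -
      \<comment> \<open>Both \<open>y\<close> and \<open>z\<close> invert \<open>t\<close>, so
        \<open>inverse y * z\<close> commutes with \<open>t\<close>; outside \<open>powers t\<close>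
        it would have to invert \<open>t\<close> as well, forcing \<open>t ^ 2 = 1\<close>.\<close>
      have "inverse y * z \<in> powers t"
      proof (rule ccontr)
        assume n: "inverse y * z \<notin> powers t"
        have q: "inverse y * z \<in> Q" using y z sgpD[OF assms(2)] by blast
        have 1: "conj_by y t = inverse t" "conj_by z t = inverse t" "conj_by (inverse y * z) t = inverse t"
          using order_4_unique(2)[OF assms(1-3) Q t] y z nz n q by blast+
        have "conj_by z t = conj_by y (conj_by (inverse y * z) t)" by (simp add: mult.assoc)
        also have "\<dots> = conj_by y (inverse t)" using 1(3) by simp
        also have "\<dots> = inverse (conj_by y t)" by (simp add: mult.assoc)
        also have "\<dots> = t" using 1(1) by simp
        finally have "t = inverse t" using 1(2) by simp
        then show False using t by (simp add: power2_eq_square mult_eq_one_iff)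
      qed
      then show ?thesis by (intro image_eqI[of _ _ "inverse y * z"]) simp_all
    qed
    then show "z \<in> powers t \<union> (*) y ` powers t" by blast
  qed
  then have "card Q \<le> card (powers t \<union> (*) y ` powers t)" using sgpD(1)[OF P(1)] by (intro card_mono) auto
  also have "\<dots> \<le> card (powers t) + card ((*) y ` powers t)" by (rule card_Un_le)
  also have "\<dots> \<le> 4 + 4" using P4 card_image_le[OF sgpD(1)[OF P(1)], of "(*) y"] by linarith
  finally have "card Q = 8" using c by simp
  then show thesis using that t y by blast
qed

text \<open>For \<open>r\<close> of order 5, (7) yields \<open>d\<close> such that
  \<open>r * f ^ d\<close> has 12th power 1. Its fifth power is 1 too, so it is trivial and
  \<open>r\<close> is a power of \<open>f\<close>.\<close>

lemma order_5_unique: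
  assumes "good H" "sgp Q" "Q \<subseteq> H" and Q: "\<And>x. x \<in> Q \<Longrightarrow> x ^ 5 = 1" and f: "f \<in> Q" "f \<noteq> 1"
  shows "Q = powers f"
proof
  show "Q \<subseteq> powers f"
  proof
    fix r assume r: "r \<in> Q"
    show "r \<in> powers f"
    proof (cases "r = 1")
      case True then show ?thesis using sgpD(2)[OF sgp_powers[OF assms(2) f(1)]] by simp
    next
      case False
      have "r \<in> H" "f \<in> H" using r f(1) assms(3) by auto
      then obtain d where d: "(r * f ^ d) ^ 12 = 1"
        using good_order_5_pair[OF assms(1) _ Q[OF r] False _ Q[OF f(1)] f(2)] by metis
      have "r * f ^ d \<in> Q" using r f assms(2) by (simp add: sgpD sgp_power)
      then have "r * f ^ d = 1" using d Q power_5_12 by blast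
      then have "r = inverse (f ^ d)" by (metis eq_mult_inverse_iff mult_1_left)
      then show ?thesis
        using sgp_powers[OF assms(2) f(1)] powers_self[of f] by (simp add: sgpD sgp_power)
    qed
  qed
qed (use powers_subset assms(2) f in blast)

text \<open>Nine nontrivial elements that are pairwise neither equal nor inverse refute (3): all
  products \<open>x i * x j\<close> and \<open>x i * x j ^ 2\<close> are nontrivial elements of
  \<open>Q\<close>, hence of order 3. A group of order 27 and exponent 3 would offer 13 of
  them.\<close>

lemma elementary_3_card:
  assumes "good H" "sgp Q" "Q \<subseteq> H" and Q: "\<And>x. x \<in> Q \<Longrightarrow> x ^ 3 = 1"
  shows "card Q < 27"
proof (rule ccontr)
  assume "\<not> card Q < 27"
  then have c: "card Q \<ge> 27" by simp
  \<comment> \<open>Greedy choice: when at most 8 elements have been chosen, these, their inverses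
    and 1 exclude at most 17 of at least 27 elements.\<close>
  have "\<exists>w. (\<forall>i<n. w i \<in> Q \<and> w i \<noteq> 1) \<and> (\<forall>i<n. \<forall>j<i. w i \<noteq> w j \<and> w i \<noteq> inverse (w j))"
    if "n \<le> 9" for n :: nat
    using that
  proof (induct n)
    case (Suc n)
    then obtain w where w: "\<forall>i<n. w i \<in> Q \<and> w i \<noteq> 1" "\<forall>i<n. \<forall>j<i. w i \<noteq> w j \<and> w i \<noteq> inverse (w j)"
      by auto
    let ?S = "insert 1 (w ` {..<n} \<union> (\<lambda>i. inverse (w i)) ` {..<n})"
    have "card (w ` {..<n} \<union> (\<lambda>i. inverse (w i)) ` {..<n}) \<le> card (w ` {..<n}) + card ((\<lambda>i. inverse (w i)) ` {..<n})"
      by (rule card_Un_le)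
    also have "\<dots> \<le> n + n"
      using card_image_le[of "{..<n}" w] card_image_le[of "{..<n}" "\<lambda>i. inverse (w i)"] by simp
    finally have "card ?S \<le> Suc (n + n)" by (simp add: card_insert_if)
    then have lt: "card ?S < card Q" using c Suc(2) by simp
    have "\<not> Q \<subseteq> ?S"
    proof
      assume "Q \<subseteq> ?S"
      then have "card Q \<le> card ?S" by (intro card_mono) auto
      then show False using lt by simp
    qed
    then obtain z where "z \<in> Q" "z \<notin> ?S" by blast
    then show ?case using w by (intro exI[of _ "w(n := z)"]) (auto simp: less_Suc_eq)
  qed simp
  then obtain w where "(\<forall>i<9. w i \<in> Q \<and> w i \<noteq> 1) \<and> (\<forall>i<9::nat. \<forall>j<i. w i \<noteq> w j \<and> w i \<noteq> inverse (w j))"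
    by blast
  then have w: "\<And>i. i < 9 \<Longrightarrow> w i \<in> Q" "\<And>i. i < 9 \<Longrightarrow> w i \<noteq> 1"
    "\<And>i j. i < 9 \<Longrightarrow> j < i \<Longrightarrow> w i \<noteq> w j \<and> w i \<noteq> inverse (w j)" by blast+
  \<comment> \<open>Shift from the indices 0 to 8 of \<open>w\<close> to the indices 1 to 9 of
    (3).\<close>
  define x where "x = (\<lambda>i. w (i - 1))"
  have x: "x i \<in> Q" "x i \<noteq> 1" if "i \<in> {1..9}" for i using w(1,2) that by (auto simp: x_def)
  have y: "x i \<noteq> x j" "x i \<noteq> inverse (x j)" if "i \<in> {1..9}" "j \<in> {1..9}" "i < j" for i j
  proof -
    have "w (j - 1) \<noteq> w (i - 1)" "w (j - 1) \<noteq> inverse (w (i - 1))"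
      using w(3)[of "j - 1" "i - 1"] that by (simp_all add: diff_less_mono)
    then show "x i \<noteq> x j" "x i \<noteq> inverse (x j)" unfolding x_def by (metis, metis inverse_inverse_mult)
  qed
  have p: "(x i * x j) ^ 20 \<noteq> 1" "(x i * x j ^ 2) ^ 20 \<noteq> 1" if "i \<in> {1..9}" "j \<in> {1..9}" "i < j" for i j
  proof -
    have 3: "x j * x j ^ 2 = 1" using Q x that by (simp flip: power_Suc)
    have "x i * x j \<noteq> 1" using y(2)[OF that] by (metis eq_mult_inverse_iff mult_1_left)
    moreover have "x i * x j ^ 2 \<noteq> 1"
      using y(1)[OF that] 3 by (metis mult_right_cancel_group)
    moreover have "x i * x j \<in> Q" "x i * x j ^ 2 \<in> Q" using x that assms(2) by (simp_all add: sgpD sgp_power)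
    ultimately show "(x i * x j) ^ 20 \<noteq> 1" "(x i * x j ^ 2) ^ 20 \<noteq> 1" using Q power_3_20 by blast+
  qed
  have q: "x i ^ 20 \<noteq> 1" if "i \<in> {1..9}" for i using x[OF that] Q power_3_20 by blast
  have "dId3 (group_of H)" using assms(1) by (simp add: good_def A6_basis_def)
  moreover have "\<forall>i\<in>{1..9}. x i \<in> H" using x(1) assms(3) by blast
  ultimately show False
    unfolding dId3_def group_of_simps pow_group_of using p q y(1) by blast
qed

lemma p_subgroup_order:
  assumes "good H" "sgp Q" "Q \<subseteq> H" "card Q = p ^ k" "x \<in> Q" "(p, n) \<in> {(2, 4), (3, 3), (5, 5)}"
  shows "x ^ n = 1"
proof -
  have "x ^ (p ^ k) = 1" using power_card_eq_1[OF assms(2,5)] assms(4) by simp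
  then show ?thesis using prime_power_order[OF assms(1) _ _ assms(6)] assms(3,5) by blast
qed

text \<open>A divisor 16, 27 or 25 would provide a subgroup of that order, against
  \<open>two_group_card\<close>, \<open>elementary_3_card\<close> or \<open>order_5_unique\<close>;
  a prime beyond 5 would provide an element of that order, against (2). As 360 = 8 * 9 * 5,
  comparing multiplicities gives the divisibility.\<close>

lemma good_card_dvd:
  assumes "good H" shows "card H dvd 360" "\<not> 16 dvd card H" "\<not> 27 dvd card H" "\<not> 25 dvd card H"
proof -
  note H = good_sgp[OF assms]
  show n16: "\<not> 16 dvd card H"
  proof
    assume "16 dvd card H"
    then obtain Q where Q: "sgp Q" "Q \<subseteq> H" "card Q = 2 ^ 4" using exists_sylow[OF H, of 2 4] by auto
    have o: "x ^ 4 = 1" if "x \<in> Q" for x using p_subgroup_order[OF assms Q that] by simp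
    have "card Q \<ge> 8" using Q(3) by simp
    then show False using two_group_card[OF assms Q(1,2) o] Q(3) by fastforce
  qed
  show n27: "\<not> 27 dvd card H"
  proof
    assume "27 dvd card H"
    then obtain Q where Q: "sgp Q" "Q \<subseteq> H" "card Q = 3 ^ 3" using exists_sylow[OF H, of 3 3] by auto
    have o: "x ^ 3 = 1" if "x \<in> Q" for x using p_subgroup_order[OF assms Q that] by simp
    show False using elementary_3_card[OF assms Q(1,2) o] Q(3) by simp
  qed
  show n25: "\<not> 25 dvd card H"
  proof
    assume "25 dvd card H"
    then obtain Q where Q: "sgp Q" "Q \<subseteq> H" "card Q = 5 ^ 2" using exists_sylow[OF H, of 5 2] by auto
    have o: "x ^ 5 = 1" if "x \<in> Q" for x using p_subgroup_order[OF assms Q that] by simp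
    obtain f where f: "f \<in> Q" "f \<noteq> 1" using exists_prime_order[OF Q(1), of 5] Q(3) by auto
    have "card (powers f) = 5" using card_powers_prime[of 5 f] f o by simp
    then show False using order_5_unique[OF assms Q(1,2) o f] Q(3) by simp
  qed
  have pr: "p \<in> {2, 3, 5}" if p: "prime p" "p dvd card H" for p
  proof (rule ccontr)
    assume n: "p \<notin> {2, 3, 5}"
    obtain x where x: "x \<in> H" "x \<noteq> 1" "x ^ p = 1" using exists_prime_order[OF H p] .
    have c: "coprime p 2" "coprime p 3" "coprime p 5" using p n primes_coprime[of p 2] primes_coprime[of p 3] primes_coprime[of p 5] by simp_all
    have "coprime p (2 * 2)" using c(1) by (simp only: coprime_mult_right_iff simp_thms)
    then have "coprime p 4" by simp
    then show False using good_ord[OF assms x(1)] power_coprime_eq_1[OF x(3)] x(2) c by blast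
  qed
  have "multiplicity p (card H) \<le> multiplicity p 360" if p: "prime p" for p
  proof (cases "p dvd card H")
    case False then show ?thesis by (simp add: not_dvd_imp_multiplicity_0)
  next
    case True
    have "card H \<noteq> 0" "\<not> is_unit p" using sgp_card_pos[OF H] p by auto
    then have ub: "multiplicity p (card H) \<le> k" if "\<not> p ^ Suc k dvd card H" for k
      using multiplicity_lessI[of "card H" p "Suc k"] that unfolding less_Suc_eq_le by blast
    have lb: "k \<le> multiplicity p 360" if "p ^ k dvd 360" for k
      using multiplicity_geI[of 360 p k] that \<open>\<not> is_unit p\<close> by simp
    have "p = 2 \<or> p = 3 \<or> p = 5" using pr[OF p True] by simp
    then show ?thesis
    proof (elim disjE)
      assume "p = 2" then show ?thesis using ub[of 3] lb[of 3] n16 by simp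
    next
      assume "p = 3" then show ?thesis using ub[of 2] lb[of 2] n27 by simp
    next
      assume "p = 5" then show ?thesis using ub[of 1] lb[of 1] n25 by simp
    qed
  qed
  then show "card H dvd 360" using sgp_card_pos[OF H] by (intro multiplicity_le_imp_dvd) auto
qed

section \<open>Centralizers, normalizers and intersections of Sylow subgroups\<close>

lemma cent_order:
  assumes "good H" "x \<in> H" "x \<noteq> 1" "x ^ n = 1" "n \<in> {3,4,5}" "y \<in> cent H x"
  shows "y ^ n = 1"
proof (cases "y = 1")
  case False
  have y: "y \<in> H" "x * y = y * x" using assms(6) by (auto simp: cent_def)
  obtain m where m: "m \<in> {3,4,5}" "y ^ m = 1" using good_ord[OF assms(1) y(1)] by auto
  then have "n = m" using good_commute[OF assms(1,2) y assms(3) False assms(4) m(2) assms(5) m(1)] by simp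
  then show ?thesis using m by simp
qed simp

lemma cent_order_5:
  assumes "good H" "f \<in> H" "f \<noteq> 1" "f ^ 5 = 1" shows "cent H f = powers f"
proof (rule order_5_unique[OF assms(1) sgp_cent[OF good_sgp[OF assms(1)]]])
  show "cent H f \<subseteq> H" "f \<in> cent H f" using assms(2) by (auto simp: cent_def)
  show "\<And>y. y \<in> cent H f \<Longrightarrow> y ^ 5 = 1" using cent_order[OF assms(1-4)] by simp
qed (rule assms)

lemma sylows_card:
  assumes "Q \<in> sylows p H" "p ^ k dvd card H" "\<not> p ^ Suc k dvd card H"
  shows "sgp Q" "Q \<subseteq> H" "card Q = p ^ k"
proof -
  have "multiplicity p (card H) = k" using assms by (intro multiplicity_eqI) auto
  then show "sgp Q" "Q \<subseteq> H" "card Q = p ^ k" using assms(1) by (auto simp: sylows_def)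
qed

lemma conj_by_mult: "conj_by (g * h) x = conj_by g (conj_by h x)"
  by (simp add: mult.assoc)

lemma conj_by_inverse: "conj_by g (inverse x) = inverse (conj_by g x)"
  by (simp add: mult.assoc)

lemma conj_by_eq_self_iff: "conj_by g x = x \<longleftrightarrow> g * x = x * g"
  by (metis eq_mult_inverse_iff)

lemma conj_elements_action:
  assumes "sgp R" "finite S" "\<And>g x. g \<in> R \<Longrightarrow> x \<in> S \<Longrightarrow> conj_by g x \<in> S"
  shows "action R S conj_by"
  using assms by unfold_locales (simp_all only: conj_by_mult, simp_all)

text \<open>The conjugation orbit of \<open>f\<close> lies in \<open>{f, inverse f}\<close>, and its
  stabilizer is the centralizer.\<close>

lemma card_normalizer_inverting:
  assumes "sgp N" "f \<in> N" and inv: "\<And>g. g \<in> N \<Longrightarrow> conj_by g f = f \<or> conj_by g f = inverse f"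
    and p: "card (cent N f) = p"
  shows "card N = p \<or> card N = 2 * p"
proof -
  have "conj_by g x \<in> {f, inverse f}" if "g \<in> N" "x \<in> {f, inverse f}" for g x
    using inv[OF that(1)] conj_by_inverse[of g f] that(2)
    by (metis insertE insertI1 insertI2 inverse_inverse_mult singletonD)
  then interpret action N "{f, inverse f}" conj_by by (intro conj_elements_action assms(1)) simp_all
  have "stab f = cent N f" unfolding stab_def cent_def conj_by_eq_self_iff ..
  then have "card (orb f) * p = card N" using orbit_stabilizer[of f] p by simp
  moreover have "card (orb f) \<le> card {f, inverse f}" using orb_subset[of f] by (intro card_mono) auto
  moreover have "card {f, inverse f} \<le> 2" by (simp add: card_insert_if)
  moreover have "card (orb f) \<noteq> 0" using orb_self[of f] finite_subset[OF orb_subset[of f]] by auto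
  ultimately have "card (orb f) = 1 \<or> card (orb f) = 2" by linarith
  then show ?thesis using \<open>card (orb f) * p = card N\<close> by auto
qed

lemma prime_card_powers:
  fixes Q :: "'a::group_mult set"
  assumes "sgp Q" "prime p" "card Q = p" "x \<in> Q" "x \<noteq> 1"
  shows "powers x = Q" "x ^ p = 1"
proof -
  show 1: "x ^ p = 1" using power_card_eq_1[OF assms(1,4)] assms(3) by simp
  show "powers x = Q"
    using sgp_eq_if_card_eq[OF assms(1) powers_subset[OF assms(1,4)]] card_powers_prime[OF assms(2) 1 assms(5)]
      assms(3) by simp
qed

text \<open>Let \<open>K\<close> be the kernel of the action. It meets \<open>F\<close> trivially: a
  nontrivial common element generates \<open>F\<close> and, being a \<open>p\<close>-element that
  normalizes every Sylow subgroup, lies in all of them, so \<open>F\<close> would be the only one.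
  An element \<open>g\<close> of \<open>K\<close> that centralizes \<open>f\<close> lies in
  \<open>F\<close>. One that inverts \<open>f\<close> has with \<open>f\<close> the commutator
  \<open>inverse f * inverse f\<close>, which lies in \<open>K\<close> and in \<open>F\<close>; this
  is impossible for odd \<open>p\<close>.\<close>

lemma sylow_action_faithful:
  assumes H: "sgp H" and p: "prime p" "odd p" and F: "F \<in> sylows p H" "card F = p"
    and f: "f \<in> F" "f \<noteq> 1" and c: "cent H f \<subseteq> F"
    and inv: "\<And>g. g \<in> nrm H F \<Longrightarrow> conj_by g f = f \<or> conj_by g f = inverse f"
    and n: "sylows p H \<noteq> {F}" and g: "g \<in> H" "\<And>R. R \<in> sylows p H \<Longrightarrow> conj_set g R = R"
  shows "g = 1"
proof -
  define K where "K = {g\<in>H. \<forall>R\<in>sylows p H. conj_set g R = R}"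
  have F': "sgp F" "F \<subseteq> H" using F by (auto simp: sylows_def)
  have KF: "x = 1" if x: "x \<in> K" "x \<in> F" for x
  proof (rule ccontr)
    assume x1: "x \<noteq> 1"
    have xp: "x ^ (p ^ 1) = 1" "powers x = F" using prime_card_powers[OF F'(1) p(1) F(2) x(2) x1] by auto
    have "R = F" if R: "R \<in> sylows p H" for R
    proof -
      have "x \<in> nrm H R" using x R by (auto simp: K_def nrm_def)
      then have "x \<in> R" using p_element_normalizing[OF H p(1) R _ xp(1)] by blast
      moreover have "sgp R" "card R = p" using R F by (auto simp: sylows_def)
      ultimately show "R = F" using prime_card_powers(1)[OF _ p(1) _ _ x1] xp(2) by metis
    qed
    then show False using n F(1) by blast
  qed
  have gK: "g \<in> K" using g by (simp add: K_def)
  then have "g \<in> nrm H F" using F by (simp add: K_def nrm_def)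
  from inv[OF this] show ?thesis
  proof
    assume "conj_by g f = f"
    then have "g \<in> cent H f" using g(1) by (simp only: cent_def conj_by_eq_self_iff) simp
    then show ?thesis using c KF gK by blast
  next
    assume i: "conj_by g f = inverse f"
    have fH: "f \<in> H" using f F' by blast
    \<comment> \<open>The conjugate of \<open>inverse g\<close> by \<open>f\<close> acts trivially
      again, so the commutator \<open>g * conj_by f (inverse g)\<close> lies in
      \<open>K\<close>.\<close>
    have "conj_set (conj_by f (inverse g)) R = R" if R: "R \<in> sylows p H" for R
    proof -
      have "conj_set (inverse f) R \<in> sylows p H" using sylows_conj[OF H R] fH H sgpD(4) by blast
      then have "conj_set g (conj_set (inverse f) R) = conj_set (inverse f) R" using g by blast
      then have "conj_set (inverse g) (conj_set (inverse f) R) = conj_set (inverse f) R"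
        by (metis conj_set_inverse(1))
      then show ?thesis by (simp add: conj_set_mult)
    qed
    moreover have "conj_set g R = R" if "R \<in> sylows p H" for R using that g by blast
    ultimately have "conj_set (g * conj_by f (inverse g)) R = R" if "R \<in> sylows p H" for R
      using that by (simp only: conj_set_mult)
    moreover have "g * conj_by f (inverse g) \<in> H" using g fH H sgpD by metis
    ultimately have "g * conj_by f (inverse g) \<in> K" by (simp add: K_def)
    moreover have "g * conj_by f (inverse g) = conj_by g f * inverse f" by (simp add: mult.assoc)
    ultimately have k: "inverse f * inverse f \<in> K" using i by simp
    have "inverse f * inverse f = 1" using KF[OF k] f F' sgpD by metis
    then have f2: "f ^ 2 = 1" by (simp add: power2_eq_square mult_eq_one_iff)
    have "f ^ p = 1" using prime_card_powers(2)[OF F'(1) p(1) F(2) f] .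
    then have "f = 1" using power_coprime_eq_1[OF f2] p(2) by simp
    then show ?thesis using f(2) by simp
  qed
qed

lemma conj_power_exponent:
  assumes "conj_by g f = f ^ k" shows "conj_by (g ^ n) f = f ^ (k ^ n)"
proof (induct n)
  case (Suc n)
  have "conj_by (g ^ Suc n) f = conj_by g (conj_by (g ^ n) f)" by (simp add: mult.assoc)
  also have "\<dots> = (conj_by g f) ^ (k ^ n)" by (simp add: Suc conj_by_power)
  also have "\<dots> = f ^ (k ^ Suc n)" by (simp add: assms flip: power_mult)
  finally show ?case .
qed simp

text \<open>As 2 has multiplicative order 4 modulo 5, \<open>g\<close> would have order 4, and (6)
  would apply to \<open>f\<close> and \<open>inverse g\<close>. Its three words evaluate to
  \<open>f ^ 3\<close>, \<open>f ^ 2\<close> and \<open>f ^ 4\<close>, all of order 5.\<close>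

lemma not_conj_square_5:
  assumes "good H" "f \<in> H" "f ^ 5 = 1" "f \<noteq> 1" "g \<in> H" shows "conj_by g f \<noteq> f ^ 2"
proof
  assume a: "conj_by g f = f ^ 2"
  have red: "f ^ m = f ^ (m mod 5)" for m using power_mod_order[OF assms(3), of m] by simp
  have ne: "f ^ m \<noteq> 1" if "m \<in> {1,2,3,4}" for m
    using power_coprime_eq_1[OF assms(3), of m] assms(4) that by (auto simp: coprime_iff_gcd_eq_1 gcd_non_0_nat)
  have pw: "conj_by (g ^ n) f = f ^ (2 ^ n)" for n using conj_power_exponent[OF a] .
  have "g ^ 3 \<noteq> 1"
  proof
    assume "g ^ 3 = 1" then have "f = f ^ 3" using pw[of 3] red[of 8] by simp
    then have "f * f ^ 2 = f" by (simp flip: power_Suc)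
    then show False using ne[of 2] by simp
  qed
  moreover have "g ^ 5 \<noteq> 1"
  proof
    assume "g ^ 5 = 1" then have "f = f ^ 2" using pw[of 5] red[of 32] by simp
    then have "f * f = f" by (simp add: power2_eq_square)
    then show False using assms(4) by simp
  qed
  ultimately have g4: "g ^ 4 = 1" using good_ord[OF assms(1,5)] by blast
  have g2: "g ^ 2 \<noteq> 1"
  proof
    assume "g ^ 2 = 1" then have "f = f ^ 4" using pw[of 2] by simp
    then have "f * f ^ 3 = f" by (simp flip: power_Suc)
    then show False using ne[of 3] by simp
  qed
  \<comment> \<open>(6) conjugates in the form \<open>inverse x2 * x1 * x2\<close>, so the inverse
    of \<open>g\<close> is substituted for the second variable.\<close>
  have gi: "inverse g \<in> H" "inverse g ^ 4 = 1" "inverse g ^ 2 \<noteq> 1"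
    using g4 g2 assms(5) good_sgp[OF assms(1)] by (simp_all add: sgpD flip: inverse_power_group)
  have "conj_by g (f ^ 3) = f ^ 6" using conj_by_power[of g f 3] a by (simp flip: power_mult)
  then have "f * g * f * inverse g = f ^ 3" "f * g * f ^ 3 * inverse g = f ^ 2" "f ^ 2 * g * f * inverse g = f ^ 4"
    using a red[of 7] by (simp_all add: mult.assoc flip: power_Suc power_add)
  then have "(f ^ 3) ^ 12 = 1 \<or> (f ^ 2) ^ 12 = 1 \<or> (f ^ 4) ^ 12 = 1"
    using good_order_5_4[OF assms(1-4) gi] by simp
  then have "f ^ 36 = 1 \<or> f ^ 24 = 1 \<or> f ^ 48 = 1" by (simp flip: power_mult)
  then show False using red[of 36] red[of 24] red[of 48] ne[of 1] ne[of 4] ne[of 3] by simp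
qed

lemma normalizer_order_5:
  assumes "good H" "f \<in> H" "f ^ 5 = 1" "f \<noteq> 1" "g \<in> nrm H (powers f)"
  shows "conj_by g f = f \<or> conj_by g f = inverse f"
proof -
  have g: "g \<in> H" "conj_set g (powers f) = powers f" using assms(5) by (auto simp: nrm_def)
  have "conj_by g f \<in> conj_set g (powers f)" using powers_self[of f] by (simp only: conj_by_mem_conj_set)
  then have gf: "conj_by g f \<in> powers f" using g(2) by simp
  from gf obtain k where k: "k < 5" "conj_by g f = f ^ k" using powers_eq[OF assms(3)] by auto
  have "k \<noteq> 0"
  proof
    assume "k = 0" then have "conj_by g f = conj_by g 1" using k by simp
    then show False using assms(4) by (simp only: conj_by_eq_iff)
  qed
  moreover have "k \<noteq> 2" using not_conj_square_5[OF assms(1-4) g(1)] k by auto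
  \<comment> \<open>If \<open>g\<close> cubes \<open>f\<close>, then \<open>inverse g\<close>
    squares it, since 3 * 2 is 1 modulo 5.\<close>
  moreover have "k \<noteq> 3"
  proof
    assume "k = 3"
    moreover have "conj_by (inverse g) (conj_by g f) = f" by (simp add: mult.assoc)
    ultimately have "conj_by (inverse g) (f ^ 3) = f" using k(2) by simp
    then have "conj_by (inverse g) (f ^ 6) = f ^ 2" using conj_by_power[of "inverse g" "f ^ 3" 2] by (simp flip: power_mult)
    moreover have "f ^ 6 = f" using power_mod_order[OF assms(3), of 6] by simp
    ultimately show False
      using not_conj_square_5[OF assms(1-4), of "inverse g"] g sgpD(4)[OF good_sgp[OF assms(1)]] by simp
  qed
  ultimately have "k = 1 \<or> k = 4" using k(1) by linarith
  moreover have "f * f ^ 4 = 1" using assms(3) by (simp flip: power_Suc)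
  then have "f ^ 4 = inverse f" by (simp only: mult_eq_one_iff)
  ultimately show ?thesis using k(2) by auto
qed

text \<open>Otherwise \<open>f\<close> permutes the 3 or 9 elements of \<open>Q\<close>; the number
  of fixed ones is 3 or 4 modulo 5, so an element other than 1 commutes with \<open>f\<close>,
  against \<open>good_commute\<close>.\<close>

lemma order_5_not_normalizing_3:
  assumes "good H" "f \<in> H" "f ^ 5 = 1" "f \<noteq> 1" and Q: "Q \<in> sylows 3 H" "3 dvd card H"
  shows "f \<notin> nrm H Q"
proof
  assume f: "f \<in> nrm H Q"
  note H = good_sgp[OF assms(1)]
  have "card Q = 3 \<or> card Q = 9"
    using sylows_card[OF Q(1), of 1] sylows_card[OF Q(1), of 2] Q(2) good_card_dvd[OF assms(1)] by auto
  moreover have Q': "sgp Q" "Q \<subseteq> H" using Q by (auto simp: sylows_def)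
  have P: "sgp (powers f)" "powers f \<subseteq> nrm H Q" using sgp_powers powers_subset sgp_nrm[OF H] f by blast+
  have "conj_by g x \<in> Q" if "g \<in> powers f" "x \<in> Q" for g x
  proof -
    have "conj_set g Q = Q" using P(2) that(1) by (auto simp: nrm_def)
    then show ?thesis using conj_by_mem_conj_set[of g x Q] that(2) by metis
  qed
  then interpret action "powers f" Q conj_by by (intro conj_elements_action P(1) sgpD(1)[OF Q'(1)])
  have "card (powers f) = 5 ^ 1" using card_powers_prime[OF _ assms(3,4)] by simp
  then have "card Q mod 5 = card fixed mod 5" using card_fixed_cong[of 5 1] by simp
  ultimately have "card fixed \<noteq> 1" "card fixed \<noteq> 0" by auto
  then have "fixed \<noteq> {1}" "1 \<in> fixed" using sgpD(2)[OF Q'(1)] by (auto simp: fixed_def)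
  then obtain x where x: "x \<in> fixed" "x \<noteq> 1" by blast
  then have xQ: "x \<in> Q" and c: "conj_by f x = x" using powers_self[of f] by (auto simp: fixed_def)
  have "f * x = x * f" using c by (simp only: conj_by_eq_self_iff)
  moreover have "x ^ 3 = 1"
    using p_subgroup_order[OF assms(1) Q', of 3 "multiplicity 3 (card H)"] xQ Q by (auto simp: sylows_def)
  ultimately show False using good_commute[OF assms(1,2) _ _ assms(4) x(2) assms(3), of 3] xQ Q'(2) by auto
qed

text \<open>An element of order 5 acts on the Sylow 3-subgroups without fixed points.\<close>

lemma sylows_3_dvd_5:
  assumes "good H" "15 dvd card H" shows "5 dvd card (sylows 3 H)"
proof -
  note H = good_sgp[OF assms(1)]
  have d: "3 dvd card H" "5 dvd card H" using assms(2) by (auto elim: dvd_trans[rotated])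
  obtain f where f: "f \<in> H" "f \<noteq> 1" "f ^ 5 = 1" using exists_prime_order[OF H _ d(2)] by auto
  interpret action "powers f" "sylows 3 H" conj_set
    using conj_action[OF H powers_subset[OF H f(1)] sgp_powers[OF H f(1)]] .
  have "Q \<notin> fixed" for Q
    using order_5_not_normalizing_3[OF assms(1) f(1,3,2) _ d(1), of Q] powers_self[of f] f(1)
    unfolding fixed_def nrm_def by blast
  then have "fixed = {}" by blast
  moreover have "card (powers f) = 5 ^ 1" using card_powers_prime[OF _ f(3,2)] by simp
  ultimately show ?thesis using card_fixed_cong[of 5 1] by (simp add: dvd_eq_mod_eq_0)
qed

text \<open>The argument avoids the quotient by the centre. For a central
  \<open>z \<noteq> 1\<close> the centralizer of \<open>x\<close> contains \<open>powers z\<close>,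
  properly unless \<open>x\<close> is a power of \<open>z\<close>; a proper inclusion forces its
  order to be 9.\<close>

lemma abelian_9:
  assumes "sgp Q" "card Q = 9" "x \<in> Q" "y \<in> Q" shows "x * y = y * x"
proof -
  interpret action Q Q conj_by
    using assms(1) by (intro conj_elements_action) (simp_all add: sgpD sgp_conj)
  have "card Q = 3 ^ 2" using assms by simp
  then have "card fixed mod 3 = 0" using card_fixed_cong[of 3 2] assms(2) by simp
  moreover have one: "1 \<in> fixed" using sgpD[OF assms(1)] by (auto simp: fixed_def)
  ultimately have "fixed \<noteq> {1}" by auto
  then obtain z where z: "z \<in> fixed" "z \<noteq> 1" using one by blast
  then have zQ: "z \<in> Q" and zc: "\<And>u. u \<in> Q \<Longrightarrow> u * z = z * u"
    unfolding fixed_def conj_by_eq_self_iff by auto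
  have S: "sgp (cent Q x)" using sgp_cent[OF assms(1)] .
  have sub: "cent Q x \<subseteq> Q" by (auto simp: cent_def)
  have P: "powers z \<subseteq> cent Q x"
    using powers_subset[OF S, of z] zQ zc[OF assms(3)] by (simp add: cent_def)
  have p3: "prime (3::nat)" by simp
  have "card (cent Q x) dvd 3 ^ 2" using lagrange_sgp[OF assms(1) S sub] assms(2) by simp
  then obtain i where i: "i \<le> 2" "card (cent Q x) = 3 ^ i" unfolding divides_primepow_nat[OF p3] by blast
  have Pz: "sgp (powers z)" using sgp_powers assms(1) zQ by blast
  have "card (powers z) dvd 3 ^ 2" using lagrange_sgp[OF assms(1) Pz powers_subset[OF assms(1) zQ]] assms(2) by simp
  then obtain j where j: "j \<le> 2" "card (powers z) = 3 ^ j" unfolding divides_primepow_nat[OF p3] by blast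
  have "card (cent Q x) = 9 \<or> x \<in> powers z"
  proof (rule ccontr)
    assume n: "\<not> ?thesis"
    have "x \<in> cent Q x" using assms by (simp add: cent_def)
    then have "powers z \<subset> cent Q x" using n P by blast
    then have lt: "card (powers z) < card (cent Q x)" using psubset_card_mono sgpD(1)[OF S] by blast
    have "card {1, z} \<le> card (powers z)"
      using sgpD[OF Pz] powers_self by (intro card_mono) auto
    then have "2 \<le> card (powers z)" using z(2) by simp
    then have "j \<noteq> 0" using j by (cases j) auto
    moreover have "i \<noteq> 2" using n i by auto
    ultimately have "i \<le> 1" "j \<ge> 1" using i by auto
    then have "(3::nat) ^ i \<le> 3 ^ j" by (intro power_increasing) auto
    then show False using lt i j by simp
  qed
  then show ?thesis
  proof
    assume "card (cent Q x) = 9"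
    then have "cent Q x = Q" using sgp_eq_if_card_eq[OF assms(1) sub] assms(2) by simp
    then have "y \<in> cent Q x" using assms(4) by simp
    then show ?thesis by (simp add: cent_def)
  next
    assume "x \<in> powers z"
    then obtain k where "x = z ^ k" by (auto simp: powers_def)
    then show ?thesis using power_commuting_commutes[of z y k] zc[OF assms(4)] by simp
  qed
qed

text \<open>Sylow subgroups that contain \<open>x\<close> are abelian, hence inside the centralizer
  of \<open>x\<close>. That centralizer is a 3-group, so of order at most 9, and equals each of
  them.\<close>

lemma sylow_9_TI:
  assumes "good H" "9 dvd card H" and QR: "Q \<in> sylows 3 H" "R \<in> sylows 3 H" and x: "x \<in> Q" "x \<in> R" "x \<noteq> 1"
  shows "Q = R"
proof -
  have n27: "\<not> 27 dvd card H" by (rule good_card_dvd[OF assms(1)])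
  have Q: "sgp Q" "Q \<subseteq> H" "card Q = 3 ^ 2" using sylows_card[OF QR(1), of 2] assms(2) n27 by simp_all
  have R: "sgp R" "R \<subseteq> H" "card R = 3 ^ 2" using sylows_card[OF QR(2), of 2] assms(2) n27 by simp_all
  have xH: "x \<in> H" using x Q by blast
  have C: "sgp (cent H x)" "cent H x \<subseteq> H" using sgp_cent good_sgp[OF assms(1)] by (auto simp: cent_def)
  have x3: "x ^ 3 = 1" using p_subgroup_order[OF assms(1) Q x(1)] by simp
  have "y ^ (3 ^ 1) = 1" if "y \<in> cent H x" for y
    using cent_order[OF assms(1) xH x(3) x3 _ that] by simp
  then obtain k where k: "card (cent H x) = 3 ^ k" using card_prime_power[OF C(1), of 3 1] by auto
  have d: "3 ^ k dvd card H" using lagrange_sgp[OF good_sgp[OF assms(1)] C] k by simp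
  have "k \<le> 2"
  proof (rule ccontr)
    assume "\<not> k \<le> 2"
    then have "(3::nat) ^ 3 dvd 3 ^ k" by (intro le_imp_power_dvd) simp
    then show False using d n27 dvd_trans by force
  qed
  then have le: "card (cent H x) \<le> 9" using k power_increasing[of k 2 "3::nat"] by simp
  have *: "S = cent H x" if S: "sgp S" "S \<subseteq> H" "card S = 3 ^ 2" "x \<in> S" for S
  proof (rule card_seteq)
    have "card S = 9" using S(3) by simp
    then show "S \<subseteq> cent H x" using abelian_9[OF S(1)] S by (auto simp: cent_def)
    show "card (cent H x) \<le> card S" using le S by simp
  qed (use sgpD(1) C in blast)
  then show ?thesis using *[OF Q x(1)] *[OF R x(2)] by simp
qed

lemma card_Union_TI:
  assumes "finite S" "\<And>Q. Q \<in> S \<Longrightarrow> sgp Q \<and> card Q = q"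
    and "\<And>Q R x. Q \<in> S \<Longrightarrow> R \<in> S \<Longrightarrow> x \<in> Q \<Longrightarrow> x \<in> R \<Longrightarrow> x \<noteq> 1 \<Longrightarrow> Q = R"
  shows "card (\<Union>Q\<in>S. Q - {1}) = card S * (q - 1)"
proof -
  have "card (\<Union>Q\<in>S. Q - {1}) = (\<Sum>Q\<in>S. card (Q - {1}))"
    using assms by (intro card_UN_disjoint) (auto simp: sgpD)
  also have "\<dots> = (\<Sum>Q\<in>S. q - 1)"
  proof (intro sum.cong refl)
    fix Q assume "Q \<in> S"
    then have "sgp Q" "card Q = q" using assms(2) by auto
    then show "card (Q - {1}) = q - 1" using card_Diff_singleton[OF sgpD(2), of Q] by simp
  qed
  finally show ?thesis by simp
qed

text \<open>Here \<open>q\<close> is the order of the Sylow 3-subgroups. Sylow subgroups for one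
  prime meet trivially, so the nontrivial elements of all of them are counted without overlap; the
  inequality is strict because 1 is left over.\<close>

lemma sylow_counting:
  assumes "good H" "15 dvd card H"
    and q: "q = 3 \<and> \<not> 9 dvd card H \<or> q = 9 \<and> 9 dvd card H"
  shows "card (sylows 5 H) * 4 + card (sylows 3 H) * (q - 1) < card H"
proof -
  note H = good_sgp[OF assms(1)]
  have d: "3 dvd card H" "5 dvd card H" using assms(2) by (auto elim: dvd_trans[rotated])
  let ?A = "\<Union>Q\<in>sylows 5 H. Q - {1}" and ?B = "\<Union>Q\<in>sylows 3 H. Q - {1}"
  have 5: "sgp Q \<and> card Q = 5" if "Q \<in> sylows 5 H" for Q
    using sylows_card[OF that, of 1] d(2) good_card_dvd[OF assms(1)] by simp
  have 3: "sgp Q \<and> card Q = q" if "Q \<in> sylows 3 H" for Q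
    using sylows_card[OF that, of 1] sylows_card[OF that, of 2] d(1) good_card_dvd[OF assms(1)] q by auto
  have A: "card ?A = card (sylows 5 H) * (5 - 1)"
  proof (rule card_Union_TI[OF finite_sylows[OF H] 5])
    fix Q R x assume "Q \<in> sylows 5 H" "R \<in> sylows 5 H" "x \<in> Q" "x \<in> R" "x \<noteq> (1::'a)"
    then show "Q = R" using prime_card_powers(1)[of Q 5 x] prime_card_powers(1)[of R 5 x] 5 by simp
  qed
  have B: "card ?B = card (sylows 3 H) * (q - 1)"
  proof (rule card_Union_TI[OF finite_sylows[OF H] 3])
    fix Q R x assume *: "Q \<in> sylows 3 H" "R \<in> sylows 3 H" "x \<in> Q" "x \<in> R" "x \<noteq> (1::'a)"
    show "Q = R"
    proof (cases "9 dvd card H")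
      case True then show ?thesis using sylow_9_TI[OF assms(1)] * by blast
    next
      case False
      then have "q = 3" using q by simp
      then show ?thesis
        using prime_card_powers(1)[of Q 3 x] prime_card_powers(1)[of R 3 x] 3[OF *(1)] 3[OF *(2)] * by simp
    qed
  qed
  have o5: "x ^ 5 = 1" if "x \<in> ?A" for x
    using that p_subgroup_order[OF assms(1), of _ 5 "multiplicity 5 (card H)"] by (auto simp: sylows_def)
  have o3: "x ^ 3 = 1" if "x \<in> ?B" for x
    using that p_subgroup_order[OF assms(1), of _ 3 "multiplicity 3 (card H)"] by (auto simp: sylows_def)
  have dj: "?A \<inter> ?B = {}"
  proof (rule ccontr)
    assume "?A \<inter> ?B \<noteq> {}"
    then obtain x where x: "x \<in> ?A" "x \<in> ?B" by blast
    then have "x = 1" using power_3_5[OF o3 o5] by blast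
    then show False using x by simp
  qed
  have sub: "?A \<union> ?B \<subseteq> H - {1}" by (auto simp: sylows_def)
  have fin: "finite (H - {1})" using sgpD(1)[OF H] by simp
  have "card (?A \<union> ?B) \<le> card (H - {1})" by (rule card_mono[OF fin sub])
  moreover have "card (?A \<union> ?B) = card ?A + card ?B"
    using finite_subset[OF _ fin, of ?A] finite_subset[OF _ fin, of ?B] sub dj
    by (intro card_Un_disjoint) (simp_all only: Un_subset_iff)
  moreover have "card (H - {1}) < card H" using sgpD[OF H] by (intro psubset_card_mono) auto
  ultimately show ?thesis using A B by simp
qed

subsection \<open>Possible orders\<close>


text \<open>The candidates for the number of Sylow 5-subgroups; 72 is 360 / 5.\<close>

lemma dvd_72_mod_5: assumes "(m::nat) dvd 72" "m mod 5 = 1" shows "m \<in> {1, 6, 36}"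
proof -
  have "\<forall>m\<in>set [0..<73]. m dvd 72 \<longrightarrow> m mod 5 = 1 \<longrightarrow> m = 1 \<or> m = 6 \<or> m = (36::nat)" by code_simp
  moreover have "m \<in> set [0..<73]" using dvd_imp_le[OF assms(1)] by simp
  ultimately show ?thesis using assms by blast
qed

text \<open>The candidates for the number of Sylow 3-subgroups of order 9; 40 is 360 / 9.\<close>

lemma dvd_40_mod_3: assumes "(m::nat) dvd 40" "m mod 3 = 1" shows "m \<in> {1, 4, 10, 40}"
proof -
  have "\<forall>m\<in>set [0..<41]. m dvd 40 \<longrightarrow> m mod 3 = 1 \<longrightarrow> m = 1 \<or> m = 4 \<or> m = 10 \<or> m = (40::nat)" by code_simp
  moreover have "m \<in> set [0..<41]" using dvd_imp_le[OF assms(1)] by simp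
  ultimately show ?thesis using assms by blast
qed

lemma sylow_5_setup:
  assumes "good H" "f \<in> H" "f ^ 5 = 1" "f \<noteq> 1"
  shows "powers f \<in> sylows 5 H" "card (powers f) = 5"
    "card (nrm H (powers f)) = 5 \<or> card (nrm H (powers f)) = 10"
    "card (sylows 5 H) * card (nrm H (powers f)) = card H" "card (sylows 5 H) mod 5 = 1"
proof -
  note H = good_sgp[OF assms(1)]
  have P: "sgp (powers f)" "powers f \<subseteq> H" using sgp_powers powers_subset H assms(2) by blast+
  show c: "card (powers f) = 5" using card_powers_prime[OF _ assms(3,4)] by simp
  then have "5 dvd card H" using lagrange_sgp[OF H P] by simp
  then have "multiplicity 5 (card H) = 1" using good_card_dvd(4)[OF assms(1)] by (intro multiplicity_eqI) auto
  then show S: "powers f \<in> sylows 5 H" using P c by (simp add: sylows_def)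
  show "card (sylows 5 H) * card (nrm H (powers f)) = card H" "card (sylows 5 H) mod 5 = 1"
    using card_sylows[OF H _ S] by simp_all
  have N: "sgp (nrm H (powers f))" "powers f \<subseteq> nrm H (powers f)" using sgp_nrm[OF H] subset_nrm[OF P] by auto
  have "cent (nrm H (powers f)) f = cent H f \<inter> nrm H (powers f)" by (auto simp: cent_def nrm_def)
  also have "\<dots> = powers f" using cent_order_5[OF assms(1,2,4,3)] N(2) by auto
  finally have "card (cent (nrm H (powers f)) f) = 5" using c by simp
  then show "card (nrm H (powers f)) = 5 \<or> card (nrm H (powers f)) = 10"
    using card_normalizer_inverting[OF N(1), of f 5] normalizer_order_5[OF assms] N(2) powers_self[of f] by auto
qed

lemma card_sylows_3:
  assumes "good H" "3 dvd card H"
  obtains k where "card (sylows 3 H) * (3 * k) = card H" "9 dvd card H \<Longrightarrow> 3 dvd k" "card (sylows 3 H) mod 3 = 1"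
proof -
  note H = good_sgp[OF assms(1)]
  have p: "prime (3::nat)" by simp
  obtain Q where Q: "Q \<in> sylows 3 H" using sylows_nonempty[OF H p] by blast
  have Q': "sgp Q" "Q \<subseteq> H" using Q by (auto simp: sylows_def)
  have d: "card Q dvd card (nrm H Q)" using lagrange_sgp[OF sgp_nrm[OF H] Q'(1) subset_nrm[OF Q']] .
  have "3 dvd card Q"
    using sylows_card(3)[OF Q, of 1] sylows_card(3)[OF Q, of 2] assms(2) good_card_dvd(3)[OF assms(1)]
    by (cases "9 dvd card H") auto
  then obtain k where k: "card (nrm H Q) = 3 * k" using d dvd_trans by blast
  moreover have "3 dvd k" if "9 dvd card H"
  proof -
    have "card Q = 9" using sylows_card(3)[OF Q, of 2] that good_card_dvd(3)[OF assms(1)] by simp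
    then show ?thesis using d k by presburger
  qed
  ultimately show thesis using that card_sylows[OF H p Q] by simp
qed

text \<open>With 1, 6 or 36 Sylow 5-subgroups and a normalizer of order 5 or 10 the order is 5, 10,
  30, 60, 180 or 360. The local fact \<open>no3\<close> eliminates 30 and 180 and settles the number
  of Sylow 3-subgroups for 360.\<close>

lemma card_cases_5:
  assumes "good H" "5 dvd card H"
  shows "card H \<in> {5, 10} \<and> card (sylows 5 H) = 1 \<or> card H = 60 \<and> card (sylows 5 H) = 6 \<or>
    card H = 360 \<and> card (sylows 3 H) = 10"
proof -
  note H = good_sgp[OF assms(1)]
  obtain f where f: "f \<in> H" "f \<noteq> 1" "f ^ 5 = 1" using exists_prime_order[OF H _ assms(2)] by auto
  note S = sylow_5_setup[OF assms(1) f(1,3,2)]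
  let ?n = "card (sylows 5 H)"
  have "?n * 5 dvd 360"
    using S(3)
  proof
    assume "card (nrm H (powers f)) = 10"
    then have "?n * 5 * 2 = card H" using S(4) by simp
    then show ?thesis using good_card_dvd(1)[OF assms(1)] by (metis dvd_mult_left)
  qed (use S(4) good_card_dvd(1)[OF assms(1)] in simp)
  then have "?n dvd 72" using dvd_mult_cancel_right[of ?n 5 72] by simp
  then have n: "?n = 1 \<or> ?n = 6 \<or> ?n = 36" using dvd_72_mod_5[OF _ S(5)] by simp
  \<comment> \<open>The number of Sylow 3-subgroups is a multiple of 5 and 1 modulo 3, so at least
    10, giving at least 20 elements of order 3. The first alternative of the hypothesis covers order
    30, the second 180 and 360; there the 144 elements of order 5 leave no room for 10 * 8 more in
    order 180, nor for 40 * 8 more in order 360.\<close>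
  have no3: "card (sylows 3 H) = 10 \<and> card H = 360" if h: "15 dvd card H" "?n * 4 + 20 \<ge> card H \<or> card H \<in> {180, 360} \<and> ?n = 36"
  proof -
    have d: "3 dvd card H" using h(1) by (auto elim: dvd_trans[rotated])
    obtain k where k: "card (sylows 3 H) * (3 * k) = card H" "9 dvd card H \<Longrightarrow> 3 dvd k" "card (sylows 3 H) mod 3 = 1"
      using card_sylows_3[OF assms(1) d] by blast
    have 5: "5 dvd card (sylows 3 H)" using sylows_3_dvd_5[OF assms(1) h(1)] .
    have "card (sylows 3 H) \<noteq> 0" using k(3) by (intro notI) simp
    then have ge: "card (sylows 3 H) \<ge> 10" using 5 k(3) by presburger
    have cnt: "?n * 4 + card (sylows 3 H) * (q - 1) < card H"
      if "q = 3 \<and> \<not> 9 dvd card H \<or> q = 9 \<and> 9 dvd card H" for q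
      using sylow_counting[OF assms(1) h(1) that] .
    have "\<not> card H \<le> ?n * 4 + 20"
      using cnt[of 3] cnt[of 9] ge by (cases "9 dvd card H") auto
    then have h2: "card H \<in> {180, 360}" "?n = 36" using h(2) by auto
    then have 9: "9 dvd card H" by auto
    have c9: "36 * 4 + card (sylows 3 H) * 8 < card H" using cnt[of 9] 9 h2(2) by simp
    have "card H \<noteq> 180" using c9 ge by auto
    then have c: "card H = 360" using h2 by simp
    obtain l where "k = 3 * l" using k(2)[OF 9] by blast
    then have "card (sylows 3 H) * l * 9 = 40 * 9" using k(1) c by (simp add: mult_ac)
    then have "card (sylows 3 H) dvd 40" by (metis dvd_triv_left mult_right_cancel zero_neq_numeral)
    then have "card (sylows 3 H) \<in> {1, 4, 10, 40}" using dvd_40_mod_3 k(3) by blast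
    then show ?thesis using c c9 ge by auto
  qed
  from n S(3) show ?thesis
  proof (elim disjE)
    assume *: "?n = 6" "card (nrm H (powers f)) = 5"
    then have "card H = 30" using S(4) by simp
    then show ?thesis using no3 *(1) by simp
  next
    assume *: "?n = 36" "card (nrm H (powers f)) = 5"
    then have "card H = 180" using S(4) by simp
    then show ?thesis using no3 *(1) by simp
  next
    assume *: "?n = 36" "card (nrm H (powers f)) = 10"
    then have "card H = 360" using S(4) by simp
    then show ?thesis using no3 *(1) by simp
  qed (use S(4) in auto)
qed

text \<open>\<open>Q\<close> acts freely on the other Sylow 3-subgroups: an element of
  \<open>Q\<close> that normalizes \<open>R\<close> belongs to \<open>R\<close>, hence is 1 by
  \<open>sylow_9_TI\<close>. So two Sylow 3-subgroups of order 9 entail at least 10.\<close>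

lemma sylow_9_orbit:
  assumes "good H" "9 dvd card H" "Q \<in> sylows 3 H" "R \<in> sylows 3 H" "Q \<noteq> R"
  shows "inj_on (\<lambda>g. conj_set g R) Q" "(\<lambda>g. conj_set g R) ` Q \<subseteq> sylows 3 H - {Q}" "card ((\<lambda>g. conj_set g R) ` Q) = 9"
proof -
  note H = good_sgp[OF assms(1)]
  have Q: "sgp Q" "Q \<subseteq> H" "card Q = 3 ^ 2"
    using sylows_card[OF assms(3), of 2] assms(2) good_card_dvd(3)[OF assms(1)] by simp_all
  show inj: "inj_on (\<lambda>g. conj_set g R) Q"
  proof
    fix g h assume gh: "g \<in> Q" "h \<in> Q" "conj_set g R = conj_set h R"
    let ?x = "inverse g * h"
    have x: "?x \<in> Q" "conj_set ?x R = R"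
      using gh sgpD[OF Q(1)] by (simp, metis conj_set_inverse(1) conj_set_mult)
    have "?x ^ (3 ^ 1) = 1" using p_subgroup_order[OF assms(1) Q x(1)] by simp
    then have "?x \<in> R"
      using p_element_normalizing[OF H _ assms(4), of ?x 1] x Q(2) by (auto simp: nrm_def)
    then have "?x = 1" using sylow_9_TI[OF assms(1-4)] x(1) assms(5) by blast
    then show "g = h" by (simp add: mult_eq_one_iff)
  qed
  show "(\<lambda>g. conj_set g R) ` Q \<subseteq> sylows 3 H - {Q}"
  proof
    fix S assume "S \<in> (\<lambda>g. conj_set g R) ` Q"
    then obtain g where g: "g \<in> Q" "S = conj_set g R" by auto
    have "S \<noteq> Q"
    proof
      assume "S = Q"
      then have "R = conj_set (inverse g) Q" using g by (metis conj_set_inverse(1))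
      then show False using conj_set_self[OF Q(1), of "inverse g"] g assms(5) sgpD(4)[OF Q(1)] by simp
    qed
    then show "S \<in> sylows 3 H - {Q}" using g sylows_conj[OF H assms(4)] Q(2) by auto
  qed
  show "card ((\<lambda>g. conj_set g R) ` Q) = 9" using card_image[OF inj] Q(3) by simp
qed

text \<open>Otherwise there are at least 10 Sylow 3-subgroups by \<open>sylow_9_orbit\<close>, while
  their number divides 40 and is prime to 5, hence divides 8.\<close>

lemma sylow_9_normal:
  assumes "good H" "9 dvd card H" "\<not> 5 dvd card H" "Q \<in> sylows 3 H"
  shows "sylows 3 H = {Q}"
proof (rule ccontr)
  note H = good_sgp[OF assms(1)]
  assume "sylows 3 H \<noteq> {Q}"
  then obtain R where R: "R \<in> sylows 3 H" "Q \<noteq> R" using assms(4) by blast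
  have "9 \<le> card (sylows 3 H - {Q})"
    using card_mono[OF _ sylow_9_orbit(2)[OF assms(1,2,4) R]] sylow_9_orbit(3)[OF assms(1,2,4) R]
      finite_sylows[OF H] by simp
  then have ge: "10 \<le> card (sylows 3 H)" using assms(4) finite_sylows[OF H] by (simp add: card_Diff_singleton)
  obtain k where k: "card (sylows 3 H) * (3 * k) = card H" "9 dvd card H \<Longrightarrow> 3 dvd k" 
    using card_sylows_3[OF assms(1)] dvd_trans[of 3 9 "card H"] assms(2) by auto
  obtain l where "k = 3 * l" using k(2)[OF assms(2)] by blast
  then have e: "card H = 9 * (card (sylows 3 H) * l)" using k(1) by simp
  then have "9 * (card (sylows 3 H) * l) dvd 9 * 40" using good_card_dvd(1)[OF assms(1)] by simp
  then have "card (sylows 3 H) * l dvd 40" by (simp only: nat_mult_dvd_cancel1)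
  then have d: "card (sylows 3 H) dvd 8 * 5" by (simp add: dvd_mult_left)
  have "\<not> 5 dvd card (sylows 3 H)" using assms(3) e by auto
  then have "coprime 5 (card (sylows 3 H))" by (intro prime_imp_coprime) simp_all
  then have "card (sylows 3 H) dvd 8" using d coprime_dvd_mult_left_iff[of "card (sylows 3 H)" 5 8]
    by (simp add: coprime_commute)
  then show False using ge dvd_imp_le[of "card (sylows 3 H)" 8] by simp
qed

text \<open>The centralizer of \<open>r\<close> is a 3-group, hence no larger than \<open>R\<close>.
  An element of the normalizer permutes the two generators \<open>r\<close> and
  \<open>inverse r\<close> of \<open>R\<close>.\<close>

lemma sylow_3_prime:
  assumes "good H" "3 dvd card H" "\<not> 9 dvd card H" and R: "R \<in> sylows 3 H" "r \<in> R" "r \<noteq> 1"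
  shows "sgp R" "R \<subseteq> H" "card R = 3" "r ^ 3 = 1" "powers r = R" "cent H r = R"
    "g \<in> nrm H R \<Longrightarrow> conj_by g r = r \<or> conj_by g r = inverse r"
    "card (nrm H R) = 3 \<or> card (nrm H R) = 6"
proof -
  note H = good_sgp[OF assms(1)]
  have p: "prime (3::nat)" by simp
  show R': "sgp R" "R \<subseteq> H" "card R = 3" using sylows_card[OF R(1), of 1] assms(2,3) by simp_all
  show pw: "powers r = R" and r3: "r ^ 3 = 1" using prime_card_powers[OF R'(1) p R'(3) R(2,3)] by simp_all
  have rH: "r \<in> H" using R R' by blast
  have C: "sgp (cent H r)" "cent H r \<subseteq> H" using sgp_cent[OF H] by (auto simp: cent_def)
  have "y ^ (3 ^ 1) = 1" if "y \<in> cent H r" for y using cent_order[OF assms(1) rH R(3) r3 _ that] by simp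
  then obtain k where k: "card (cent H r) = 3 ^ k" using card_prime_power[OF C(1) p] by blast
  have "3 ^ k dvd card H" using lagrange_sgp[OF H C] k by simp
  then have "\<not> 3 ^ 2 dvd (3::nat) ^ k" using assms(3) dvd_trans[of "3 ^ 2" "3 ^ k" "card H"] by auto
  then have "\<not> 2 \<le> k" using le_imp_power_dvd[of 2 k "3::nat"] by blast
  then have "k \<le> 1" by simp
  then have "card (cent H r) \<le> 3" using k power_increasing[of k 1 "3::nat"] by simp
  moreover have sub: "R \<subseteq> cent H r"
    using R'(2) by (auto simp: cent_def power_commutes simp flip: pw) (auto simp: powers_def power_commutes)
  ultimately show c: "cent H r = R" using card_seteq[OF sgpD(1)[OF C(1)] sub] R'(3) by simp
  have three: "R = {1, r, inverse r}"
  proof -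
    have "r * r ^ 2 = 1" using r3 by (simp flip: power_Suc)
    then have "r ^ 2 = inverse r" by (simp only: mult_eq_one_iff)
    moreover have "{..<3::nat} = {0, 1, 2}" by auto
    ultimately show ?thesis using powers_eq[OF r3] pw by simp
  qed
  have inv: "conj_by g r = r \<or> conj_by g r = inverse r" if "g \<in> nrm H R" for g
  proof -
    have "conj_set g R = R" using that by (simp add: nrm_def)
    then have "conj_by g r \<in> R" using conj_by_mem_conj_set[of g r R] R(2) by metis
    moreover have "conj_by g r \<noteq> 1" using conj_by_eq_iff[of g r 1] R(3) by simp
    ultimately show ?thesis using three by auto
  qed
  then show "g \<in> nrm H R \<Longrightarrow> conj_by g r = r \<or> conj_by g r = inverse r" .
  have N: "sgp (nrm H R)" "R \<subseteq> nrm H R" using sgp_nrm[OF H] subset_nrm R' by blast+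
  have "cent (nrm H R) r = cent H r \<inter> nrm H R" by (auto simp: cent_def nrm_def)
  then have "card (cent (nrm H R) r) = 3" using c N(2) R'(3) by (simp add: Int_absorb2)
  then show "card (nrm H R) = 3 \<or> card (nrm H R) = 6"
    using card_normalizer_inverting[OF N(1) _ inv] N(2) R(2) by auto
qed

text \<open>The number of Sylow 3-subgroups is prime to 3 and to 5, so it divides 8 and is 1 or 4;
  the normalizer has order 3 or 6.\<close>

lemma card_cases_3:
  assumes "good H" "3 dvd card H" "\<not> 9 dvd card H" "\<not> 5 dvd card H"
  shows "card H \<in> {3, 6} \<or> card H \<in> {12, 24} \<and> card (sylows 3 H) = 4"
proof -
  note H = good_sgp[OF assms(1)]
  have p: "prime (3::nat)" by simp
  obtain R where R: "R \<in> sylows 3 H" using sylows_nonempty[OF H p] by blast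
  have R': "sgp R" "card R = 3" using sylows_card[OF R(1), of 1] assms(2,3) by simp_all
  have "R \<noteq> {1}" using R'(2) by auto
  then obtain r where r: "r \<in> R" "r \<noteq> 1" using sgpD(2)[OF R'(1)] by blast
  have N: "card (nrm H R) = 3 \<or> card (nrm H R) = 6" using sylow_3_prime(8)[OF assms(1-3) R r] .
  let ?n = "card (sylows 3 H)"

  \<comment> \<open>Counting Sylow 3-subgroups of order 3\<close>
  have n: "?n * card (nrm H R) = card H" "?n mod 3 = 1" using card_sylows[OF H p R] .
  have "?n dvd card H" using n(1) by (metis dvd_triv_left)
  have "card H dvd 8 * 45" using good_card_dvd(1)[OF assms(1)] by simp
  with \<open>?n dvd card H\<close> have d: "?n dvd 8 * 45" by (rule dvd_trans)
  have "\<not> 5 dvd ?n" using assms(4) \<open>?n dvd card H\<close> dvd_trans[of 5 ?n "card H"] by blast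
  then have "coprime 5 ?n" by (intro prime_imp_coprime) simp_all
  moreover have "coprime 3 ?n" using n(2) by (intro prime_imp_coprime) (auto simp: dvd_eq_mod_eq_0)
  ultimately have "coprime ?n (5 * 3 * 3)" by (simp only: coprime_mult_right_iff coprime_commute simp_thms)
  then have "?n dvd 8" using d coprime_dvd_mult_left_iff[of ?n 45 8] by simp
  then have "?n \<in> {1, 4, 10, 40}" using dvd_40_mod_3[OF _ n(2)] dvd_trans[of ?n 8 40] by simp
  then have "?n = 1 \<or> ?n = 4" using dvd_imp_le[OF \<open>?n dvd 8\<close>] by auto
  then show ?thesis using n(1) N by auto
qed

text \<open>The product of \<open>x\<close> and its conjugate is fixed by \<open>z\<close>, because
  \<open>Q\<close> is abelian; but an element of order 3 cannot commute with an involution, so the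
  product is 1.\<close>

lemma involution_inverts_9:
  assumes "good H" and Q: "sgp Q" "Q \<subseteq> H" "card Q = 9" and z: "z \<in> H" "conj_set z Q = Q" "z ^ 2 = 1" "z \<noteq> 1"
    and x: "x \<in> Q"
  shows "conj_by z x = inverse x"
proof -
  have zx: "conj_by z x \<in> Q" using conj_by_mem_conj_set[of z x Q] z(2) x by metis
  let ?u = "x * conj_by z x"
  have u: "?u \<in> Q" using x zx sgpD(3)[OF Q(1)] by blast
  have z2: "z * z = 1" using z(3) by (simp add: power2_eq_square)
  then have zi: "inverse z = z" by (simp add: mult_eq_one_iff)
  have "conj_by z ?u = conj_by z x * conj_by z (conj_by z x)" by (simp add: mult.assoc)
  also have "conj_by z (conj_by z x) = x" unfolding conj_by_mult[symmetric] z2 by simp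
  also have "conj_by z x * x = ?u" using abelian_9[OF Q(1,3) x zx] by simp
  finally have com: "z * ?u = ?u * z" by (simp only: conj_by_eq_self_iff)
  have "?u = 1"
  proof (rule ccontr)
    assume n: "?u \<noteq> 1"
    have "?u ^ 3 = 1" using p_subgroup_order[OF assms(1) Q(1,2), of 3 2 ?u 3] Q(3) u by simp
    moreover have "z ^ 4 = 1" using z(3) by (metis mult_2 numeral_Bit0 power_add power_one power_mult mult_1_left)
    moreover have "?u \<in> H" using u Q(2) by blast
    ultimately show False using good_commute[OF assms(1) z(1) _ com z(4) n, of 4 3] by simp
  qed
  then show ?thesis by (simp only: mult_eq_one_iff)
qed

text \<open>Both involutions invert \<open>Q\<close>, so their product centralizes it; a nontrivial
  element of order dividing 4 cannot commute with an element of order 3.\<close>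

lemma no_two_involutions_9:
  assumes "good H" and Q: "sgp Q" "Q \<subseteq> H" "card Q = 9" and n: "\<And>g. g \<in> H \<Longrightarrow> conj_set g Q = Q"
    and y: "y \<in> H" "y ^ 2 = 1" "y \<noteq> 1" and z: "z \<in> H" "z ^ 2 = 1" "z \<noteq> 1" and yz: "(y * z) ^ 4 = 1"
  shows "y = z"
proof (rule ccontr)
  assume "y \<noteq> z"
  moreover have "inverse z = z" using z(2) by (simp add: power2_eq_square mult_eq_one_iff)
  ultimately have yz1: "y * z \<noteq> 1" by (metis mult_eq_one_iff inverse_inverse_mult)
  have "Q \<noteq> {1}" using Q(3) by auto
  then obtain x where x: "x \<in> Q" "x \<noteq> 1" using sgpD(2)[OF Q(1)] by blast
  have i: "inverse x \<in> Q" using x sgpD(4)[OF Q(1)] by blast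
  have "conj_by (y * z) x = x"
    unfolding conj_by_mult
    using involution_inverts_9[OF assms(1) Q z(1) n[OF z(1)] z(2,3) x(1)]
      involution_inverts_9[OF assms(1) Q y(1) n[OF y(1)] y(2,3) i] by simp
  then have com: "(y * z) * x = x * (y * z)" by (simp only: conj_by_eq_self_iff)
  have "x ^ 3 = 1" using p_subgroup_order[OF assms(1) Q(1,2), of 3 2 x 3] Q(3) x by simp
  moreover have "x \<in> H" "y * z \<in> H" using x Q(2) y z sgpD(3)[OF good_sgp[OF assms(1)]] by auto
  ultimately show False using good_commute[OF assms(1) _ _ com yz1 x(2) yz, of 3] by simp
qed

text \<open>The index of \<open>Q\<close> is 1, 2, 4 or 8, and by
  \<open>no_two_involutions_9\<close> a Sylow 2-subgroup has at most one involution. In index 4 it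
  therefore has an element of order 4; in index 8 it would contain both \<open>t ^ 2\<close> and an
  involution outside \<open>powers t\<close>.\<close>

lemma structure_9:
  assumes "good H" and Q: "sgp Q" "Q \<subseteq> H" "card Q = 9" and n: "\<And>g. g \<in> H \<Longrightarrow> conj_set g Q = Q"
    and d: "\<not> 5 dvd card H"
  shows "card H = 9 \<or> card H = 18 \<and> (\<exists>z\<in>H. z ^ 2 = 1 \<and> z \<noteq> 1) \<or> card H = 36 \<and> (\<exists>t\<in>H. t ^ 4 = 1 \<and> t ^ 2 \<noteq> 1)"
proof -
  note H = good_sgp[OF assms(1)]
  obtain m where m: "card H = 9 * m" using lagrange_sgp[OF H Q(1,2)] Q(3) by (metis dvdE)
  have "9 * m dvd 9 * 40" using good_card_dvd(1)[OF assms(1)] m by simp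
  then have "m dvd 8 * 5" by (simp add: nat_mult_dvd_cancel1)
  moreover have "\<not> 5 dvd m" using d m by auto
  then have "coprime 5 m" by (intro prime_imp_coprime) simp_all
  ultimately have "m dvd 2 ^ 3" using coprime_dvd_mult_left_iff[of m 5 8] by (simp add: coprime_commute)
  then obtain i where i: "i \<le> 3" "m = 2 ^ i" unfolding divides_primepow_nat[OF two_is_prime_nat] by blast
  then have "m \<in> {1, 2, 4, 8}" by (auto simp: le_Suc_eq numeral_3_eq_3)
  have inv: "T \<subseteq> {1, z}" if T: "sgp T" "T \<subseteq> H" "\<And>x. x \<in> T \<Longrightarrow> x ^ 2 = 1" "z \<in> T" "z \<noteq> 1" for T z
  proof
    fix y assume y: "y \<in> T"
    show "y \<in> {1, z}"
    proof (cases "y = 1")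
      case False
      have "(y * z) ^ 2 = 1" using T y sgpD(3) by blast
      then have "((y * z) ^ 2) ^ 2 = 1" by simp
      then have "(y * z) ^ 4 = 1" by (simp flip: power_mult)
      moreover have "y ^ 2 = 1" "z ^ 2 = 1" "y \<in> H" "z \<in> H" using T y by auto
      ultimately have "y = z" using no_two_involutions_9[OF assms(1) Q n] False T(5) by blast
      then show ?thesis by simp
    qed simp
  qed
  show ?thesis
    using \<open>m \<in> {1, 2, 4, 8}\<close>
  proof (elim insertE emptyE)
    assume "m = 2"
    then have "2 dvd card H" using m by simp
    then obtain z where "z \<in> H" "z \<noteq> 1" "z ^ 2 = 1" using exists_prime_order[OF H two_is_prime_nat] by blast
    then show ?thesis using m \<open>m = 2\<close> by auto
  next
    assume "m = 4"
    then have "2 ^ 2 dvd card H" using m by simp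
    then obtain T where T: "sgp T" "T \<subseteq> H" "card T = 2 ^ 2" using exists_sylow[OF H two_is_prime_nat] by blast
    have o: "x ^ 4 = 1" if "x \<in> T" for x using p_subgroup_order[OF assms(1) T that] by simp
    have "\<exists>t\<in>T. t ^ 2 \<noteq> 1"
    proof (rule ccontr)
      assume a: "\<not> (\<exists>t\<in>T. t ^ 2 \<noteq> 1)"
      have "T \<noteq> {1}" using T(3) by auto
      then obtain z where "z \<in> T" "z \<noteq> 1" using sgpD(2)[OF T(1)] by blast
      then have "T \<subseteq> {1, z}" using inv[OF T(1,2)] a by blast
      then have "card T \<le> card {1, z}" by (intro card_mono) simp_all
      also have "\<dots> \<le> 2" by (simp add: card_insert_if)
      finally show False using T(3) by simp
    qed
    then obtain t where "t \<in> T" "t ^ 2 \<noteq> 1" by blast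
    then show ?thesis using o T(2) m \<open>m = 4\<close> by auto
  next
    assume "m = 8"
    then have "2 ^ 3 dvd card H" using m by simp
    then obtain T where T: "sgp T" "T \<subseteq> H" "card T = 2 ^ 3" using exists_sylow[OF H two_is_prime_nat] by blast
    have o: "x ^ 4 = 1" if "x \<in> T" for x using p_subgroup_order[OF assms(1) T that] by simp
    have "8 \<le> card T" using T(3) by simp
    then obtain t y where t: "t \<in> T" "t ^ 2 \<noteq> 1" and y: "y \<in> T" "y \<notin> powers t"
      using two_group_card[OF assms(1) T(1,2) o] by blast
    have y2: "y ^ 2 = 1" using order_4_unique(1)[OF assms(1) T(1,2) o t y] .
    have y1: "y \<noteq> 1" using y(2) sgpD(2)[OF sgp_powers[OF T(1) t(1)]] by blast
    have "(t ^ 2) ^ 2 = 1" using o[OF t(1)] by (simp flip: power_mult)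
    moreover have "t ^ 2 \<in> T" using t T(1) sgp_power by blast
    then have "(y * t ^ 2) ^ 4 = 1" "t ^ 2 \<in> H" "y \<in> H" using o y T sgpD(3)[OF T(1)] by auto
    ultimately have "y = t ^ 2" using no_two_involutions_9[OF assms(1) Q n _ y2 y1 _ _ t(2)] by blast
    then show ?thesis using y(2) by (auto simp: powers_def)
  qed (use m in simp)
qed

subsection \<open>Embeddings\<close>

typedef 'a bij = "{f :: 'a \<Rightarrow> 'a. bij f}" morphisms apply_bij Bij
  by (rule exI[of _ id]) simp

setup_lifting type_definition_bij

instantiation bij :: (type) group_mult
begin
lift_definition one_bij :: "'a bij" is id by simp
lift_definition times_bij :: "'a bij \<Rightarrow> 'a bij \<Rightarrow> 'a bij" is "(\<circ>)" by (simp add: bij_comp)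
lift_definition inverse_bij :: "'a bij \<Rightarrow> 'a bij" is "Hilbert_Choice.inv" by (rule bij_imp_bij_inv)
definition divide_bij :: "'a bij \<Rightarrow> 'a bij \<Rightarrow> 'a bij" where "divide_bij a b = a * inverse b"
instance
  by standard (transfer; auto simp: comp_assoc bij_def divide_bij_def)+
end

lemma apply_bij_simps [simp]: "apply_bij (f * g) k = apply_bij f (apply_bij g k)" "apply_bij 1 k = k"
  by (transfer; simp)+

lemma bij_eqI: "(\<And>k. apply_bij f k = apply_bij g k) \<Longrightarrow> f = g"
  by transfer auto

lemma apply_Bij: "bij f \<Longrightarrow> apply_bij (Bij f) = f"
  by (simp add: Bij_inverse)

section \<open>Embeddings and split extensions\<close>

definition is_emb :: "('a::group_mult \<Rightarrow> 'b::group_mult) \<Rightarrow> 'a set \<Rightarrow> bool" where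
  "is_emb \<phi> H \<longleftrightarrow> inj_on \<phi> H \<and> (\<forall>x\<in>H. \<forall>y\<in>H. \<phi> (x * y) = \<phi> x * \<phi> y)"

lemma is_emb_one: "is_emb \<phi> H \<Longrightarrow> sgp H \<Longrightarrow> \<phi> 1 = 1"
  unfolding is_emb_def using sgpD(2)[of H] by (metis mult_1_left mult_eq_self_group(1))

lemma is_emb_inverse: assumes "is_emb \<phi> H" "sgp H" "x \<in> H" shows "\<phi> (inverse x) = inverse (\<phi> x)"
proof -
  have "\<phi> x * \<phi> (inverse x) = \<phi> (x * inverse x)" using assms sgpD(4)[OF assms(2,3)] by (simp add: is_emb_def del: right_inverse_mult)
  also have "\<dots> = 1" using is_emb_one[OF assms(1,2)] by simp
  finally show ?thesis by (simp only: mult_eq_one_iff)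
qed

lemma is_emb_power: assumes "is_emb \<phi> H" "sgp H" "x \<in> H" shows "\<phi> (x ^ n) = \<phi> x ^ n"
  using assms sgp_power[OF assms(2,3)] is_emb_one[OF assms(1,2)] by (induct n) (simp_all add: is_emb_def)

text \<open>The nontrivial powers of \<open>t\<close> avoid \<open>N\<close> and those of
  \<open>t'\<close> avoid its image, so \<open>x * t ^ j\<close> with \<open>j < n\<close> is a
  normal form on both sides. Compatibility with conjugation by \<open>t\<close> and
  \<open>t'\<close> makes products of normal forms correspond.\<close>

lemma extend_embedding:
  fixes \<phi> :: "'a::group_mult \<Rightarrow> 'b::group_mult"
  assumes N: "sgp N" and \<phi>: "is_emb \<phi> N" and n: "n > 0" "t ^ n = 1" "t' ^ n = 1"
    and cN: "\<And>x. x \<in> N \<Longrightarrow> conj_by t x \<in> N"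
    and c\<phi>: "\<And>x. x \<in> N \<Longrightarrow> \<phi> (conj_by t x) = conj_by t' (\<phi> x)"
    and tN: "\<And>j. 0 < j \<Longrightarrow> j < n \<Longrightarrow> t ^ j \<notin> N" and t'N: "\<And>j. 0 < j \<Longrightarrow> j < n \<Longrightarrow> t' ^ j \<notin> \<phi> ` N"
  defines "M \<equiv> (\<lambda>(x, j). x * t ^ j) ` (N \<times> {..<n})"
  obtains \<psi> where "is_emb \<psi> M" "\<And>x j. x \<in> N \<Longrightarrow> \<psi> (x * t ^ j) = \<phi> x * t' ^ j"
    "sgp M" "card M = card N * n" "N \<subseteq> M" "t \<in> M"
proof -
  have hom: "\<phi> (x * y) = \<phi> x * \<phi> y" if "x \<in> N" "y \<in> N" for x y using \<phi> that by (simp add: is_emb_def)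
  have pc: "conj_by (t ^ i) x \<in> N \<and> \<phi> (conj_by (t ^ i) x) = conj_by (t' ^ i) (\<phi> x)" if "x \<in> N" for i x
  proof (induct i)
    case (Suc i)
    then show ?case using cN c\<phi> unfolding power_Suc conj_by_mult by metis
  qed (use that in simp)
  \<comment> \<open>Two equal normal forms give \<open>inverse y * x = t ^ (j - i)\<close>; the
    order \<open>i \<le> j\<close> keeps the exponent natural.\<close>
  have uni: "i = j \<and> x = y" if "x * t ^ i = y * t ^ j" "x \<in> N" "y \<in> N" "i < n" "j < n" "i \<le> j" for x y i j
  proof -
    have "x * t ^ i = y * t ^ (j - i) * t ^ i" using that(1,6) by (simp add: mult.assoc flip: power_add)
    then have "x = y * t ^ (j - i)" by (simp only: mult_right_cancel_group)
    then have e: "inverse y * x = t ^ (j - i)" by simp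
    have "inverse y * x \<in> N" using that N sgpD by metis
    then have "j = i" using tN[of "j - i"] e that(5,6) by fastforce
    then show ?thesis using that(1) by simp
  qed
  have uni': "i = j \<and> x = y" if "\<phi> x * t' ^ i = \<phi> y * t' ^ j" "x \<in> N" "y \<in> N" "i < n" "j < n" "i \<le> j" for x y i j
  proof -
    have "\<phi> x * t' ^ i = \<phi> y * t' ^ (j - i) * t' ^ i" using that(1,6) by (simp add: mult.assoc flip: power_add)
    then have "\<phi> x = \<phi> y * t' ^ (j - i)" by (simp only: mult_right_cancel_group)
    then have "inverse (\<phi> y) * \<phi> x = t' ^ (j - i)" by simp
    moreover have "inverse (\<phi> y) * \<phi> x = \<phi> (inverse y * x)"
      using hom[of "inverse y" x] is_emb_inverse[OF \<phi> N] that sgpD(4)[OF N] by simp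
    moreover have "inverse y * x \<in> N" using that N sgpD by metis
    ultimately have "t' ^ (j - i) \<in> \<phi> ` N" by force
    then have "j = i" using t'N[of "j - i"] that(5,6) by fastforce
    then show ?thesis using that(1-3) \<phi> by (auto simp: is_emb_def inj_on_def)
  qed
  let ?P = "\<lambda>(x, j). x * t ^ j" and ?P' = "\<lambda>(x, j). \<phi> x * t' ^ j" and ?D = "N \<times> {..<n}"
  have inj: "inj_on ?P ?D"
  proof (rule inj_onI, clarsimp)
    fix x i y j assume "x \<in> N" "i < n" "y \<in> N" "j < n" "x * t ^ i = y * t ^ j"
    then show "x = y \<and> i = j" using uni[of x i y j] uni[of y j x i] by (cases "i \<le> j") auto
  qed
  have inj': "inj_on ?P' ?D"
  proof (rule inj_onI, clarsimp)
    fix x i y j assume "x \<in> N" "i < n" "y \<in> N" "j < n" "\<phi> x * t' ^ i = \<phi> y * t' ^ j"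
    then show "x = y \<and> i = j" using uni'[of x i y j] uni'[of y j x i] by (cases "i \<le> j") auto
  qed
  \<comment> \<open>\<open>\<psi>\<close> recovers the normal form and substitutes
    \<open>\<phi> x\<close> and \<open>t'\<close>; for arbitrary \<open>j\<close> the exponent is
    first reduced modulo \<open>n\<close>.\<close>
  define \<psi> where "\<psi> = ?P' \<circ> inv_into ?D ?P"
  have \<psi>: "\<psi> (x * t ^ j) = \<phi> x * t' ^ j" if "x \<in> N" for x j
  proof -
    have "inv_into ?D ?P (?P (x, j mod n)) = (x, j mod n)"
      using that n(1) by (intro inv_into_f_f inj) simp
    then show ?thesis using power_mod_order[OF n(2), of j] power_mod_order[OF n(3), of j] by (simp add: \<psi>_def)
  qed
  have MI: "x * t ^ j \<in> M" if "x \<in> N" for x j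
    unfolding M_def using that n(1) power_mod_order[OF n(2), of j]
    by (intro image_eqI[of _ _ "(x, j mod n)"]) simp_all
  have mul: "(x * t ^ i) * (y * t ^ j) = (x * conj_by (t ^ i) y) * t ^ (i + j)" for x y i j
    by (simp add: mult.assoc power_add)
  have mul': "(x * t' ^ i) * (y * t' ^ j) = (x * conj_by (t' ^ i) y) * t' ^ (i + j)" for x y i j
    by (simp add: mult.assoc power_add)
  have xc: "x * conj_by (t ^ i) y \<in> N" if "x \<in> N" "y \<in> N" for x y i
    using pc[OF that(2)] that sgpD(3)[OF N] by blast
  have "\<psi> (u * v) = \<psi> u * \<psi> v" if uv: "u \<in> M" "v \<in> M" for u v
  proof -
    obtain x i y j where *: "u = x * t ^ i" "v = y * t ^ j" "x \<in> N" "y \<in> N" using uv by (auto simp: M_def)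
    have "\<psi> (u * v) = \<phi> (x * conj_by (t ^ i) y) * t' ^ (i + j)"
      unfolding * mul using \<psi>[OF xc[OF *(3,4)]] .
    also have "\<phi> (x * conj_by (t ^ i) y) = \<phi> x * conj_by (t' ^ i) (\<phi> y)"
      using hom[OF *(3)] pc[OF *(4)] by metis
    also have "\<phi> x * conj_by (t' ^ i) (\<phi> y) * t' ^ (i + j) = \<psi> u * \<psi> v"
      unfolding * \<psi>[OF *(3)] \<psi>[OF *(4)] mul' ..
    finally show ?thesis .
  qed
  moreover have "inj_on \<psi> M"
  proof -
    have "inj_on ?P' (inv_into ?D ?P ` M)" unfolding M_def using inj inj' by simp
    moreover have "inj_on (inv_into ?D ?P) M" unfolding M_def by (rule inj_on_inv_into) simp
    ultimately show ?thesis unfolding \<psi>_def by (intro comp_inj_on)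
  qed
  ultimately have "is_emb \<psi> M" by (simp add: is_emb_def)
  moreover have "sgp M"
  proof (rule sgp_finite_closed)
    show "finite M" using sgpD(1)[OF N] by (simp add: M_def)
    show "M \<noteq> {}" using MI[OF sgpD(2)[OF N]] by blast
    fix u v assume uv: "u \<in> M" "v \<in> M"
    then obtain x i y j where *: "u = x * t ^ i" "v = y * t ^ j" "x \<in> N" "y \<in> N" by (auto simp: M_def)
    show "u * v \<in> M" unfolding * mul using MI[OF xc[OF *(3,4)]] .
  qed
  moreover have "card M = card N * n" unfolding M_def using card_image[OF inj] by (simp add: card_cartesian_product)
  moreover have "N \<subseteq> M" using MI[of _ 0] by auto
  moreover have "t \<in> M" using MI[OF sgpD(2)[OF N], of 1] by simp
  ultimately show thesis using that \<psi> by blast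
qed

lemma (in action) permutation_embedding:
  assumes faithful: "\<And>g. g \<in> H \<Longrightarrow> (\<And>x. x \<in> \<Omega> \<Longrightarrow> act g x = x) \<Longrightarrow> g = 1"
    and e: "bij_betw e \<Omega> S"
  obtains \<phi> :: "'a \<Rightarrow> 'c bij" where "is_emb \<phi> H" "\<And>g. g \<in> H \<Longrightarrow> apply_bij (\<phi> g) permutes S"
    "\<And>g x. g \<in> H \<Longrightarrow> x \<in> \<Omega> \<Longrightarrow> apply_bij (\<phi> g) (e x) = e (act g x)"
proof -
  \<comment> \<open>The action is transported along \<open>e\<close>; points outside
    \<open>S\<close> are fixed, so that \<open>p g\<close> is a bijection of the whole type.\<close>
  define p where "p = (\<lambda>g k. if k \<in> S then e (act g (inv_into \<Omega> e k)) else k)"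
  have i: "inv_into \<Omega> e k \<in> \<Omega>" if "k \<in> S" for k
    using e that by (metis bij_betw_imp_surj_on inv_into_into)
  have ie: "inv_into \<Omega> e (e x) = x" if "x \<in> \<Omega>" for x using e that by (metis bij_betw_inv_into_left)
  have ei: "e (inv_into \<Omega> e k) = k" if "k \<in> S" for k using e that by (metis bij_betw_inv_into_right)
  have eS: "e x \<in> S" if "x \<in> \<Omega>" for x using e that by (metis bij_betwE)
  have pm: "p (g * h) k = p g (p h k)" if "g \<in> H" "h \<in> H" for g h k
    using that i[of k] by (simp add: p_def eS ie act_in act_mult)
  have p1: "p 1 k = k" for k using i[of k] ei[of k] by (simp add: p_def act_one)
  have bj: "bij (p g)" if "g \<in> H" for g
    using pm[of g "inverse g"] pm[of "inverse g" g] p1 that sgpD(4)[OF sgp]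
    by (intro o_bij[of "p (inverse g)"]) (auto simp: fun_eq_iff)
  have pe: "p g (e x) = e (act g x)" if "x \<in> \<Omega>" for g x using that by (simp add: p_def eS ie)
  define \<phi> where "\<phi> = (\<lambda>g. Bij (p g))"
  have ap: "apply_bij (\<phi> g) = p g" if "g \<in> H" for g using bj[OF that] by (simp add: \<phi>_def apply_Bij)
  have "\<phi> (g * h) = \<phi> g * \<phi> h" if "g \<in> H" "h \<in> H" for g h
    using that pm ap sgpD(3)[OF sgp] by (intro bij_eqI) simp
  moreover have "inj_on \<phi> H"
  proof
    fix g h assume gh: "g \<in> H" "h \<in> H" "\<phi> g = \<phi> h"
    have gi: "inverse g * h \<in> H" using gh sgpD[OF sgp] by blast
    have "act (inverse g * h) x = x" if x: "x \<in> \<Omega>" for x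
    proof -
      have "e (act g x) = e (act h x)" using gh ap pe[OF x] by metis
      then have "act g x = act h x" using ie act_in gh x by metis
      then show ?thesis using act_eq_iff[OF gh(1,2) x] by simp
    qed
    then have "inverse g * h = 1" using faithful[OF gi] by blast
    then show "g = h" by (simp add: mult_eq_one_iff)
  qed
  ultimately have "is_emb \<phi> H" by (simp add: is_emb_def)
  moreover have "apply_bij (\<phi> g) permutes S" if "g \<in> H" for g
    unfolding ap[OF that] permutes_def using bj[OF that, unfolded bij_iff] by (simp add: p_def)
  moreover have "apply_bij (\<phi> g) (e x) = e (act g x)" if "g \<in> H" "x \<in> \<Omega>" for g x
    using ap pe that by simp
  ultimately show thesis using that by blast
qed


section \<open>Reference elements of the alternating group\<close>

definition A6_bij :: "nat bij set" where
  "A6_bij = {g. apply_bij g permutes {1..6} \<and> evenperm (apply_bij g)}"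

definition embeds_A6 :: "'a::group_mult set \<Rightarrow> bool" where
  "embeds_A6 H \<longleftrightarrow> (\<exists>\<phi>. is_emb \<phi> H \<and> \<phi> ` H \<subseteq> A6_bij)"

lemma apply_bij_inverse: "apply_bij (inverse g) = Hilbert_Choice.inv (apply_bij g)"
  by transfer simp

lemma apply_bij_mult: "apply_bij (f * g) = apply_bij f \<circ> apply_bij g"
  by transfer simp

lemma apply_bij_one: "apply_bij 1 = id"
  by transfer simp

lemma permutes_imp_permutation_nat: "p permutes {1..6::nat} \<Longrightarrow> permutation p"
  by (auto simp: permutation_permutes)

lemma sgp_A6_bij: "sgp A6_bij"
proof (rule sgp_finite_closed)
  have "inj_on apply_bij A6_bij" by (simp add: inj_on_def apply_bij_inject)
  moreover have "finite (apply_bij ` A6_bij)"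
    by (rule finite_subset[OF _ finite_permutations[of "{1..6::nat}"]]) (auto simp: A6_bij_def)
  ultimately show "finite A6_bij" by (rule finite_imageD[rotated])
  have "1 \<in> A6_bij" by (simp add: A6_bij_def apply_bij_one permutes_id evenperm_id)
  then show "A6_bij \<noteq> {}" by blast
  fix x y assume "x \<in> A6_bij" "y \<in> A6_bij"
  then show "x * y \<in> A6_bij"
    by (auto simp: A6_bij_def apply_bij_mult permutes_compose evenperm_comp permutes_imp_permutation_nat)
qed

lemma A6_bij_eqI:
  assumes "f \<in> A6_bij" "g \<in> A6_bij" "\<forall>k\<in>{1,2,3,4,5,6}. apply_bij f k = apply_bij g k"
  shows "f = g"
proof (rule bij_eqI)
  fix k
  show "apply_bij f k = apply_bij g k"
  proof (cases "k \<in> {1..6}")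
    case True
    then have "k \<in> {1,2,3,4,5,6}" by auto
    then show ?thesis using assms(3) by blast
  next
    case False
    then have "apply_bij f k = k" "apply_bij g k = k"
      using assms(1,2) permutes_not_in[OF _ False] unfolding A6_bij_def by blast+
    then show ?thesis by simp
  qed
qed

text \<open>Even by construction, so membership of products in \<open>A6_bij\<close> takes no
  computation of signs. With \<open>b = c\<close> and otherwise distinct points this is a
  three-cycle.\<close>

definition swap2 :: "nat \<Rightarrow> nat \<Rightarrow> nat \<Rightarrow> nat \<Rightarrow> nat bij" where
  "swap2 a b c d = Bij (transpose a b) * Bij (transpose c d)"

lemma apply_swap2: "apply_bij (swap2 a b c d) k = transpose a b (transpose c d k)"
  by (simp add: swap2_def apply_Bij)

lemma swap2_A6:
  assumes "{a, b, c, d} \<subseteq> {1..6}" "a \<noteq> b" "c \<noteq> d" shows "swap2 a b c d \<in> A6_bij"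
proof -
  have "apply_bij (swap2 a b c d) = transpose a b \<circ> transpose c d" by (auto simp: apply_swap2)
  then show ?thesis
    using assms by (simp add: A6_bij_def permutes_compose permutes_swap_id evenperm_comp permutation_swap_id evenperm_swap)
qed

text \<open>In cycle notation: \<open>(1 2 3)\<close>, \<open>(4 5 6)\<close>, \<open>(1 4)(2 5 3 6)\<close>, \<open>(1 2 3 4 5)\<close>, \<open>(2 5)(3 4)\<close>,
  \<open>(1 2 3 4)(5 6)\<close>, \<open>(1 3)(5 6)\<close>.\<close>
definition "A6_a = swap2 1 2 2 3"
definition "A6_b = swap2 4 5 5 6"
definition "A6_t = swap2 1 4 2 5 * swap2 5 3 3 6"
definition "A6_f = swap2 1 2 2 3 * swap2 3 4 4 5"
definition "A6_w = swap2 2 5 3 4"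
definition "A6_x = swap2 1 2 2 3 * swap2 3 4 5 6"
definition "A6_y = swap2 1 3 5 6"

lemmas A6_defs = A6_a_def A6_b_def A6_t_def A6_f_def A6_w_def A6_x_def A6_y_def

lemma A6_elements:
  "A6_a \<in> A6_bij" "A6_b \<in> A6_bij" "A6_t \<in> A6_bij" "A6_f \<in> A6_bij" "A6_w \<in> A6_bij" "A6_x \<in> A6_bij" "A6_y \<in> A6_bij"
  unfolding A6_defs by (simp_all add: swap2_A6 sgpD[OF sgp_A6_bij])

lemmas A6_elements_mult = sgpD(2-4)[OF sgp_A6_bij] sgp_power[OF sgp_A6_bij] A6_elements

text \<open>The relations that the abstract generators will satisfy: \<open>A6_t\<close> acts on the
  group of \<open>A6_a\<close> and \<open>A6_b\<close> as multiplication by a square root of -1 acts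
  on the field with 9 elements, \<open>A6_w\<close> inverts \<open>A6_f\<close>, and
  \<open>A6_y\<close> inverts \<open>A6_x\<close>.\<close>

lemma A6_relations:
  "A6_a ^ 3 = 1" "A6_b ^ 3 = 1" "A6_t ^ 4 = 1" "A6_f ^ 5 = 1" "A6_w ^ 2 = 1" "A6_x ^ 4 = 1" "A6_y ^ 2 = 1"
  "A6_t * A6_a = A6_b * A6_t" "A6_t * A6_b = A6_a ^ 2 * A6_t" "A6_a * A6_b = A6_b * A6_a"
  "A6_w * A6_f = A6_f ^ 4 * A6_w" "A6_y * A6_x = A6_x ^ 3 * A6_y"
  by (rule A6_bij_eqI; simp add: A6_elements_mult; simp add: A6_defs apply_swap2 eval_nat_numeral transpose_def)+

lemma conj_byI: "g * x = z * g \<Longrightarrow> conj_by g x = z"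
  by (simp add: mult.assoc)

lemma A6_nontrivial:
  "A6_a \<noteq> 1" "A6_f \<noteq> 1" "A6_x ^ 2 \<noteq> 1" "A6_t ^ 2 \<noteq> 1" "A6_y \<noteq> 1" "A6_y \<noteq> A6_x" "A6_y \<noteq> A6_x ^ 2" "A6_y \<noteq> A6_x ^ 3"
  "A6_b \<noteq> 1" "A6_b \<noteq> A6_a" "A6_b \<noteq> A6_a ^ 2" "A6_w \<noteq> 1"
proof -
  have neq: "f \<noteq> g" if "apply_bij f k \<noteq> apply_bij g k" for f g :: "nat bij" and k using that by auto
  note s = A6_defs apply_swap2 eval_nat_numeral transpose_def
  show "A6_a \<noteq> 1" by (rule neq[of _ 1]) (simp add: s)
  show "A6_f \<noteq> 1" by (rule neq[of _ 1]) (simp add: s)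
  show "A6_x ^ 2 \<noteq> 1" by (rule neq[of _ 1]) (simp add: s)
  show "A6_t ^ 2 \<noteq> 1" by (rule neq[of _ 2]) (simp add: s)
  show "A6_y \<noteq> 1" by (rule neq[of _ 1]) (simp add: s)
  show "A6_y \<noteq> A6_x" by (rule neq[of _ 1]) (simp add: s)
  show "A6_y \<noteq> A6_x ^ 2" by (rule neq[of _ 2]) (simp add: s)
  show "A6_y \<noteq> A6_x ^ 3" by (rule neq[of _ 1]) (simp add: s)
  show "A6_b \<noteq> 1" by (rule neq[of _ 4]) (simp add: s)
  show "A6_b \<noteq> A6_a" by (rule neq[of _ 1]) (simp add: s)
  show "A6_b \<noteq> A6_a ^ 2" by (rule neq[of _ 1]) (simp add: s)
  show "A6_w \<noteq> 1" by (rule neq[of _ 2]) (simp add: s)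
qed

lemma extend_A6:
  assumes H: "sgp H" "N \<subseteq> H" "t \<in> H" and B: "\<phi> ` N \<subseteq> A6_bij" "t' \<in> A6_bij"
    and ext: "sgp N" "is_emb \<phi> N" "n > 0" "t ^ n = 1" "t' ^ n = 1"
      "\<And>x. x \<in> N \<Longrightarrow> conj_by t x \<in> N" "\<And>x. x \<in> N \<Longrightarrow> \<phi> (conj_by t x) = conj_by t' (\<phi> x)"
      "\<And>j. 0 < j \<Longrightarrow> j < n \<Longrightarrow> t ^ j \<notin> N" "\<And>j. 0 < j \<Longrightarrow> j < n \<Longrightarrow> t' ^ j \<notin> \<phi> ` N"
  obtains M \<psi> where "M = (\<lambda>(x, j). x * t ^ j) ` (N \<times> {..<n})" "is_emb \<psi> M" "\<psi> ` M \<subseteq> A6_bij"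
    "\<And>x j. x \<in> N \<Longrightarrow> \<psi> (x * t ^ j) = \<phi> x * t' ^ j" "sgp M" "M \<subseteq> H" "card M = card N * n"
    "card N * n = card H \<Longrightarrow> embeds_A6 H"
proof -
  let ?M = "(\<lambda>(x, j). x * t ^ j) ` (N \<times> {..<n})"
  obtain \<psi> where \<psi>: "is_emb \<psi> ?M" "\<And>x j. x \<in> N \<Longrightarrow> \<psi> (x * t ^ j) = \<phi> x * t' ^ j" "sgp ?M"
      "card ?M = card N * n" "N \<subseteq> ?M" "t \<in> ?M"
    by (rule extend_embedding[OF ext]) (assumption | rule that)+
  have im: "\<psi> ` ?M \<subseteq> A6_bij"
    using \<psi>(2) B by (auto simp: sgpD(3)[OF sgp_A6_bij] sgp_power[OF sgp_A6_bij] image_subset_iff)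
  have sub: "?M \<subseteq> H" using H sgpD(3)[OF H(1)] sgp_power[OF H(1,3)] by auto
  have "embeds_A6 H" if "card N * n = card H"
  proof -
    have "?M = H" using sgp_eq_if_card_eq[OF H(1) sub] \<psi>(4) that by simp
    then show ?thesis using \<psi>(1) im unfolding embeds_A6_def by metis
  qed
  then show thesis using that[OF refl \<psi>(1) im \<psi>(2,3) sub \<psi>(4)] by blast
qed

lemma is_emb_trivial: "is_emb (\<lambda>_. 1) {1}"
  by (simp add: is_emb_def)

lemma sgp_trivial: "sgp {1}"
  by (simp add: sgp_def)

lemma cyclic_A6:
  assumes "sgp H" "x \<in> H" "x' \<in> A6_bij" "n > 0" "x ^ n = 1" "x' ^ n = 1"
    and "\<And>j. 0 < j \<Longrightarrow> j < n \<Longrightarrow> x ^ j \<noteq> 1" "\<And>j. 0 < j \<Longrightarrow> j < n \<Longrightarrow> x' ^ j \<noteq> 1"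
  obtains \<psi> where "is_emb \<psi> (powers x)" "\<psi> ` powers x \<subseteq> A6_bij" "\<And>i. \<psi> (x ^ i) = x' ^ i"
    "card (powers x) = n" "n = card H \<Longrightarrow> embeds_A6 H"
proof -
  obtain M \<psi> where *: "M = (\<lambda>(y, j). y * x ^ j) ` ({1} \<times> {..<n})" "is_emb \<psi> M" "\<psi> ` M \<subseteq> A6_bij"
    "\<And>y j. y \<in> {1} \<Longrightarrow> \<psi> (y * x ^ j) = 1 * x' ^ j" "card M = card {1::'a} * n" "card {1::'a} * n = card H \<Longrightarrow> embeds_A6 H"
    by (rule extend_A6[of H "{1}" x "\<lambda>_. 1" x' n])
      (use assms sgpD(2)[OF assms(1)] sgpD(2)[OF sgp_A6_bij] in \<open>simp_all add: is_emb_trivial sgp_trivial\<close>)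
  have "M = powers x" using *(1) powers_eq[OF assms(5,4)] by (auto simp: image_def)
  moreover have "\<psi> (x ^ i) = x' ^ i" for i using *(4)[of 1 i] by simp
  ultimately show thesis using * that by simp
qed

text \<open>Two extension steps, first by \<open>x\<close>, then by \<open>y\<close>. The common
  exponent \<open>r\<close> in the two conjugation relations is what makes the embeddings
  compatible.\<close>

lemma metacyclic_A6:
  assumes H: "sgp H" "x \<in> H" "y \<in> H" and B: "x' \<in> A6_bij" "y' \<in> A6_bij"
    and m: "m > 0" "x ^ m = 1" "x' ^ m = 1" "\<And>j. 0 < j \<Longrightarrow> j < m \<Longrightarrow> x ^ j \<noteq> 1" "\<And>j. 0 < j \<Longrightarrow> j < m \<Longrightarrow> x' ^ j \<noteq> 1"
    and n: "n > 0" "y ^ n = 1" "y' ^ n = 1"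
      "\<And>j. 0 < j \<Longrightarrow> j < n \<Longrightarrow> y ^ j \<notin> powers x" "\<And>j. 0 < j \<Longrightarrow> j < n \<Longrightarrow> y' ^ j \<notin> powers x'"
    and r: "conj_by y x = x ^ r" "conj_by y' x' = x' ^ r"
  obtains M \<psi> where "M = (\<lambda>(z, j). z * y ^ j) ` (powers x \<times> {..<n})" "is_emb \<psi> M" "\<psi> ` M \<subseteq> A6_bij"
    "\<And>i j. \<psi> (x ^ i * y ^ j) = x' ^ i * y' ^ j" "sgp M" "M \<subseteq> H" "card M = m * n" "m * n = card H \<Longrightarrow> embeds_A6 H"
proof -
  obtain \<phi> where \<phi>: "is_emb \<phi> (powers x)" "\<phi> ` powers x \<subseteq> A6_bij" "\<And>i. \<phi> (x ^ i) = x' ^ i" "card (powers x) = m"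
    using cyclic_A6[OF H(1,2) B(1) m] by blast
  have im: "\<phi> ` powers x = powers x'" by (simp add: powers_def image_image \<phi>(3))
  have c: "conj_by y (x ^ i) = x ^ (r * i)" "conj_by y' (x' ^ i) = x' ^ (r * i)" for i
    unfolding conj_by_power[symmetric] r by (simp_all add: power_mult)
  obtain M \<psi> where *: "M = (\<lambda>(z, j). z * y ^ j) ` (powers x \<times> {..<n})" "is_emb \<psi> M" "\<psi> ` M \<subseteq> A6_bij"
    "\<And>z j. z \<in> powers x \<Longrightarrow> \<psi> (z * y ^ j) = \<phi> z * y' ^ j" "sgp M" "M \<subseteq> H" "card M = card (powers x) * n"
    "card (powers x) * n = card H \<Longrightarrow> embeds_A6 H"
  proof (rule extend_A6[OF H(1) powers_subset[OF H(1,2)] H(3) \<phi>(2) B(2) sgp_powers[OF H(1,2)] \<phi>(1) n(1-3)])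
    show "conj_by y z \<in> powers x" if "z \<in> powers x" for z
      using that unfolding powers_def by (elim rangeE, simp only: c) blast
    show "\<phi> (conj_by y z) = conj_by y' (\<phi> z)" if "z \<in> powers x" for z
      using that unfolding powers_def by (elim rangeE, simp only: c \<phi>(3))
  qed (use n im in auto)
  have "\<psi> (x ^ i * y ^ j) = x' ^ i * y' ^ j" for i j
    using *(4)[of "x ^ i" j] \<phi>(3) by (simp add: powers_def)
  then show thesis using that[OF *(1-3) _ *(5,6)] *(7,8) \<phi>(4) by simp
qed

section \<open>Embeddings order by order\<close>

lemma order_4_powers:
  fixes x :: "'a::group_mult"
  assumes "x ^ 4 = 1" "x ^ 2 \<noteq> 1" "0 < j" "j < 4" shows "x ^ j \<noteq> 1"
proof
  assume j: "x ^ j = 1"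
  have "j = 1 \<or> j = 2 \<or> j = 3" using assms by linarith
  then show False
  proof (elim disjE)
    assume "j = 3"
    then have "x = 1" using power_3_4 assms(1) j by blast
    then show False using assms(2) by simp
  qed (use assms j in auto)
qed

lemma prime_powers_ne_1:
  fixes x :: "'a::group_mult"
  assumes "x ^ p = 1" "x \<noteq> 1" "prime p" "0 < j" "j < p" shows "x ^ j \<noteq> 1"
proof
  assume "x ^ j = 1"
  moreover have "coprime p j" using assms by (intro prime_imp_coprime) (auto dest: dvd_imp_le)
  ultimately show False using power_coprime_eq_1[OF assms(1)] assms(2) by blast
qed

lemma powers_4: assumes "x ^ 4 = 1" shows "powers x = {1, x, x ^ 2, x ^ 3}"
proof -
  have "{..<4::nat} = {0, 1, 2, 3}" by auto
  then show ?thesis using powers_eq[OF assms] by simp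
qed

lemma powers_3: assumes "x ^ 3 = 1" shows "powers x = {1, x, x ^ 2}"
proof -
  have "{..<3::nat} = {0, 1, 2}" by auto
  then show ?thesis using powers_eq[OF assms] by simp
qed

lemma powers_2: assumes "x ^ 2 = 1" shows "powers x = {1, x}"
proof -
  have "{..<2::nat} = {0, 1}" by auto
  then show ?thesis using powers_eq[OF assms] by simp
qed

text \<open>In order 8 \<open>order_4_unique\<close> leaves only the dihedral group, matched with
  \<open>A6_x\<close> and \<open>A6_y\<close>. A cyclic group of order 4 goes to the powers of
  \<open>A6_x\<close>, a four-group to \<open>A6_x ^ 2\<close> and \<open>A6_y\<close>, a group of
  order 2 to the powers of \<open>A6_y\<close>.\<close>

lemma embeds_2_group:
  assumes "good H" and H4: "\<And>x. x \<in> H \<Longrightarrow> x ^ 4 = 1" and c: "card H \<in> {1, 2, 4, 8}"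
  shows "embeds_A6 H"
proof -
  note H = good_sgp[OF assms(1)]
  consider (1) "card H = 1" | (8) "card H = 8" | (4) "card H = 4" "\<exists>t\<in>H. t ^ 2 \<noteq> 1"
    | (22) "card H = 4" "\<forall>t\<in>H. t ^ 2 = 1" | (2) "card H = 2"
    using c by auto
  then show ?thesis
  proof cases
    case 1
    then have "H = {1}" using sgpD(2)[OF H] by (metis card_1_singletonE singletonD)
    then show ?thesis using is_emb_trivial sgpD(2)[OF sgp_A6_bij] unfolding embeds_A6_def by blast
  next
    case 8
    then have "8 \<le> card H" by simp
    then obtain t y where t: "t \<in> H" "t ^ 2 \<noteq> 1" and y: "y \<in> H" "y \<notin> powers t"
      using two_group_card[OF assms(1) H subset_refl H4] by blast
    have t4: "t ^ 4 = 1" using H4 t by blast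
    have y': "y ^ 2 = 1" "conj_by y t = inverse t"
      using order_4_unique[OF assms(1) H subset_refl H4 t y] by blast+
    have "t * t ^ 3 = 1" using t4 by (simp flip: power_Suc)
    then have "conj_by y t = t ^ 3" using y'(2) by (simp only: mult_eq_one_iff)
    moreover have "conj_by A6_y A6_x = A6_x ^ 3" using A6_relations(12) by (rule conj_byI)
    ultimately show ?thesis
      using metacyclic_A6[OF H t(1) y(1) A6_elements(6,7) _ t4 A6_relations(6) order_4_powers[OF t4 t(2)]
          order_4_powers[OF A6_relations(6) A6_nontrivial(3)] _ y'(1) A6_relations(7), of 3] y(2) 8
        A6_nontrivial powers_4[OF A6_relations(6)] by (auto simp: less_2_cases_iff)
  next
    case 4
    then obtain t where t: "t \<in> H" "t ^ 2 \<noteq> 1" by blast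
    have t4: "t ^ 4 = 1" using H4 t by blast
    show ?thesis
      using cyclic_A6[OF H t(1) A6_elements(6) _ t4 A6_relations(6) order_4_powers[OF t4 t(2)]
          order_4_powers[OF A6_relations(6) A6_nontrivial(3)]] 4 by auto
  next
    case 22
    have "\<not> H \<subseteq> {1}" using 22 card_mono[of "{1}" H] by auto
    then obtain u where u: "u \<in> H" "u \<noteq> 1" by blast
    have "\<not> H \<subseteq> {1, u}"
    proof
      assume "H \<subseteq> {1, u}"
      then have "card H \<le> card {1, u}" by (intro card_mono) auto
      then show False using 22 by (simp add: card_insert_if split: if_splits)
    qed
    then obtain v where v: "v \<in> H" "v \<notin> {1, u}" by blast
    have inv: "inverse z = z" if "z \<in> H" for z
      using 22(2) that by (simp add: power2_eq_square mult_eq_one_iff)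
    have u2: "u ^ 2 = 1" "v ^ 2 = 1" using 22 u v by auto
    have "v * u = u * v" using inv[of "v * u"] inv[of u] inv[of v] u v sgpD(3)[OF H] by simp
    \<comment> \<open>A four-group is treated as metacyclic with conjugation exponent 1.\<close>
    then have "conj_by v u = u ^ 1" by (intro conj_byI) simp
    moreover have x2: "(A6_x ^ 2) ^ 2 = 1" using A6_relations(6) by (simp flip: power_mult)
    moreover have "conj_by A6_y (A6_x ^ 2) = (A6_x ^ 2) ^ 1"
    proof -
      have "conj_by A6_y (A6_x ^ 2) = (A6_x ^ 3) ^ 2"
        unfolding conj_by_power[symmetric] conj_byI[OF A6_relations(12)] ..
      also have "\<dots> = A6_x ^ 6" by (simp flip: power_mult)
      also have "\<dots> = A6_x ^ 2" using power_mod_order[OF A6_relations(6), of 6] by simp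
      finally show ?thesis by simp
    qed
    moreover have "A6_x ^ 2 \<in> A6_bij" by (simp add: A6_elements_mult)
    ultimately show ?thesis
      using metacyclic_A6[OF H u(1) v(1), of "A6_x ^ 2" A6_y 2 2 1] A6_elements(7) u2 A6_relations(7)
        A6_nontrivial u v 22 by (auto simp: less_2_cases_iff powers_2)
  next
    case 2
    have "\<not> H \<subseteq> {1}" using 2 card_mono[of "{1}" H] by auto
    then obtain u where u: "u \<in> H" "u \<noteq> 1" by blast
    have "u ^ 2 = 1" using power_card_eq_1[OF H u(1)] 2 by simp
    then show ?thesis
      using cyclic_A6[OF H u(1) A6_elements(7), of 2] A6_relations(7) A6_nontrivial(5) 2 u(2)
      by (auto simp: less_2_cases_iff)
  qed
qed

lemma powers_coprime:
  fixes x y :: "'a::group_mult"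
  assumes "y \<in> powers x" "x ^ m = 1" "y ^ n = 1" "coprime m n" shows "y = 1"
proof -
  obtain i where "y = x ^ i" using assms(1) by (auto simp: powers_def)
  then have "y ^ m = 1" using assms(2) by (metis mult.commute power_mult power_one)
  then show ?thesis using power_coprime_eq_1 assms(3,4) by blast
qed

lemma conj_by_prod: "conj_by g (x * y) = conj_by g x * conj_by g y"
  by (simp add: mult.assoc)

lemma inverse_eq_square: "x ^ 3 = 1 \<Longrightarrow> inverse x = (x::'a::group_mult) ^ 2"
proof -
  assume "x ^ 3 = 1"
  then have "x * x ^ 2 = 1" by (simp flip: power_Suc)
  then show ?thesis by (simp only: mult_eq_one_iff)
qed

lemma A6_t_conj: "conj_by A6_t A6_a = A6_b" "conj_by A6_t A6_b = A6_a ^ 2"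
    "conj_by (A6_t ^ 2) A6_a = A6_a ^ 2" "conj_by (A6_t ^ 2) A6_b = A6_b ^ 2"
proof -
  show 1: "conj_by A6_t A6_a = A6_b" "conj_by A6_t A6_b = A6_a ^ 2" using A6_relations(8,9) conj_byI by blast+
  show "conj_by (A6_t ^ 2) A6_a = A6_a ^ 2" unfolding power2_eq_square[of A6_t] conj_by_mult 1 ..
  show "conj_by (A6_t ^ 2) A6_b = A6_b ^ 2"
    unfolding power2_eq_square[of A6_t] conj_by_mult 1 conj_by_power[symmetric] ..
qed

text \<open>In order 6 there would be 1 or 2 Sylow 3-subgroups, and 2 is not 1 modulo 3, so
  \<open>R\<close> is normal. An involution cannot commute with \<open>r\<close> by
  \<open>good_commute\<close>, hence inverts it, as \<open>A6_t ^ 2\<close> inverts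
  \<open>A6_a\<close>.\<close>

lemma embeds_3_6:
  assumes "good H" and c: "card H = 3 \<or> card H = 6"
  shows "embeds_A6 H"
proof -
  note H = good_sgp[OF assms(1)]
  have p: "prime (3::nat)" by simp
  have d: "3 dvd card H" "\<not> 9 dvd card H" using c by auto
  obtain R where R: "R \<in> sylows 3 H" using sylows_nonempty[OF H p] by blast
  have R': "sgp R" "R \<subseteq> H" "card R = 3" using sylows_card[OF R, of 1] d by simp_all
  have "R \<noteq> {1}" using R'(3) by auto
  then obtain r where r: "r \<in> R" "r \<noteq> 1" using sgpD(2)[OF R'(1)] by blast
  note S = sylow_3_prime[OF assms(1) d R r]
  have rH: "r \<in> H" using r R' by blast
  note o = prime_powers_ne_1[OF S(4) r(2) p] prime_powers_ne_1[OF A6_relations(1) A6_nontrivial(1) p]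
  from c show ?thesis
  proof
    assume "card H = 3"
    then show ?thesis using cyclic_A6[OF H rH A6_elements(1) _ S(4) A6_relations(1) o] by auto
  next
    assume c6: "card H = 6"
    have n: "card (sylows 3 H) * card (nrm H R) = 6" "card (sylows 3 H) mod 3 = 1"
      using card_sylows[OF H p R] c6 by simp_all
    have "card (nrm H R) = 6"
    proof (rule ccontr)
      assume "card (nrm H R) \<noteq> 6"
      then have "card (sylows 3 H) * 3 = 2 * 3" using n(1) S(8) by simp
      then have "card (sylows 3 H) = 2" by simp
      then show False using n(2) by simp
    qed
    then have N: "nrm H R = H" using sgp_eq_if_card_eq[OF H nrm_subset] c6 by simp
    have "2 dvd card H" using c6 by simp
    then obtain z where z: "z \<in> H" "z \<noteq> 1" "z ^ 2 = 1" using exists_prime_order[OF H two_is_prime_nat] by blast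
    have "z ^ 4 = (z ^ 2) ^ 2" by (simp flip: power_mult)
    then have z4: "z ^ 4 = 1" using z by simp
    have "z * r \<noteq> r * z" using good_commute[OF assms(1) z(1) rH _ z(2) r(2) z4 S(4)] by auto
    then have "conj_by z r \<noteq> r" by (simp only: conj_by_eq_self_iff) simp
    then have zr: "conj_by z r = r ^ 2" using S(7)[of z] N z(1) inverse_eq_square[OF S(4)] by auto
    have t2: "(A6_t ^ 2) ^ 2 = 1" using A6_relations(3) by (simp flip: power_mult)
    have "coprime 3 (2::nat)" by simp
    then have "z \<notin> powers r" "A6_t ^ 2 \<notin> powers A6_a"
      using powers_coprime[OF _ S(4) z(3)] powers_coprime[OF _ A6_relations(1) t2] z(2) A6_nontrivial(4) by blast+
    moreover have "A6_t ^ 2 \<in> A6_bij" by (simp add: A6_elements_mult)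
    ultimately show ?thesis
      using metacyclic_A6[OF H rH z(1) A6_elements(1) _ _ S(4) A6_relations(1) o _ z(3) t2 _ _ zr A6_t_conj(3)] c6
      by (auto simp: less_2_cases_iff)
  qed
qed

text \<open>The unique Sylow 5-subgroup is normal; an involution cannot centralize it and so inverts
  it, as \<open>A6_w\<close> inverts \<open>A6_f\<close>.\<close>

lemma embeds_5_10:
  assumes "good H" and c: "card H \<in> {5, 10}" "card (sylows 5 H) = 1"
  shows "embeds_A6 H"
proof -
  note H = good_sgp[OF assms(1)]
  have p: "prime (5::nat)" by simp
  have "5 dvd card H" using c(1) by auto
  then obtain f where f: "f \<in> H" "f \<noteq> 1" "f ^ 5 = 1" using exists_prime_order[OF H p] by blast
  note S = sylow_5_setup[OF assms(1) f(1,3,2)]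
  note o = prime_powers_ne_1[OF f(3,2) p] prime_powers_ne_1[OF A6_relations(4) A6_nontrivial(2) p]
  have N: "nrm H (powers f) = H" using sgp_eq_if_card_eq[OF H nrm_subset] S(4) c(2) by simp
  from c(1) have "card H = 5 \<or> card H = 10" by simp
  then show ?thesis
  proof
    assume "card H = 5"
    then show ?thesis using cyclic_A6[OF H f(1) A6_elements(4) _ f(3) A6_relations(4) o] by auto
  next
    assume c10: "card H = 10"
    then have "2 dvd card H" by simp
    then obtain z where z: "z \<in> H" "z \<noteq> 1" "z ^ 2 = 1" using exists_prime_order[OF H two_is_prime_nat] by blast
    have "z ^ 4 = (z ^ 2) ^ 2" by (simp flip: power_mult)
    then have z4: "z ^ 4 = 1" using z by simp
    have "z * f \<noteq> f * z" using good_commute[OF assms(1) z(1) f(1) _ z(2) f(2) z4 f(3)] by auto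
    then have n: "conj_by z f \<noteq> f" by (simp only: conj_by_eq_self_iff) simp
    have "f * f ^ 4 = 1" using f(3) by (simp flip: power_Suc)
    then have "inverse f = f ^ 4" by (simp only: mult_eq_one_iff)
    then have zf: "conj_by z f = f ^ 4" using normalizer_order_5[OF assms(1) f(1,3,2), of z] N z(1) n by auto
    have wf: "conj_by A6_w A6_f = A6_f ^ 4" using A6_relations(11) by (rule conj_byI)
    have "coprime 5 (2::nat)" by simp
    then have "z \<notin> powers f" "A6_w \<notin> powers A6_f"
      using powers_coprime[OF _ f(3) z(3)] powers_coprime[OF _ A6_relations(4,5)] z(2) A6_nontrivial(12) by blast+
    then show ?thesis
      using metacyclic_A6[OF H f(1) z(1) A6_elements(4,5) _ f(3) A6_relations(4) o _ z(3) A6_relations(5) _ _ zf wf] c10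
      by (auto simp: less_2_cases_iff)
  qed
qed

text \<open>Any \<open>a \<noteq> 1\<close> in \<open>Q\<close> and \<open>b = conj_by t a\<close>
  will do. The involution \<open>t ^ 2\<close> inverts \<open>Q\<close>, which gives
  \<open>conj_by t b = a ^ 2\<close>. If \<open>b\<close> were a power of \<open>a\<close>,
  conjugating twice by \<open>t\<close> would fix \<open>a\<close>. So \<open>t\<close> acts in the
  same way in every such group.\<close>

lemma order_9_generators:
  assumes "good H" and Q: "sgp Q" "Q \<subseteq> H" "card Q = 9" and n: "conj_set t Q = Q"
    and t: "t \<in> H" "t ^ 4 = 1" "t ^ 2 \<noteq> 1"
  obtains a b where "a \<in> Q" "b \<in> Q" "a \<noteq> 1" "b \<notin> powers a" "conj_by t a = b" "conj_by t b = a ^ 2" "Q \<subseteq> {a ^ i * b ^ j | i j. True}"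
proof -
  note H = good_sgp[OF assms(1)]
  have p: "prime (3::nat)" by simp
  have Q3: "x ^ 3 = 1" if "x \<in> Q" for x
    using p_subgroup_order[OF assms(1) Q(1,2), of 3 2 x 3] Q(3) that by simp
  have "Q \<noteq> {1}" using Q(3) by auto
  then obtain a where a: "a \<in> Q" "a \<noteq> 1" using sgpD(2)[OF Q(1)] by blast
  define b where "b = conj_by t a"
  have bQ: "b \<in> Q" using conj_by_mem_conj_set[of t a Q] n a unfolding b_def by metis
  have t2: "(t ^ 2) ^ 2 = 1" "t ^ 2 \<in> H" using t(2) sgp_power[OF H t(1)] by (simp_all flip: power_mult)
  have "conj_set (t ^ 2) Q = Q" unfolding power2_eq_square conj_set_mult n ..
  then have "conj_by (t ^ 2) a = inverse a"
    using involution_inverts_9[OF assms(1) Q t2(2) _ t2(1) t(3) a(1)] by blast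
  then have tb: "conj_by t b = a ^ 2"
    unfolding b_def conj_by_mult[symmetric] power2_eq_square[symmetric] inverse_eq_square[OF Q3[OF a(1)]] .
  have a2: "a ^ 2 \<noteq> a" using a(2) by (simp add: power2_eq_square)
  have nb: "b \<notin> powers a"
  proof
    assume "b \<in> powers a"
    then consider "b = 1" | "b = a" | "b = a ^ 2" using powers_3[OF Q3[OF a(1)]] by auto
    then show False
    proof cases
      case 1
      then have "conj_by t a = conj_by t 1" by (simp add: b_def[symmetric])
      then show False using a(2) by (simp only: conj_by_eq_iff)
    next
      case 2
      then show False using tb a2 b_def by simp
    next
      case 3
      have "conj_by t (a ^ 2) = b ^ 2" unfolding b_def conj_by_power ..
      also have "\<dots> = a ^ 4" unfolding 3 by (simp flip: power_mult)
      also have "\<dots> = a" using power_mod_order[OF Q3[OF a(1)], of 4] by simp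
      finally show False using tb a2 3 by simp
    qed
  qed
  \<comment> \<open>The subgroup generated by \<open>a\<close> and \<open>b\<close>: its order
    divides 9 and exceeds 3.\<close>
  let ?M = "{a ^ i * b ^ j | i j. True}"
  have com: "b ^ i * a ^ j = a ^ j * b ^ i" for i j using commute_power[OF abelian_9[OF Q(1,3) bQ a(1)]] .
  have MQ: "?M \<subseteq> Q" using a(1) bQ sgpD(3)[OF Q(1)] sgp_power[OF Q(1)] by auto
  have M: "sgp ?M"
  proof (rule sgp_finite_closed)
    show "finite ?M" using MQ sgpD(1)[OF Q(1)] by (rule finite_subset)
    fix x y assume "x \<in> ?M" "y \<in> ?M"
    then obtain i j k l where "x = a ^ i * b ^ j" "y = a ^ k * b ^ l" by blast
    then have "x * y = a ^ i * (b ^ j * a ^ k) * b ^ l" by (simp add: mult.assoc)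
    also have "\<dots> = a ^ (i + k) * b ^ (j + l)" unfolding com by (simp add: power_add mult.assoc)
    finally show "x * y \<in> ?M" by blast
  qed blast
  have sub: "powers a \<subseteq> ?M"
  proof
    fix x assume "x \<in> powers a"
    then obtain i where "x = a ^ i * b ^ 0" by (auto simp: powers_def)
    then show "x \<in> ?M" by blast
  qed
  have "b = a ^ 0 * b ^ 1" by simp
  then have "b \<in> ?M" by blast
  then have "powers a \<subset> ?M" using sub nb by blast
  then have "card (powers a) < card ?M" using psubset_card_mono sgpD(1)[OF M] by blast
  then have gt: "3 < card ?M" using card_powers_prime[OF p Q3[OF a(1)] a(2)] by simp
  have "card ?M dvd 3 ^ 2" using lagrange_sgp[OF Q(1) M MQ] Q(3) by simp
  then obtain i where i: "i \<le> 2" "card ?M = 3 ^ i" unfolding divides_primepow_nat[OF p] by blast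
  have "i = 2"
  proof (rule ccontr)
    assume "i \<noteq> 2"
    then have "(3::nat) ^ i \<le> 3 ^ 1" using i(1) by (intro power_increasing) auto
    then show False using gt i(2) by simp
  qed
  then have "?M = Q" using sgp_eq_if_card_eq[OF Q(1) MQ] i Q(3) by simp
  then show thesis using that[OF a(1) bQ a(2) nb b_def[symmetric] tb] by simp
qed

text \<open>\<open>Q\<close> is normal and maps to the group generated by \<open>A6_a\<close> and
  \<open>A6_b\<close>. In order 18 any basis of \<open>Q\<close> works, as the involution inverts
  everything; in order 36 the basis is the one adapted to \<open>t\<close>, so that
  \<open>A6_t\<close> matches \<open>t\<close>.\<close>

lemma embeds_9:
  assumes "good H" "9 dvd card H" "\<not> 5 dvd card H"
  shows "embeds_A6 H"
proof -
  note H = good_sgp[OF assms(1)]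
  have p: "prime (3::nat)" by simp
  obtain Q where Q0: "Q \<in> sylows 3 H" using sylows_nonempty[OF H p] by blast
  have Q: "sgp Q" "Q \<subseteq> H" "card Q = 9"
    using sylows_card[OF Q0, of 2] assms(2) good_card_dvd(3)[OF assms(1)] by simp_all
  have nQ: "conj_set g Q = Q" if "g \<in> H" for g
    using sylow_9_normal[OF assms Q0] sylows_conj[OF H Q0 that] by simp
  have Q3: "x ^ 3 = 1" if "x \<in> Q" for x
    using p_subgroup_order[OF assms(1) Q(1,2), of 3 2 x 3] Q(3) that by simp
  have com: "b ^ i * a ^ j = a ^ j * b ^ i" if "a \<in> Q" "b \<in> Q" for a b i j
    using commute_power[OF abelian_9[OF Q(1,3) that(2,1)]] .
  have base: "\<exists>\<psi>. is_emb \<psi> Q \<and> \<psi> ` Q \<subseteq> A6_bij \<and> (\<forall>i j. \<psi> (a ^ i * b ^ j) = A6_a ^ i * A6_b ^ j) \<and>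
      Q = {a ^ i * b ^ j | i j. True} \<and> (card H = 9 \<longrightarrow> embeds_A6 H)"
    if ab: "a \<in> Q" "a \<noteq> 1" "b \<in> Q" "b \<notin> powers a" for a b
  proof -
    have aH: "a \<in> H" "b \<in> H" using ab Q by auto
    note a3 = Q3[OF ab(1)] and b3 = Q3[OF ab(3)]
    note o = prime_powers_ne_1[OF a3 ab(2) p] prime_powers_ne_1[OF A6_relations(1) A6_nontrivial(1) p]
    \<comment> \<open>The square of an element with cube 1 is its inverse, so it lies in the same
      subgroups.\<close>
    have sq: "y ^ 2 \<notin> P" if "sgp P" "y \<notin> P" "y ^ 3 = 1" for P and y :: "'g::group_mult"
      using that sgpD(4)[OF that(1), of "y ^ 2"] inverse_eq_square[OF that(3)] by (metis inverse_inverse_mult)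
    have B: "A6_b \<notin> powers A6_a" using powers_3[OF A6_relations(1)] A6_nontrivial by simp
    have r: "conj_by b a = a ^ 1" "conj_by A6_b A6_a = A6_a ^ 1"
      using abelian_9[OF Q(1,3) ab(1,3)] A6_relations(10) by (simp_all add: conj_byI)
    have pw: "j = 1 \<or> j = 2" if "0 < j" "j < 3" for j :: nat using that by linarith
    have b1: "b ^ j \<notin> powers a" if "0 < j" "j < 3" for j
      using pw[OF that] sq[OF sgp_powers[OF H aH(1)] ab(4) b3] ab(4) by auto
    have b2: "A6_b ^ j \<notin> powers A6_a" if "0 < j" "j < 3" for j
      using pw[OF that] sq[OF sgp_powers[OF sgp_A6_bij A6_elements(1)] B A6_relations(2)] B by auto
    obtain M \<psi> where M: "M = (\<lambda>(z, j). z * b ^ j) ` (powers a \<times> {..<3})" "is_emb \<psi> M" "\<psi> ` M \<subseteq> A6_bij"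
      "\<And>i j. \<psi> (a ^ i * b ^ j) = A6_a ^ i * A6_b ^ j" "card M = 3 * 3" "3 * 3 = card H \<Longrightarrow> embeds_A6 H"
      by (rule metacyclic_A6[OF H aH A6_elements(1,2) zero_less_numeral a3 A6_relations(1) o zero_less_numeral b3
          A6_relations(2) b1 b2 r]) (assumption | rule that)+
    have MQ: "x \<in> Q" if "x = a ^ i * b ^ j" for x i j using that ab sgpD(3)[OF Q(1)] sgp_power[OF Q(1)] by blast
    have "M \<subseteq> Q" using MQ by (auto simp: M(1) powers_def)
    then have "M = Q" using sgp_eq_if_card_eq[OF Q(1)] M(5) Q(3) by simp
    moreover have "M \<subseteq> {a ^ i * b ^ j | i j. True}" by (auto simp: M(1) powers_def)
    ultimately show ?thesis using M MQ by (intro exI[of _ \<psi>]) auto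
  qed
  \<comment> \<open>Elements of \<open>Q\<close> have cube 1 and powers of \<open>t\<close> have
    fourth power 1, so they meet trivially; the same holds for the image and
    \<open>t'\<close>.\<close>
  have ext: "embeds_A6 H"
    if \<psi>: "is_emb \<psi> Q" "\<psi> ` Q \<subseteq> A6_bij" and t: "t \<in> H" "t' \<in> A6_bij" "9 * n = card H" "0 < n" "t ^ n = 1" "t' ^ n = 1"
      "n dvd 4" "\<And>j. 0 < j \<Longrightarrow> j < n \<Longrightarrow> t ^ j \<noteq> 1" "\<And>j. 0 < j \<Longrightarrow> j < n \<Longrightarrow> t' ^ j \<noteq> 1"
      "\<And>x. x \<in> Q \<Longrightarrow> \<psi> (conj_by t x) = conj_by t' (\<psi> x)" for \<psi> t t' n
  proof -
    have 4: "(t ^ j) ^ 4 = 1" "(t' ^ j) ^ 4 = 1" for j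
    proof -
      obtain k where "4 = n * k" using t(7) by blast
      have "t ^ 4 = 1" "t' ^ 4 = 1" unfolding \<open>4 = n * k\<close> power_mult t(5,6) by simp_all
      then show "(t ^ j) ^ 4 = 1" "(t' ^ j) ^ 4 = 1" by (metis mult.commute power_mult power_one)+
    qed
    have a1: "t ^ j \<notin> Q" if "0 < j" "j < n" for j using power_3_4[OF Q3 4(1)] t(8) that by blast
    have a2: "t' ^ j \<notin> \<psi> ` Q" if j: "0 < j" "j < n" for j
    proof
      assume "t' ^ j \<in> \<psi> ` Q"
      then obtain x where x: "x \<in> Q" "t' ^ j = \<psi> x" by blast
      then have "(t' ^ j) ^ 3 = 1" using is_emb_power[OF \<psi>(1) Q(1) x(1), of 3] Q3 is_emb_one[OF \<psi>(1) Q(1)] by simp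
      then show False using power_3_4 4(2) t(9)[OF j] by blast
    qed
    have a3: "conj_by t x \<in> Q" if "x \<in> Q" for x
      using conj_by_mem_conj_set[of t x Q] nQ[OF t(1)] that by metis
    have c: "card Q * n = card H" using Q(3) t(3) by simp
    show ?thesis
      by (rule extend_A6[OF H Q(2) t(1) \<psi>(2) t(2) Q(1) \<psi>(1) t(4-6)]) (assumption | rule a1 a2 a3 t(10) | simp add: c)+
  qed
  have "Q \<noteq> {1}" using Q(3) by auto
  then obtain a where a: "a \<in> Q" "a \<noteq> 1" using sgpD(2)[OF Q(1)] by blast
  have "card (powers a) = 3" using card_powers_prime[OF p Q3[OF a(1)] a(2)] .
  moreover have "finite (powers a)" using sgpD(1)[OF sgp_powers[OF Q(1) a(1)]] .
  ultimately have "\<not> Q \<subseteq> powers a" using card_mono[of "powers a" Q] Q(3) by auto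
  then obtain c where c: "c \<in> Q" "c \<notin> powers a" by blast
  have "card H = 9 \<or> card H = 18 \<and> (\<exists>z\<in>H. z ^ 2 = 1 \<and> z \<noteq> 1) \<or> card H = 36 \<and> (\<exists>t\<in>H. t ^ 4 = 1 \<and> t ^ 2 \<noteq> 1)"
    by (rule structure_9[OF assms(1) Q _ assms(3)]) (rule nQ)
  then show ?thesis
  proof (elim disjE conjE bexE)
    assume "card H = 9"
    then show ?thesis using base[OF a c] by blast
  next
    fix z assume h: "card H = 18" "z \<in> H" "z ^ 2 = 1" "z \<noteq> 1"
    obtain \<psi> where \<psi>: "is_emb \<psi> Q" "\<psi> ` Q \<subseteq> A6_bij" "\<And>i j. \<psi> (a ^ i * c ^ j) = A6_a ^ i * A6_b ^ j"
      "Q = {a ^ i * c ^ j | i j. True}" using base[OF a c] by blast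
    have iv: "conj_by z x = x ^ 2" if "x \<in> Q" for x
      using involution_inverts_9[OF assms(1) Q h(2) nQ[OF h(2)] h(3,4) that] inverse_eq_square[OF Q3[OF that]] by simp
    have cc: "conj_by z (a ^ i * c ^ j) = a ^ (2 * i) * c ^ (2 * j)"
      "conj_by (A6_t ^ 2) (A6_a ^ i * A6_b ^ j) = A6_a ^ (2 * i) * A6_b ^ (2 * j)" for i j
      unfolding conj_by_prod conj_by_power[symmetric] iv[OF a(1)] iv[OF c(1)] A6_t_conj by (simp_all add: power_mult)
    have eq: "\<psi> (conj_by z x) = conj_by (A6_t ^ 2) (\<psi> x)" if x: "x \<in> Q" for x
    proof -
      obtain i j where "x = a ^ i * c ^ j" using x \<psi>(4) by blast
      then show ?thesis by (simp only: cc \<psi>(3))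
    qed
    have t2: "(A6_t ^ 2) ^ 2 = 1" using A6_relations(3) by (simp flip: power_mult)
    have tB: "A6_t ^ 2 \<in> A6_bij" by (simp add: A6_elements_mult)
    show ?thesis
      using ext[OF \<psi>(1,2) h(2) tB, of 2] h t2 A6_nontrivial(4) eq by (auto simp: less_2_cases_iff)
  next
    fix t assume h: "card H = 36" "t \<in> H" "t ^ 4 = 1" "t ^ 2 \<noteq> 1"
    obtain a b where ab: "a \<in> Q" "b \<in> Q" "a \<noteq> 1" "b \<notin> powers a" "conj_by t a = b" "conj_by t b = a ^ 2"
      using order_9_generators[OF assms(1) Q nQ[OF h(2)] h(2-4)] by metis
    obtain \<psi> where \<psi>: "is_emb \<psi> Q" "\<psi> ` Q \<subseteq> A6_bij" "\<And>i j. \<psi> (a ^ i * b ^ j) = A6_a ^ i * A6_b ^ j"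
      "Q = {a ^ i * b ^ j | i j. True}" using base[OF ab(1,3,2,4)] by blast
    have cc: "conj_by t (a ^ i * b ^ j) = a ^ (2 * j) * b ^ i"
      "conj_by A6_t (A6_a ^ i * A6_b ^ j) = A6_a ^ (2 * j) * A6_b ^ i" for i j
      unfolding conj_by_prod conj_by_power[symmetric] ab(5,6) A6_t_conj power_mult[symmetric]
      using com[OF ab(1,2)] commute_power[OF A6_relations(10)] by simp_all
    have eq: "\<psi> (conj_by t x) = conj_by A6_t (\<psi> x)" if x: "x \<in> Q" for x
    proof -
      obtain i j where "x = a ^ i * b ^ j" using x \<psi>(4) by blast
      then show ?thesis by (simp only: cc \<psi>(3))
    qed
    show ?thesis
      using ext[OF \<psi>(1,2) h(2) A6_elements(3), of 4] h A6_relations(3) eq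
        order_4_powers[OF h(3,4)] order_4_powers[OF A6_relations(3) A6_nontrivial(4)] by simp
  qed
qed

text \<open>The transposition of 5 and 6 corrects the sign.\<close>
lemma embeds_degree_4:
  fixes \<phi> :: "'a::group_mult \<Rightarrow> nat bij"
  assumes \<phi>: "is_emb \<phi> H" and H: "sgp H" and p: "\<And>g. g \<in> H \<Longrightarrow> apply_bij (\<phi> g) permutes {1..4}"
  shows "embeds_A6 H"
proof -
  define s :: "nat bij" where "s = Bij (transpose 5 6)"
  have as: "apply_bij s = transpose 5 6" by (simp add: s_def apply_Bij)
  have ss: "s * s = 1" by (rule bij_eqI) (simp add: as)
  have com: "\<phi> g * s = s * \<phi> g" if "g \<in> H" for g
  proof (rule bij_eqI)
    fix k
    have in4: "apply_bij (\<phi> g) k \<in> {1..4} \<longleftrightarrow> k \<in> {1..4}" using p[OF that] by (rule permutes_in_image)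
    have fix4: "apply_bij (\<phi> g) j = j" if "j \<notin> {1..4}" for j using p[OF \<open>g \<in> H\<close>] that by (rule permutes_not_in)
    show "apply_bij (\<phi> g * s) k = apply_bij (s * \<phi> g) k"
      using in4 fix4[of 5] fix4[of 6] fix4[of k] by (cases "k \<in> {1..4}") (auto simp: as transpose_def)
  qed
  have hom: "\<phi> (g * h) = \<phi> g * \<phi> h" if "g \<in> H" "h \<in> H" for g h using \<phi> that by (simp add: is_emb_def)
  define ev where "ev = (\<lambda>g. evenperm (apply_bij (\<phi> g)))"
  have perm: "permutation (apply_bij (\<phi> g))" if "g \<in> H" for g using p[OF that] by (auto simp: permutation_permutes)
  have ev: "ev (g * h) \<longleftrightarrow> ev g = ev h" if "g \<in> H" "h \<in> H" for g h
    using perm that by (simp add: ev_def hom apply_bij_mult evenperm_comp)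
  define \<psi> where "\<psi> = (\<lambda>g. if ev g then \<phi> g else s * \<phi> g)"
  have m4: "s * (\<phi> g * (s * x)) = \<phi> g * x" if "g \<in> H" for g x
    by (metis com[OF that] mult.assoc ss mult_1_left)
  have "\<psi> (g * h) = \<psi> g * \<psi> h" if "g \<in> H" "h \<in> H" for g h
    using ev[OF that] hom[OF that] com[OF that(1)] m4[OF that(1)]
    by (auto simp: \<psi>_def mult.assoc) (simp flip: mult.assoc)
  moreover have "inj_on \<psi> H"
  proof
    fix g h assume gh: "g \<in> H" "h \<in> H" "\<psi> g = \<psi> h"
    \<comment> \<open>The image of 5 is 5 if \<open>\<phi> g\<close> is even and 6 if it is odd, so
      \<open>\<psi> g\<close> determines the parity and then \<open>\<phi> g\<close> itself.\<close>
    have f5: "apply_bij (\<phi> g) 5 = 5" if "g \<in> H" for g using permutes_not_in[OF p[OF that]] by simp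
    have "apply_bij (\<psi> g) 5 = (if ev g then 5 else 6)" "apply_bij (\<psi> h) 5 = (if ev h then 5 else 6)"
      using f5 gh(1,2) by (simp_all add: \<psi>_def as)
    then have "(if ev g then 5 else 6::nat) = (if ev h then 5 else 6)" using gh(3) by simp
    then have "ev g = ev h" by (auto split: if_splits)
    then have "\<phi> g = \<phi> h" using gh(3) by (auto simp: \<psi>_def split: if_splits)
    then show "g = h" using \<phi> gh by (auto simp: is_emb_def inj_on_def)
  qed
  ultimately have "is_emb \<psi> H" by (simp add: is_emb_def)
  moreover have "\<psi> g \<in> A6_bij" if g: "g \<in> H" for g
  proof -
    have p6: "apply_bij (\<phi> g) permutes {1..6}" using p[OF g] by (rule permutes_subset) auto
    show ?thesis
    proof (cases "ev g")
      case True then show ?thesis using p6 by (simp add: \<psi>_def A6_bij_def ev_def)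
    next
      case False
      have "transpose 5 6 \<circ> apply_bij (\<phi> g) permutes {1..6}"
        by (intro permutes_compose p6 permutes_swap_id) auto
      moreover have "evenperm (transpose 5 6 \<circ> apply_bij (\<phi> g))"
        using False perm[OF g] by (simp add: evenperm_comp permutation_swap_id evenperm_swap ev_def)
      ultimately show ?thesis using False by (simp add: \<psi>_def A6_bij_def apply_bij_mult as)
    qed
  qed
  ultimately show ?thesis unfolding embeds_A6_def by blast
qed

text \<open>A Sylow 3-subgroup is the centralizer of its generator, and its normalizer only fixes or
  inverts that generator; this is what \<open>sylow_action_faithful\<close> asks for.\<close>

lemma embeds_12_24:
  assumes "good H" "card H \<in> {12, 24}" "card (sylows 3 H) = 4"
  shows "embeds_A6 H"
proof -
  note H = good_sgp[OF assms(1)]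
  have p: "prime (3::nat)" by simp
  have d: "3 dvd card H" "\<not> 9 dvd card H" using assms(2) by auto
  obtain R where R: "R \<in> sylows 3 H" using sylows_nonempty[OF H p] by blast
  have R': "sgp R" "R \<subseteq> H" "card R = 3" using sylows_card[OF R, of 1] d by simp_all
  have "R \<noteq> {1}" using R'(3) by auto
  then obtain r where r: "r \<in> R" "r \<noteq> 1" using sgpD(2)[OF R'(1)] by blast
  note S = sylow_3_prime[OF assms(1) d R r]
  have n: "sylows 3 H \<noteq> {R}" using assms(3) by auto
  have c: "cent H r \<subseteq> R" using S(6) by simp
  have odd: "odd (3::nat)" by simp
  have faithful: "g = 1" if "g \<in> H" "\<And>Q. Q \<in> sylows 3 H \<Longrightarrow> conj_set g Q = Q" for g
    using sylow_action_faithful[OF H p odd R R'(3) r c S(7) n that(1)] that(2) by blast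
  interpret action H "sylows 3 H" conj_set using conj_action[OF H subset_refl H] .
  obtain e where e: "bij_betw e (sylows 3 H) {1..4::nat}"
    using finite_same_card_bij[OF finite_sylows[OF H, of 3], of "{1..4::nat}"] assms(3) by auto
  obtain \<phi> :: "'a \<Rightarrow> nat bij" where \<phi>: "is_emb \<phi> H" "\<And>g. g \<in> H \<Longrightarrow> apply_bij (\<phi> g) permutes {1..4}"
    "\<And>g Q. g \<in> H \<Longrightarrow> Q \<in> sylows 3 H \<Longrightarrow> apply_bij (\<phi> g) (e Q) = e (conj_set g Q)"
    by (rule permutation_embedding[OF _ e]) (assumption | rule faithful that)+
  show ?thesis by (rule embeds_degree_4[OF \<phi>(1) H \<phi>(2)])
qed

text \<open>The six Sylow 5-subgroups give degree 6 at once; the remaining point is that all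
  permutations are even.\<close>

lemma embeds_60:
  assumes "good H" "card H = 60" "card (sylows 5 H) = 6"
  shows "embeds_A6 H"
proof -
  note H = good_sgp[OF assms(1)]
  have p: "prime (5::nat)" by simp
  have "5 dvd card H" using assms(2) by simp
  then obtain f where f: "f \<in> H" "f \<noteq> 1" "f ^ 5 = 1" using exists_prime_order[OF H p] by blast
  note S = sylow_5_setup[OF assms(1) f(1,3,2)]
  have n: "sylows 5 H \<noteq> {powers f}" using assms(3) by auto
  have c: "cent H f \<subseteq> powers f" using cent_order_5[OF assms(1) f] by simp
  have odd: "odd (5::nat)" by simp
  have faithful: "g = 1" if "g \<in> H" "\<And>Q. Q \<in> sylows 5 H \<Longrightarrow> conj_set g Q = Q" for g
    using sylow_action_faithful[OF H p odd S(1,2) powers_self f(2) c normalizer_order_5[OF assms(1) f(1,3,2)] n that(1)]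
      that(2) by blast
  interpret action H "sylows 5 H" conj_set using conj_action[OF H subset_refl H] .
  obtain e where e: "bij_betw e (sylows 5 H) {1..6::nat}"
    using finite_same_card_bij[OF finite_sylows[OF H, of 5], of "{1..6::nat}"] assms(3) by auto
  obtain \<phi> :: "'a \<Rightarrow> nat bij" where \<phi>: "is_emb \<phi> H" "\<And>g. g \<in> H \<Longrightarrow> apply_bij (\<phi> g) permutes {1..6}"
    "\<And>g Q. g \<in> H \<Longrightarrow> Q \<in> sylows 5 H \<Longrightarrow> apply_bij (\<phi> g) (e Q) = e (conj_set g Q)"
    by (rule permutation_embedding[OF _ e]) (assumption | rule faithful that)+
  define K where "K = {g\<in>H. evenperm (apply_bij (\<phi> g))}"
  have ev: "evenperm (apply_bij (\<phi> (g * h))) \<longleftrightarrow> evenperm (apply_bij (\<phi> g)) = evenperm (apply_bij (\<phi> h))"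
    if "g \<in> H" "h \<in> H" for g h
    using \<phi>(1) \<phi>(2)[OF that(1)] \<phi>(2)[OF that(2)] that
    by (auto simp: is_emb_def apply_bij_mult evenperm_comp permutes_imp_permutation_nat)
  have K: "sgp K"
  proof (rule sgp_finite_closed)
    have "1 \<in> K" using is_emb_one[OF \<phi>(1) H] sgpD(2)[OF H] by (simp add: K_def apply_bij_one evenperm_id)
    then show "K \<noteq> {}" by blast
  qed (use sgpD[OF H] ev in \<open>auto simp: K_def\<close>)
  \<comment> \<open>Otherwise the even elements form a subgroup of the impossible order 30.\<close>
  have "K = H"
  proof (rule ccontr)
    assume "K \<noteq> H"
    then obtain h where h: "h \<in> H" "h \<notin> K" by (auto simp: K_def)
    have "bij_betw ((*) h) K (H - K)"
    proof (rule bij_betw_byWitness[where f' = "(*) (inverse h)"])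
      have "inverse h \<in> H - K" using h sgpD(4)[OF H] sgp_inverse_iff[OF K] by blast
      then show "(*) (inverse h) ` (H - K) \<subseteq> K" using ev sgpD(3)[OF H] by (auto simp: K_def)
      show "(*) h ` K \<subseteq> H - K" using h ev sgpD(3)[OF H] by (auto simp: K_def)
    qed auto
    then have "card K = card (H - K)" by (rule bij_betw_same_card)
    moreover have "card (H - K) = card H - card K" using sgpD(1)[OF K] by (intro card_Diff_subset) (auto simp: K_def)
    ultimately have K30: "card K = 30" using assms(2) by simp
    have "good K" using good_subgroup[OF assms(1) K] by (auto simp: K_def)
    then show False using card_cases_5[of K] K30 by simp
  qed
  then have "\<phi> ` H \<subseteq> A6_bij" using \<phi>(2) by (auto simp: A6_bij_def K_def)
  then show ?thesis using \<phi>(1) unfolding embeds_A6_def by blast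
qed

lemma embeds_if_not_360:
  assumes "good H" "card H \<noteq> 360"
  shows "embeds_A6 H"
proof -
  note H = good_sgp[OF assms(1)] and d = good_card_dvd[OF assms(1)]
  consider "5 dvd card H" | "\<not> 5 dvd card H" "9 dvd card H" | "\<not> 5 dvd card H" "\<not> 9 dvd card H" "3 dvd card H"
    | "\<not> 5 dvd card H" "\<not> 3 dvd card H" by blast
  then show ?thesis
  proof cases
    case 1
    then show ?thesis using card_cases_5[OF assms(1)] assms embeds_5_10 embeds_60 by blast
  next
    case 2
    then show ?thesis using embeds_9[OF assms(1)] by blast
  next
    case 3
    then show ?thesis using card_cases_3[OF assms(1)] embeds_3_6 embeds_12_24 assms(1) by blast
  next
    case 4
    then have "coprime 5 (card H)" "coprime 3 (card H)" by (auto intro!: prime_imp_coprime)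
    then have "coprime (card H) (3 * 3 * 5)" by (simp only: coprime_mult_right_iff coprime_commute simp_thms)
    moreover have "card H dvd 8 * (3 * 3 * 5)" using d(1) by simp
    ultimately have "card H dvd 2 ^ 3" using coprime_dvd_mult_left_iff[of "card H" "3 * 3 * 5" 8] by simp
    then obtain i where i: "i \<le> 3" "card H = 2 ^ i" unfolding divides_primepow_nat[OF two_is_prime_nat] by blast
    then have "card H \<in> {1, 2, 4, 8}" by (auto simp: le_Suc_eq numeral_3_eq_3)
    then show ?thesis using embeds_2_group[OF assms(1)] p_subgroup_order[OF assms(1) H subset_refl i(2)] by simp
  qed
qed

subsection \<open>Groups of order 360\<close>


text \<open>The permutations of the projective line over \<open>F\<^sub>9 = F\<^sub>3(i)\<close> given by \<open>z + 1\<close>, \<open>z + i\<close>, \<open>i z\<close> and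
  \<open>- 1 / z\<close>; the number \<open>3 x + y\<close> with \<open>x, y < 3\<close> stands for \<open>x + y i\<close>, and 9 for infinity.\<close>
definition pt_a :: "nat \<Rightarrow> nat" where "pt_a n = (if n < 10 then [3,4,5,6,7,8,0,1,2,9] ! n else n)"
definition pt_b :: "nat \<Rightarrow> nat" where "pt_b n = (if n < 10 then [1,2,0,4,5,3,7,8,6,9] ! n else n)"
definition pt_t :: "nat \<Rightarrow> nat" where "pt_t n = (if n < 10 then [0,6,3,1,7,4,2,8,5,9] ! n else n)"
definition pt_s :: "nat \<Rightarrow> nat" where "pt_s n = (if n < 10 then [9,1,2,6,5,4,3,8,7,0] ! n else n)"

lemma less_10_cases: "n < 10 \<longleftrightarrow> n \<in> {0,1,2,3,4,5,6,7,8,9::nat}"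
  by auto

lemma pt_values:
  "pt_a 0 = 3" "pt_a 1 = 4" "pt_a 2 = 5" "pt_a 3 = 6" "pt_a 4 = 7" "pt_a 5 = 8" "pt_a 6 = 0" "pt_a 7 = 1" "pt_a 8 = 2" "pt_a 9 = 9"
  "pt_b 0 = 1" "pt_b 1 = 2" "pt_b 2 = 0" "pt_b 3 = 4" "pt_b 4 = 5" "pt_b 5 = 3" "pt_b 6 = 7" "pt_b 7 = 8" "pt_b 8 = 6" "pt_b 9 = 9"
  "pt_t 0 = 0" "pt_t 1 = 6" "pt_t 2 = 3" "pt_t 3 = 1" "pt_t 4 = 7" "pt_t 5 = 4" "pt_t 6 = 2" "pt_t 7 = 8" "pt_t 8 = 5" "pt_t 9 = 9"
  "pt_s 0 = 9" "pt_s 1 = 1" "pt_s 2 = 2" "pt_s 3 = 6" "pt_s 4 = 5" "pt_s 5 = 4" "pt_s 6 = 3" "pt_s 7 = 8" "pt_s 8 = 7" "pt_s 9 = 0"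
  "pt_a (Suc 0) = 4" "pt_b (Suc 0) = 2" "pt_t (Suc 0) = 6" "pt_s (Suc 0) = 1"
  by (simp_all add: pt_a_def pt_b_def pt_t_def pt_s_def)

text \<open>An involution swapping zero and infinity and inverting \<open>i z\<close> is determined up to few choices; all but
  \<open>- 1 / z\<close> give a product with \<open>z + 1\<close> whose order is not 3, 4 or 5.\<close>
lemma swap_determined:
  fixes u :: "nat \<Rightarrow> nat"
  assumes lt: "\<And>n. n < 10 \<Longrightarrow> u n < 10" and invol: "\<And>n. n < 10 \<Longrightarrow> u (u n) = n" and u0: "u 0 = 9"
    and tw: "\<And>n. n < 10 \<Longrightarrow> pt_t (u (pt_t n)) = u n" and u3: "u 3 = 6 \<or> u 3 = 4"
    and ord: "(\<forall>n<10. u (pt_a (u (pt_a (u (pt_a n))))) = n) \<or>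
      (\<forall>n<10. u (pt_a (u (pt_a (u (pt_a (u (pt_a n))))))) = n) \<or>
      (\<forall>n<10. u (pt_a (u (pt_a (u (pt_a (u (pt_a (u (pt_a n))))))))) = n)"
    and n: "n < 10"
  shows "u n = pt_s n"
proof -
  have t_inj: "m = l" if "pt_t m = pt_t l" "m < 10" "l < 10" for m l
  proof -
    have "\<forall>m\<in>set [0..<10]. \<forall>l\<in>set [0..<10]. pt_t m = pt_t l \<longrightarrow> m = l" by code_simp
    then show ?thesis using that by simp
  qed
  \<comment> \<open>\<open>tw\<close> says that \<open>u\<close> conjugates \<open>pt_t\<close> into
    its inverse, so one value of \<open>u\<close> determines its values along a whole cycle of
    \<open>pt_t\<close>.\<close>
  have step: "u (pt_t n) = l" if "u n = pt_t l" "n < 10" "l < 10" for n l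
  proof (rule t_inj)
    show "pt_t (u (pt_t n)) = pt_t l" using tw[OF that(2)] that(1) by simp
    have "pt_t n < 10" using that(2) by (auto simp: less_10_cases pt_values)
    then show "u (pt_t n) < 10" by (rule lt)
  qed (rule that)
  have u9: "u 9 = 0" using invol[of 0] u0 by simp
  show ?thesis
  proof (cases "u 3 = 6")
    case True
    have u1: "u 1 = 1" using step[of 3 1] True by (simp add: pt_values del: One_nat_def)
    have u6: "u 6 = 3" using step[of 1 3] u1 by (simp add: pt_values del: One_nat_def)
    have u2: "u 2 = 2" using step[of 6 2] u6 by (simp add: pt_values del: One_nat_def)
    note u = u0 u1 u2 True u6 u9 pt_values
    have ne: "u 4 \<noteq> k" if "u k \<noteq> 4" for k using invol[of 4] that by auto
    have "u 4 < 10" using lt[of 4] by simp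
    moreover have "u 4 \<noteq> 0" "u 4 \<noteq> 1" "u 4 \<noteq> 2" "u 4 \<noteq> 3" "u 4 \<noteq> 6" "u 4 \<noteq> 9"
      by (rule ne, simp add: u del: One_nat_def)+
    ultimately have u4: "u 4 = 4 \<or> u 4 = 5 \<or> u 4 = 7 \<or> u 4 = 8" by (auto simp: less_10_cases)
    have 9: "(9::nat) < 10" "(1::nat) < 10" by simp_all
    \<comment> \<open>\<open>u \<circ> pt_a\<close> moves 9 to 0 to 6 to 9. A cycle of length 3
      excludes the orders 4 and 5, so the cube is the identity; its value at 1 then singles out
      \<open>u 4 = 5\<close>.\<close>
    have "u (pt_a (u (pt_a (u (pt_a (u (pt_a 9))))))) \<noteq> 9" "u (pt_a (u (pt_a (u (pt_a (u (pt_a (u (pt_a 9))))))))) \<noteq> 9"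
      by (simp_all add: u del: One_nat_def)
    then have "u (pt_a (u (pt_a (u (pt_a 1))))) = 1" using ord 9 by blast
    then have r: "u (pt_a (u (pt_a (u 4)))) = 1" by (simp add: u del: One_nat_def)
    from u4 have "u 4 = 5 \<and> u 7 = 8 \<and> u 8 = 7 \<and> u 5 = 4"
    proof (elim disjE)
      assume v: "u 4 = 4"
      have "u 7 = 5" using step[of 4 5] v by (simp add: pt_values)
      moreover then have "u 8 = 8" using step[of 7 8] by (simp add: pt_values)
      ultimately show ?thesis using r v by (simp add: u del: One_nat_def)
    next
      assume v: "u 4 = 7"
      then show ?thesis using r by (simp add: u del: One_nat_def)
    next
      assume v: "u 4 = 8"
      have "u 7 = 7" using step[of 4 7] v by (simp add: pt_values)
      moreover then have "u 8 = 4" using step[of 7 4] by (simp add: pt_values)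
      moreover then have "u 5 = 5" using step[of 8 5] by (simp add: pt_values)
      ultimately show ?thesis using r v by (simp add: u del: One_nat_def)
    next
      assume v: "u 4 = 5"
      have "u 7 = 8" using step[of 4 8] v by (simp add: pt_values)
      moreover then have "u 8 = 7" using step[of 7 7] by (simp add: pt_values)
      ultimately show ?thesis using v invol[of 4] by simp
    qed
    then show ?thesis
      using n[unfolded less_10_cases] by (elim insertE emptyE) (simp_all add: u del: One_nat_def)
  next
    case False
    then have u3: "u 3 = 4" using u3 by simp
    have u1: "u 1 = 5" using step[of 3 5] u3 by (simp add: pt_values del: One_nat_def)
    have u6: "u 6 = 8" using step[of 1 8] u1 by (simp add: pt_values del: One_nat_def)
    have u2: "u 2 = 7" using step[of 6 7] u6 by (simp add: pt_values del: One_nat_def)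
    have "u 4 = 3" "u 5 = 1" "u 8 = 6" "u 7 = 2"
      using invol[of 3] invol[of 1] invol[of 6] invol[of 2] u3 u1 u6 u2 by simp_all
    note u = this u0 u1 u2 u3 u6 u9 pt_values
    \<comment> \<open>Here \<open>u \<circ> pt_a\<close> moves 9 through 0, 4, 2, 1, 3, so none of
      its third, fourth and fifth powers fixes 9.\<close>
    have "u (pt_a (u (pt_a (u (pt_a 9))))) \<noteq> 9" "u (pt_a (u (pt_a (u (pt_a (u (pt_a 9))))))) \<noteq> 9"
      "u (pt_a (u (pt_a (u (pt_a (u (pt_a (u (pt_a 9))))))))) \<noteq> 9"
      by (simp_all add: u del: One_nat_def)
    moreover have "(9::nat) < 10" by simp
    ultimately show ?thesis using ord by blast
  qed
qed

section \<open>Generated subgroups and the action on ten Sylow subgroups\<close>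

inductive_set gen :: "'a::group_mult set \<Rightarrow> 'a set" for S where
  gen_base: "x \<in> S \<Longrightarrow> x \<in> gen S"
| gen_mult: "x \<in> gen S \<Longrightarrow> y \<in> gen S \<Longrightarrow> x * y \<in> gen S"

lemma gen_subset: assumes "sgp H" "S \<subseteq> H" shows "gen S \<subseteq> H"
proof
  fix x assume "x \<in> gen S"
  then show "x \<in> H" by induct (use assms sgpD(3) in auto)
qed

text \<open>\<open>gen\<close> closes under products only; inverses come from the finiteness of
  \<open>H\<close>.\<close>

lemma sgp_gen: assumes "sgp H" "S \<subseteq> H" "S \<noteq> {}" shows "sgp (gen S)"
proof (rule sgp_finite_closed)
  show "finite (gen S)" using gen_subset[OF assms(1,2)] sgpD(1)[OF assms(1)] by (rule finite_subset)
qed (use assms(3) in \<open>auto intro: gen.intros\<close>)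

lemma is_emb_gen:
  assumes "is_emb \<phi> H" "sgp H" "S \<subseteq> H" shows "\<phi> ` gen S = gen (\<phi> ` S)"
proof
  have "\<phi> x \<in> gen (\<phi> ` S)" if "x \<in> gen S" for x
    using that
  proof induct
    case (gen_mult x y)
    then have "\<phi> (x * y) = \<phi> x * \<phi> y" using assms(1) gen_subset[OF assms(2,3)] by (auto simp: is_emb_def)
    then show ?case using gen_mult gen.gen_mult by metis
  qed (auto intro: gen.gen_base)
  then show "\<phi> ` gen S \<subseteq> gen (\<phi> ` S)" by blast
  show "gen (\<phi> ` S) \<subseteq> \<phi> ` gen S"
  proof
    fix y assume "y \<in> gen (\<phi> ` S)"
    then show "y \<in> \<phi> ` gen S"
    proof induct
      case (gen_mult x y)
      then obtain u v where uv: "u \<in> gen S" "v \<in> gen S" "x = \<phi> u" "y = \<phi> v" by blast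
      moreover have "u \<in> H" "v \<in> H" using uv gen_subset[OF assms(2,3)] by auto
      ultimately have "x * y = \<phi> (u * v)" using assms(1) by (simp add: is_emb_def)
      then show ?case using gen.gen_mult[OF uv(1,2)] by blast
    qed (auto intro: gen.gen_base)
  qed
qed

lemma self_eq_mult_group [simp]: "a = a * b \<longleftrightarrow> b = (1::'a::group_mult)" "a = b * a \<longleftrightarrow> b = (1::'a::group_mult)"
  by (metis mult_eq_self_group(1), metis mult_eq_self_group(2))

lemma card_powers_4:
  fixes x :: "'a::group_mult"
  assumes "x ^ 4 = 1" "x ^ 2 \<noteq> 1" shows "card (powers x) = 4"
proof -
  have "x ^ 1 \<noteq> 1" "x ^ 3 \<noteq> 1" using order_4_powers[OF assms, of 1] order_4_powers[OF assms, of 3] by simp_all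
  then have "1 \<noteq> x" "1 \<noteq> x ^ 2" "1 \<noteq> x ^ 3" "x \<noteq> x ^ 2" "x \<noteq> x ^ 3" "x ^ 2 \<noteq> x ^ 3"
    using assms(2) by (auto simp: power2_eq_square power3_eq_cube mult.assoc)
  then show ?thesis unfolding powers_4[OF assms(1)] by simp
qed

text \<open>\<open>P\<close> is transitive on the other nine Sylow subgroups and its normalizer has
  order 36, so the elements fixing both \<open>P\<close> and \<open>R\<close> number at most 4 and
  form \<open>powers t\<close>. Together with the coset of \<open>s\<close> they form a group of
  order 8, where \<open>order_4_unique\<close> applies to \<open>t\<close> and
  \<open>s\<close>.\<close>

lemma setwise_stabilizer:
  assumes "good H" "card H = 360" "card (sylows 3 H) = 10" "P \<in> sylows 3 H" "R \<in> sylows 3 H" "P \<noteq> R"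
    and t: "t \<in> H" "t ^ 4 = 1" "t ^ 2 \<noteq> 1" "conj_set t P = P" "conj_set t R = R"
    and s: "s \<in> H" "conj_set s P = R" "conj_set s R = P"
  shows "\<And>g. g \<in> H \<Longrightarrow> conj_set g P = P \<Longrightarrow> conj_set g R = R \<Longrightarrow> g \<in> powers t"
    "s ^ 2 = 1" "conj_by s t = inverse t"
proof -
  note H = good_sgp[OF assms(1)]
  have p: "prime (3::nat)" by simp
  have P: "sgp P" "P \<subseteq> H" "card P = 9" using sylows_card[OF assms(4), of 2] assms(2) by simp_all
  have N: "card (nrm H P) = 36" using card_sylows(1)[OF H p assms(4)] assms(2,3) by simp
  have "9 dvd card H" using assms(2) by simp
  note orb9 = sylow_9_orbit[OF assms(1) this assms(4,5,6)]
  let ?S = "{g\<in>H. conj_set g P = P \<and> conj_set g R = R}"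
  interpret action "nrm H P" "sylows 3 H" conj_set using conj_action[OF H nrm_subset sgp_nrm[OF H]] .
  have "card (orb R) \<ge> card ((\<lambda>g. conj_set g R) ` P)"
    using subset_nrm[OF P(1,2)] finite_subset[OF orb_subset[OF assms(5)] fin] by (intro card_mono) (auto simp: orb_def)
  then have "9 \<le> card (orb R)" using orb9(3) by simp
  moreover have "card (orb R) * card (stab R) = 36" using orbit_stabilizer[OF assms(5)] N by simp
  ultimately have "9 * card (stab R) \<le> 36" by (metis mult_le_mono1)
  moreover have "stab R = ?S" unfolding stab_def by (auto simp: nrm_def)
  ultimately have le: "card ?S \<le> 4" by simp
  have S: "sgp ?S" using sgp_stab[OF assms(5)] \<open>stab R = ?S\<close> by simp
  have "t \<in> ?S" using t by simp
  then have sub: "powers t \<subseteq> ?S" by (rule powers_subset[OF S])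
  have c4: "card (powers t) = 4" by (rule card_powers_4[OF t(2,3)])
  then have eq: "powers t = ?S" using card_seteq[OF sgpD(1)[OF S] sub] le by simp
  then show "\<And>g. g \<in> H \<Longrightarrow> conj_set g P = P \<Longrightarrow> conj_set g R = R \<Longrightarrow> g \<in> powers t" by blast
  let ?Q = "{g\<in>H. conj_set g P = P \<and> conj_set g R = R \<or> conj_set g P = R \<and> conj_set g R = P}"
  have Q: "sgp ?Q"
  proof (rule sgp_finite_closed)
    show "finite ?Q" using sgpD(1)[OF H] by simp
    show "?Q \<noteq> {}" using s by blast
    show "\<And>x y. x \<in> ?Q \<Longrightarrow> y \<in> ?Q \<Longrightarrow> x * y \<in> ?Q" using sgpD(3)[OF H] by (auto simp: conj_set_mult)
  qed
  have "?Q = powers t \<union> (*) s ` powers t"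
  proof
    show "?Q \<subseteq> powers t \<union> (*) s ` powers t"
    proof
      fix g assume g: "g \<in> ?Q"
      show "g \<in> powers t \<union> (*) s ` powers t"
      proof (cases "conj_set g P = P")
        case True
        then have "conj_set g R = R" using g assms(6) by auto
        then show ?thesis using True g eq by blast
      next
        case False
        then have gg: "conj_set g P = R" "conj_set g R = P" using g by auto
        have si: "conj_set (inverse s) R = P" "conj_set (inverse s) P = R"
          using conj_set_inverse(1)[of s P] conj_set_inverse(1)[of s R] s by simp_all
        have "inverse s * g \<in> H" using g s sgpD(3,4)[OF H] by blast
        then have "inverse s * g \<in> ?S" by (simp add: conj_set_mult gg si)
        then have "inverse s * g \<in> powers t" using eq by blast
        then have "g \<in> (*) s ` powers t" by (intro image_eqI[of _ _ "inverse s * g"]) simp_all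
        then show ?thesis by blast
      qed
    qed
    show "powers t \<union> (*) s ` powers t \<subseteq> ?Q"
      unfolding eq using s sgpD(3)[OF H] by (auto simp: conj_set_mult)
  qed
  moreover have "powers t \<inter> (*) s ` powers t = {}"
    unfolding eq using s assms(6) by (auto simp: conj_set_mult)
  moreover have "card ((*) s ` powers t) = 4" using c4 by (subst card_image) (auto simp: inj_on_def)
  moreover have "finite (powers t)" using eq S sgpD(1) by metis
  ultimately have "card ?Q = 2 ^ 3" using c4 card_Un_disjoint[of "powers t" "(*) s ` powers t"] by simp
  then have Q4: "x ^ 4 = 1" if "x \<in> ?Q" for x using p_subgroup_order[OF assms(1) Q _ _ that, of 2 3 4] by blast
  have "t \<in> ?Q" "s \<in> ?Q" "s \<notin> powers t" using t s assms(6) eq by auto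
  then show "s ^ 2 = 1" "conj_by s t = inverse t"
    using order_4_unique[OF assms(1) Q _ Q4 _ t(3), of s] by blast+
qed

text \<open>Some \<open>g\<close> moves \<open>P\<close> to \<open>R\<close> and hence
  \<open>R\<close> to some \<open>?R1 \<noteq> R\<close>. As \<open>R\<close> is transitive on the
  subgroups other than itself, one of its elements moves \<open>?R1\<close> to
  \<open>P\<close>.\<close>

lemma exists_swap:
  assumes "good H" "9 dvd card H" "card (sylows 3 H) = 10" "P \<in> sylows 3 H" "R \<in> sylows 3 H" "P \<noteq> R"
  obtains s where "s \<in> H" "conj_set s P = R" "conj_set s R = P"
proof -
  note H = good_sgp[OF assms(1)]
  have p: "prime (3::nat)" by simp
  obtain g where g: "g \<in> H" "R = conj_set g P" using sylows_conjugate[OF H p assms(4,5)] .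
  let ?R1 = "conj_set g R"
  have "R \<noteq> ?R1"
  proof
    assume "R = ?R1"
    then have "conj_set (inverse g) (conj_set g P) = conj_set (inverse g) (conj_set g R)" using g(2) by simp
    then show False using assms(6) by simp
  qed
  then have R1: "?R1 \<in> sylows 3 H" "R \<noteq> ?R1" using sylows_conj[OF H assms(5) g(1)] by simp_all
  note o = sylow_9_orbit[OF assms(1,2,5) R1]
  have "card (sylows 3 H - {R}) = 9" using assms(3,5) finite_sylows[OF H] by simp
  then have "(\<lambda>g. conj_set g ?R1) ` R = sylows 3 H - {R}"
    using o(2,3) finite_sylows[OF H] by (intro card_subset_eq) auto
  then have "P \<in> (\<lambda>g. conj_set g ?R1) ` R" using assms(4,6) by blast
  then obtain h where h: "h \<in> R" "P = conj_set h ?R1" by blast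
  have R: "sgp R" "R \<subseteq> H" using assms(5) by (auto simp: sylows_def)
  have "h * g \<in> H" using h g R sgpD(3)[OF H] by blast
  moreover have "conj_set (h * g) P = R" unfolding conj_set_mult g(2)[symmetric] using conj_set_self[OF R(1) h(1)] .
  moreover have "conj_set (h * g) R = P" unfolding conj_set_mult h(2)[symmetric] ..
  ultimately show thesis using that by blast
qed

text \<open>\<open>P\<close> plays infinity, \<open>R\<close> zero, \<open>a\<close> and
  \<open>b\<close> the translations by 1 and i, \<open>t\<close> the multiplication by i, and
  \<open>s\<close> the map -1 / z. The four permutations come out the same for every such group,
  which is what the comparison of two groups rests on.\<close>

lemma order_360_permutations:
  fixes H :: "'a::group_mult set"
  assumes "good H" "card H = 360" "card (sylows 3 H) = 10"
  obtains \<phi> :: "'a \<Rightarrow> nat bij" and a b t s where "is_emb \<phi> H" "{a, b, t, s} \<subseteq> H" "gen {a, b, t, s} = H"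
    "apply_bij (\<phi> a) = pt_a" "apply_bij (\<phi> b) = pt_b" "apply_bij (\<phi> t) = pt_t" "apply_bij (\<phi> s) = pt_s"
proof -
  note H = good_sgp[OF assms(1)]
  have p: "prime (3::nat)" by simp
  have 9: "9 dvd card H" using assms(2) by simp
  obtain P where P0: "P \<in> sylows 3 H" using sylows_nonempty[OF H p] by blast
  have P: "sgp P" "P \<subseteq> H" "card P = 9" using sylows_card[OF P0, of 2] assms(2) by simp_all
  have P3: "x ^ 3 = 1" if "x \<in> P" for x using p_subgroup_order[OF assms(1) P(1,2), of 3 2 x 3] P(3) that by simp
  let ?N = "nrm H P"
  have N: "sgp ?N" "?N \<subseteq> H" "P \<subseteq> ?N" using sgp_nrm[OF H] nrm_subset subset_nrm[OF P(1,2)] by auto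
  have c36: "card ?N = 36" using card_sylows(1)[OF H p P0] assms(2,3) by simp
  have gN: "good ?N" using good_subgroup[OF assms(1) N(1,2)] .
  have n: "conj_set g P = P" if "g \<in> ?N" for g using that by (simp add: nrm_def)
  have "card ?N = 9 \<or> card ?N = 18 \<and> (\<exists>z\<in>?N. z ^ 2 = 1 \<and> z \<noteq> 1) \<or> card ?N = 36 \<and> (\<exists>t\<in>?N. t ^ 4 = 1 \<and> t ^ 2 \<noteq> 1)"
    by (rule structure_9[OF gN P(1) N(3) P(3)]) (use n c36 in simp_all)
  then obtain t where t: "t \<in> ?N" "t ^ 4 = 1" "t ^ 2 \<noteq> 1" using c36 by auto
  have tH: "t \<in> H" and tP: "conj_set t P = P" using t(1) by (auto simp: nrm_def)
  obtain a b where ab: "a \<in> P" "b \<in> P" "a \<noteq> 1" "conj_by t a = b" "conj_by t b = a ^ 2" "P \<subseteq> {a ^ i * b ^ j | i j. True}"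
    by (rule order_9_generators[OF assms(1) P tP tH t(2,3)]) (rule that)
  have abH: "a \<in> H" "b \<in> H" using ab P by auto
  have com: "b ^ i * a ^ j = a ^ j * b ^ i" for i j using commute_power[OF abelian_9[OF P(1,3) ab(2,1)]] .
  have fin: "finite (sylows 3 H)" by (rule finite_sylows[OF H])
  have c9: "card (sylows 3 H - {P}) = 9" using assms(3) P0 fin by simp

  \<comment> \<open>A 2-group acting on the nine other Sylow subgroups has a fixed point, because
    nine is odd.\<close>
  obtain R where R: "R \<in> sylows 3 H" "R \<noteq> P" "conj_set t R = R"
  proof -
    have T: "sgp (powers t)" "powers t \<subseteq> H" using sgp_powers[OF H tH] powers_subset[OF H tH] .
    have TN: "powers t \<subseteq> ?N" using powers_subset[OF N(1) t(1)] .
    interpret action "powers t" "sylows 3 H - {P}" conj_set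
    proof
      fix g Q assume g: "g \<in> powers t" and Q: "Q \<in> sylows 3 H - {P}"
      have "conj_set g P = P" using n TN g by blast
      then have "conj_set g Q \<noteq> P" using Q by (metis DiffD2 conj_set_inverse(1) singletonI)
      then show "conj_set g Q \<in> sylows 3 H - {P}" using sylows_conj[OF H] Q g T(2) by blast
    qed (use T fin in \<open>auto simp: conj_set_mult\<close>)
    have 4: "x ^ (2 ^ 2) = 1" if "x \<in> powers t" for x
    proof -
      obtain i where "x = t ^ i" using \<open>x \<in> powers t\<close> by (auto simp: powers_def)
      then have "x ^ 4 = (t ^ 4) ^ i" by (metis mult.commute power_mult)
      then show ?thesis using t(2) by simp
    qed
    obtain k where "card (powers t) = 2 ^ k" using card_prime_power[OF T(1) two_is_prime_nat 4] by blast
    then have "card fixed mod 2 = 1" using card_fixed_cong[OF two_is_prime_nat] c9 by simp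
    then have "fixed \<noteq> {}" by (intro notI) simp
    then obtain R where "R \<in> fixed" by blast
    then show thesis using that powers_self[of t] by (auto simp: fixed_def)
  qed
  note orb = sylow_9_orbit[OF assms(1) 9 P0 R(1) R(2)[symmetric]]
  have orb_eq: "(\<lambda>g. conj_set g R) ` P = sylows 3 H - {P}"
    using orb(2,3) c9 fin by (intro card_subset_eq) auto

  \<comment> \<open>\<open>q x y\<close> is the point x + y i, the translate of zero
    \<open>R\<close> by \<open>a ^ x * b ^ y\<close>.\<close>
  define q where "q = (\<lambda>i j. conj_set (a ^ i * b ^ j) R)"
  have q_mod: "q i j = q (i mod 3) (j mod 3)" for i j
    by (simp add: q_def power_mod_order P3 ab)
  have aq: "conj_set a (q i j) = q (Suc i) j" for i j
    by (simp add: q_def mult.assoc flip: conj_set_mult)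
  have bq: "conj_set b (q i j) = q i (Suc j)" for i j
  proof -
    have "b * (a ^ i * b ^ j) = a ^ i * b ^ Suc j" using com[of 1 i] by (simp add: mult.assoc flip: mult.assoc[of b])
    then show ?thesis by (simp only: q_def conj_set_mult[symmetric])
  qed
  \<comment> \<open>Multiplication by i sends x + y i to -y + x i, and -y is 2 y modulo 3.\<close>
  have tq: "conj_set t (q i j) = q (2 * j) i" for i j
  proof -
    have "conj_by t (a ^ i * b ^ j) = a ^ (2 * j) * b ^ i"
      unfolding conj_by_prod conj_by_power[symmetric] ab(4,5) power_mult[symmetric] by (rule com)
    then have "t * (a ^ i * b ^ j) = (a ^ (2 * j) * b ^ i) * t" by (metis eq_mult_inverse_iff)
    then have "conj_set t (q i j) = conj_set ((a ^ (2 * j) * b ^ i) * t) R"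
      by (simp only: q_def conj_set_mult[symmetric])
    then show ?thesis by (simp only: q_def conj_set_mult R(3))
  qed
  define pt where "pt = (\<lambda>n::nat. if n = 9 then P else q (n div 3) (n mod 3))"
  have qr: "q 3 j = q 0 j" "q j 3 = q j 0" "q 4 j = q 1 j" for j
    using q_mod[of 3 j] q_mod[of 0 j] q_mod[of j 3] q_mod[of j 0] q_mod[of 4 j] q_mod[of 1 j] by simp_all
  have a_q: "conj_set a (q 0 j) = q 1 j" "conj_set a (q 1 j) = q 2 j" "conj_set a (q 2 j) = q 0 j"
    "conj_set b (q j 0) = q j 1" "conj_set b (q j 1) = q j 2" "conj_set b (q j 2) = q j 0"
    "conj_set t (q j 0) = q 0 j" "conj_set t (q j 1) = q 2 j" "conj_set t (q j 2) = q 1 j" for j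
    using aq[of 0 j] aq[of 1 j] aq[of 2 j] bq[of j 0] bq[of j 1] bq[of j 2] tq[of j 0] tq[of j 1] tq[of j 2]
    by (simp_all add: qr flip: numeral_2_eq_2)
  have pv: "pt 0 = q 0 0" "pt 1 = q 0 1" "pt 2 = q 0 2" "pt 3 = q 1 0" "pt 4 = q 1 1" "pt 5 = q 1 2"
    "pt 6 = q 2 0" "pt 7 = q 2 1" "pt 8 = q 2 2" "pt 9 = P"
    by (simp_all add: pt_def)
  have aP: "conj_set a P = P" "conj_set b P = P" using conj_set_self[OF P(1)] ab by blast+
  have act: "conj_set a (pt n) = pt (pt_a n)" "conj_set b (pt n) = pt (pt_b n)" "conj_set t (pt n) = pt (pt_t n)"
    if "n < 10" for n
    using that by (auto simp: less_10_cases pv a_q aP tP pt_values simp del: One_nat_def)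
  have lt: "pt_a n < 10" "pt_b n < 10" "pt_t n < 10" if "n < 10" for n
    using that by (auto simp: less_10_cases pt_values)
  have ptR: "pt 0 = R" by (simp add: pt_def q_def)
  have im: "pt ` {..<10} = sylows 3 H"
  proof
    have "q i j \<in> sylows 3 H" for i j
      unfolding q_def using abH sgpD(3)[OF H] sgp_power[OF H] by (intro sylows_conj H R(1)) blast
    then show "pt ` {..<10} \<subseteq> sylows 3 H" using P0 by (auto simp: pt_def)
    show "sylows 3 H \<subseteq> pt ` {..<10}"
    proof
      fix Q assume Q: "Q \<in> sylows 3 H"
      show "Q \<in> pt ` {..<10}"
      proof (cases "Q = P")
        case True then show ?thesis by (intro image_eqI[of _ _ 9]) (simp_all add: pt_def)
      next
        case False
        then obtain g where "g \<in> P" "Q = conj_set g R" using Q orb_eq by blast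
        then obtain i j where "Q = q i j" using ab(6) unfolding q_def by blast
        then have "Q = q (i mod 3) (j mod 3)" using q_mod by simp
        moreover have "i mod 3 \<le> 2" "j mod 3 \<le> 2" by presburger+
        then have l: "3 * (i mod 3) + j mod 3 < 9" by linarith
        then have "pt (3 * (i mod 3) + j mod 3) = q (i mod 3) (j mod 3)" "3 * (i mod 3) + j mod 3 < 10"
          by (simp_all add: pt_def)
        ultimately show ?thesis by (intro image_eqI[of _ _ "3 * (i mod 3) + j mod 3"]) simp_all
      qed
    qed
  qed
  then have inj: "inj_on pt {..<10}" using assms(3) by (intro eq_card_imp_inj_on) simp_all
  define e where "e = inv_into {..<10} pt"
  have e: "bij_betw e (sylows 3 H) {..<10}"
    unfolding e_def using inj im by (intro bij_betw_inv_into) (simp add: bij_betw_def)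
  have ept: "e (pt n) = n" if "n < 10" for n unfolding e_def using that inj by simp
  have pt_eq: "n = m" if "pt n = pt m" "n < 10" "m < 10" for n m using that ept by metis

  obtain s0 where s0: "s0 \<in> H" "conj_set s0 P = R" "conj_set s0 R = P"
    using exists_swap[OF assms(1) 9 assms(3) P0 R(1) R(2)[symmetric]] .
  note ss = setwise_stabilizer[OF assms P0 R(1) R(2)[symmetric] tH t(2,3) tP R(3)]

  interpret action H "sylows 3 H" conj_set using conj_action[OF H subset_refl H] .
  \<comment> \<open>Fixing \<open>P\<close> and \<open>R\<close> puts \<open>g\<close> into
    \<open>powers t\<close>, and \<open>t\<close> moves the points 3, 1, 6, 2 in a cycle of length
    4.\<close>
  have faithful: "g = 1" if g: "g \<in> H" "\<And>Q. Q \<in> sylows 3 H \<Longrightarrow> conj_set g Q = Q" for g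
  proof -
    have "g \<in> powers t" using ss(1)[OF s0 g(1) g(2)[OF P0] g(2)[OF R(1)]] .
    then consider "g = 1" | "g = t" | "g = t * t" | "g = t * (t * t)"
      unfolding powers_4[OF t(2)] power2_eq_square power3_eq_cube by (auto simp: mult.assoc)
    moreover have "pt 3 \<in> pt ` {..<10}" by (rule imageI) simp
    then have "conj_set g (pt 3) = pt 3" unfolding im by (rule g(2))
    moreover have "conj_set t (pt 3) = pt 1" "conj_set t (pt 1) = pt 6" "conj_set t (pt 6) = pt 2"
      using act(3)[of 3] act(3)[of 1] act(3)[of 6] by (simp_all add: pt_values del: One_nat_def)
    ultimately show "g = 1"
    proof cases
      case 2
      with \<open>conj_set g (pt 3) = pt 3\<close> \<open>conj_set t (pt 3) = pt 1\<close> show ?thesis using pt_eq[of 3 1] by simp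
    next
      case 3
      then have "conj_set g (pt 3) = pt 6"
        using \<open>conj_set t (pt 3) = pt 1\<close> \<open>conj_set t (pt 1) = pt 6\<close> by (simp only: conj_set_mult)
      then show ?thesis using \<open>conj_set g (pt 3) = pt 3\<close> pt_eq[of 3 6] by simp
    next
      case 4
      then have "conj_set g (pt 3) = pt 2"
        using \<open>conj_set t (pt 3) = pt 1\<close> \<open>conj_set t (pt 1) = pt 6\<close> \<open>conj_set t (pt 6) = pt 2\<close>
        by (simp only: conj_set_mult)
      then show ?thesis using \<open>conj_set g (pt 3) = pt 3\<close> pt_eq[of 3 2] by simp
    qed
  qed
  obtain \<phi> :: "'a \<Rightarrow> nat bij" where \<phi>: "is_emb \<phi> H" "\<And>g. g \<in> H \<Longrightarrow> apply_bij (\<phi> g) permutes {..<10}"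
    "\<And>g Q. g \<in> H \<Longrightarrow> Q \<in> sylows 3 H \<Longrightarrow> apply_bij (\<phi> g) (e Q) = e (conj_set g Q)"
    by (rule permutation_embedding[OF _ e]) (assumption | rule faithful that)+
  have F: "apply_bij (\<phi> g) n = m" if "g \<in> H" "conj_set g (pt n) = pt m" "n < 10" "m < 10" for g n m
  proof -
    have "pt n \<in> pt ` {..<10}" by (rule imageI) (simp add: that(3))
    then have "pt n \<in> sylows 3 H" unfolding im .
    then show ?thesis using \<phi>(3)[OF that(1), of "pt n"] that ept by simp
  qed
  have Fout: "apply_bij (\<phi> g) n = n" if "g \<in> H" "\<not> n < 10" for g n
    using permutes_not_in[OF \<phi>(2)[OF that(1)]] that(2) by simp
  have Flt: "apply_bij (\<phi> g) n < 10" if "g \<in> H" "n < 10" for g n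
    using permutes_in_image[OF \<phi>(2)[OF that(1)], of n] that(2) by simp
  have hom: "\<phi> (g * h) = \<phi> g * \<phi> h" if "g \<in> H" "h \<in> H" for g h using \<phi>(1) that by (simp add: is_emb_def)
  have Fa: "apply_bij (\<phi> a) = pt_a"
  proof
    fix n show "apply_bij (\<phi> a) n = pt_a n"
      using F[OF abH(1) act(1) _ lt(1), of n] Fout[OF abH(1), of n] by (cases "n < 10") (auto simp: pt_a_def)
  qed
  have Fb: "apply_bij (\<phi> b) = pt_b"
  proof
    fix n show "apply_bij (\<phi> b) n = pt_b n"
      using F[OF abH(2) act(2) _ lt(2), of n] Fout[OF abH(2), of n] by (cases "n < 10") (auto simp: pt_b_def)
  qed
  have Ft: "apply_bij (\<phi> t) = pt_t"
  proof
    fix n show "apply_bij (\<phi> t) n = pt_t n"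
      using F[OF tH act(3) _ lt(3), of n] Fout[OF tH, of n] by (cases "n < 10") (auto simp: pt_t_def)
  qed

  \<comment> \<open>On the nonzero points \<open>pt_t\<close> has two cycles, one through 6 and one
    through 4. Replacing \<open>s0\<close> by some \<open>t ^ k * s0\<close>, which still swaps
    \<open>P\<close> and \<open>R\<close>, brings the image of 3, the field element 1, to one of
    these two.\<close>
  obtain s where s: "s \<in> H" "conj_set s P = R" "conj_set s R = P" "apply_bij (\<phi> s) 3 = 6 \<or> apply_bij (\<phi> s) 3 = 4"
  proof -
    have ts: "t * s' \<in> H" "conj_set (t * s') P = R" "conj_set (t * s') R = P"
      "apply_bij (\<phi> (t * s')) 3 = pt_t (apply_bij (\<phi> s') 3)"
      if "s' \<in> H" "conj_set s' P = R" "conj_set s' R = P" for s'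
      using that tH tP R(3) sgpD(3)[OF H] hom Ft by (simp_all add: conj_set_mult)
    note t1 = ts[OF s0] note t2 = ts[OF t1(1-3)] note t3 = ts[OF t2(1-3)]
    let ?c = "apply_bij (\<phi> s0) 3"
    have v: "apply_bij (\<phi> s0) 9 = 0" "apply_bij (\<phi> s0) 0 = 9"
      using F[OF s0(1), of 9 0] F[OF s0(1), of 0 9] s0(2,3) ptR pv(10) by simp_all
    have inj: "inj (apply_bij (\<phi> s0))" using permutes_inj[OF \<phi>(2)[OF s0(1)]] .
    have "?c \<noteq> 0" "?c \<noteq> 9" using injD[OF inj, of 3 9] injD[OF inj, of 3 0] v by auto
    then have "?c = 1 \<or> ?c = 2 \<or> ?c = 3 \<or> ?c = 4 \<or> ?c = 5 \<or> ?c = 6 \<or> ?c = 7 \<or> ?c = 8"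
      using Flt[OF s0(1), of 3] by auto
    then have "\<exists>x\<in>{?c, pt_t ?c, pt_t (pt_t ?c), pt_t (pt_t (pt_t ?c))}. x = 6 \<or> x = 4"
      by (elim disjE) (simp_all add: pt_values del: One_nat_def)
    then show thesis using that[OF s0] that[OF t1(1-3)] that[OF t2(1-3)] that[OF t3(1-3)] t1(4) t2(4) t3(4) by auto
  qed
  note st = ss(2,3)[OF s(1-3)]
  let ?u = "apply_bij (\<phi> s)"
  have \<phi>1: "\<phi> 1 = 1" using is_emb_one[OF \<phi>(1) H] .
  have Fs: "?u n = pt_s n" if "n < 10" for n
  proof (rule swap_determined[where u = "apply_bij (\<phi> s)", OF _ _ _ _ s(4) _ that])
    show "?u m < 10" if "m < 10" for m using Flt[OF s(1) that] .
    show "?u 0 = 9" using F[OF s(1), of 0 9] s(3) ptR pv(10) by simp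
    have "s * s = 1" using st(1) by (simp add: power2_eq_square)
    then have "\<phi> s * \<phi> s = 1" using hom[OF s(1) s(1)] \<phi>1 by simp
    then show "?u (?u m) = m" for m by (metis apply_bij_simps)
    \<comment> \<open>This is \<open>conj_by s t = inverse t\<close>, in the shape of the hypothesis
      \<open>tw\<close> of \<open>swap_determined\<close>.\<close>
    have "t * (s * t) = s" using st(2) by (metis eq_mult_inverse_iff right_cancel_inverse)
    then have "\<phi> t * (\<phi> s * \<phi> t) = \<phi> s" using hom[OF tH, of "s * t"] hom[OF s(1) tH] sgpD(3)[OF H s(1) tH] by simp
    then show "pt_t (?u (pt_t m)) = ?u m" for m by (metis apply_bij_simps(1) Ft)
    have saH: "s * a \<in> H" using sgpD(3)[OF H s(1) abH(1)] .
    have \<phi>sa: "\<phi> (s * a) = \<phi> s * \<phi> a" using hom[OF s(1) abH(1)] .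
    have pw: "(\<phi> s * \<phi> a) ^ k = 1" if "(s * a) ^ k = 1" for k
      using is_emb_power[OF \<phi>(1) H saH, of k] that \<phi>1 \<phi>sa by simp
    have "(\<phi> s * \<phi> a) ^ 3 = 1 \<or> (\<phi> s * \<phi> a) ^ 4 = 1 \<or> (\<phi> s * \<phi> a) ^ 5 = 1"
      using good_ord[OF assms(1) saH] pw by blast
    moreover have "apply_bij ((\<phi> s * \<phi> a) ^ 3) n = ?u (pt_a (?u (pt_a (?u (pt_a n)))))"
      "apply_bij ((\<phi> s * \<phi> a) ^ 4) n = ?u (pt_a (?u (pt_a (?u (pt_a (?u (pt_a n)))))))"
      "apply_bij ((\<phi> s * \<phi> a) ^ 5) n = ?u (pt_a (?u (pt_a (?u (pt_a (?u (pt_a (?u (pt_a n)))))))))" for n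
      by (simp_all add: eval_nat_numeral Fa)
    ultimately show "(\<forall>n<10. ?u (pt_a (?u (pt_a (?u (pt_a n))))) = n) \<or>
      (\<forall>n<10. ?u (pt_a (?u (pt_a (?u (pt_a (?u (pt_a n))))))) = n) \<or>
      (\<forall>n<10. ?u (pt_a (?u (pt_a (?u (pt_a (?u (pt_a (?u (pt_a n))))))))) = n)"
      by (metis apply_bij_simps(2))
  qed
  have Fs': "apply_bij (\<phi> s) = pt_s"
  proof
    fix n show "apply_bij (\<phi> s) n = pt_s n"
      using Fs[of n] Fout[OF s(1), of n] by (cases "n < 10") (auto simp: pt_s_def)
  qed

  \<comment> \<open>\<open>P\<close> lies in the generated group but is not normal there, as
    \<open>s\<close> moves it; so \<open>sylow_9_normal\<close> forces a factor 5, and the possible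
    orders leave only 360.\<close>
  let ?K = "gen {a, b, t, s}"
  have sub: "{a, b, t, s} \<subseteq> H" using abH tH s(1) by blast
  have K: "sgp ?K" "?K \<subseteq> H" using sgp_gen[OF H sub] gen_subset[OF H sub] by simp_all
  have gK: "a \<in> ?K" "b \<in> ?K" "t \<in> ?K" "s \<in> ?K" by (auto intro: gen.gen_base)
  have good: "good ?K" using good_subgroup[OF assms(1) K] .
  have PK: "P \<subseteq> ?K" using ab(6) gK(1,2) sgpD(3)[OF K(1)] sgp_power[OF K(1)] by blast
  have d9: "9 dvd card ?K" using lagrange_sgp[OF K(1) P(1) PK] P(3) by simp
  have PsK: "P \<in> sylows 3 ?K"
  proof -
    have "multiplicity 3 (card ?K) = 2" using d9 good_card_dvd(3)[OF good] by (intro multiplicity_eqI) auto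
    then show ?thesis using P PK by (simp add: sylows_def)
  qed
  have "5 dvd card ?K"
  proof (rule ccontr)
    assume n5: "\<not> 5 dvd card ?K"
    have "conj_set s P \<in> sylows 3 ?K" using sylows_conj[OF K(1) PsK gK(4)] .
    then have "R = P" using sylow_9_normal[OF good d9 n5 PsK] s(2) by simp
    then show False using R(2) by simp
  qed
  moreover have "4 dvd card ?K"
  proof -
    have "powers t \<subseteq> ?K" "sgp (powers t)" using powers_subset[OF K(1) gK(3)] sgp_powers[OF K(1) gK(3)] by auto
    moreover have "card (powers t) = 4" by (rule card_powers_4[OF t(2,3)])
    ultimately show ?thesis using lagrange_sgp[OF K(1)] by metis
  qed
  ultimately have "card ?K = 360" using card_cases_5[OF good] d9 by auto
  then have "?K = H" using sgp_eq_if_card_eq[OF H K(2)] assms(2) by simp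
  then show thesis using that[OF \<phi>(1) sub _ Fa Fb Ft Fs'] by blast
qed

text \<open>Both groups have generators acting by the same four permutations, so their permutation
  images coincide; one embedding followed by the inverse of the other is the isomorphism.\<close>

lemma order_360_unique:
  fixes H :: "'a::group_mult set" and H' :: "'b::group_mult set"
  assumes "good H" "card H = 360" "good H'" "card H' = 360"
  obtains \<psi> where "is_emb \<psi> H" "\<psi> ` H = H'"
proof -
  have c: "card (sylows 3 H) = 10" "card (sylows 3 H') = 10"
    using card_cases_5[OF assms(1)] card_cases_5[OF assms(3)] assms(2,4) by simp_all
  obtain \<phi> :: "'a \<Rightarrow> nat bij" and a b t s where 1: "is_emb \<phi> H" "{a, b, t, s} \<subseteq> H" "gen {a, b, t, s} = H"
    "apply_bij (\<phi> a) = pt_a" "apply_bij (\<phi> b) = pt_b" "apply_bij (\<phi> t) = pt_t" "apply_bij (\<phi> s) = pt_s"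
    using order_360_permutations[OF assms(1,2) c(1)] .
  obtain \<phi>' :: "'b \<Rightarrow> nat bij" and a' b' t' s' where 2: "is_emb \<phi>' H'" "{a', b', t', s'} \<subseteq> H'" "gen {a', b', t', s'} = H'"
    "apply_bij (\<phi>' a') = pt_a" "apply_bij (\<phi>' b') = pt_b" "apply_bij (\<phi>' t') = pt_t" "apply_bij (\<phi>' s') = pt_s"
    using order_360_permutations[OF assms(3,4) c(2)] .
  have "\<phi> a = \<phi>' a'" "\<phi> b = \<phi>' b'" "\<phi> t = \<phi>' t'" "\<phi> s = \<phi>' s'"
    using 1(4-7) 2(4-7) by (simp_all flip: apply_bij_inject)
  then have im: "\<phi> ` H = \<phi>' ` H'"
    using is_emb_gen[OF 1(1) good_sgp[OF assms(1)] 1(2)] is_emb_gen[OF 2(1) good_sgp[OF assms(3)] 2(2)] 1(3) 2(3) by simp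
  have inj: "inj_on \<phi>' H'" using 2(1) by (simp add: is_emb_def)
  define \<psi> where "\<psi> = inv_into H' \<phi>' \<circ> \<phi>"
  have \<psi>: "\<psi> x \<in> H'" "\<phi>' (\<psi> x) = \<phi> x" if "x \<in> H" for x
  proof -
    have "\<phi> x \<in> \<phi>' ` H'" using im that by blast
    then show "\<psi> x \<in> H'" "\<phi>' (\<psi> x) = \<phi> x" by (simp_all add: \<psi>_def inv_into_into f_inv_into_f)
  qed
  have "\<psi> (x * y) = \<psi> x * \<psi> y" if xy: "x \<in> H" "y \<in> H" for x y
  proof (rule inj_onD[OF inj])
    have xyH: "x * y \<in> H" using xy sgpD(3)[OF good_sgp[OF assms(1)]] by blast
    show "\<phi>' (\<psi> (x * y)) = \<phi>' (\<psi> x * \<psi> y)"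
      using 1(1) 2(1) xy xyH \<psi> by (simp add: is_emb_def)
    show "\<psi> (x * y) \<in> H'" "\<psi> x * \<psi> y \<in> H'" using \<psi>(1) xy xyH sgpD(3)[OF good_sgp[OF assms(3)]] by blast+
  qed
  moreover have "inj_on \<psi> H"
    using 1(1) \<psi>(2) by (intro inj_onI) (metis is_emb_def inj_onD)
  moreover have "\<psi> ` H = H'"
  proof
    show "\<psi> ` H \<subseteq> H'" using \<psi>(1) by blast
    show "H' \<subseteq> \<psi> ` H"
    proof
      fix y assume y: "y \<in> H'"
      then obtain x where x: "x \<in> H" "\<phi> x = \<phi>' y" using im by (metis imageE imageI)
      then have "\<psi> x = y" using inj_onD[OF inj, of "\<psi> x" y] \<psi>[OF x(1)] y by simp
      then show "y \<in> \<psi> ` H" using x(1) by blast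
    qed
  qed
  ultimately have "is_emb \<psi> H" "\<psi> ` H = H'" by (simp_all add: is_emb_def)
  then show thesis by (rule that)
qed

subsection \<open>From abstract groups to permutation groups\<close>

text \<open>Left translation, extended by the identity outside the carrier to a bijection of the
  type.\<close>

definition cayley :: "('a, 'b) monoid_scheme \<Rightarrow> 'a \<Rightarrow> 'a bij" where
  "cayley G g = Bij (\<lambda>x. if x \<in> carrier G then g \<otimes>\<^bsub>G\<^esub> x else x)"

lemma apply_cayley:
  fixes G (structure)
  assumes "group G" "g \<in> carrier G"
  shows "apply_bij (cayley G g) = (\<lambda>x. if x \<in> carrier G then g \<otimes>\<^bsub>G\<^esub> x else x)"
proof -
  interpret group G by fact
  have "bij (\<lambda>x. if x \<in> carrier G then g \<otimes> x else x)"
    by (rule o_bij[of "\<lambda>x. if x \<in> carrier G then inv g \<otimes> x else x"])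
      (use assms(2) in \<open>auto simp: fun_eq_iff m_assoc[symmetric]\<close>)
  then show ?thesis by (simp add: cayley_def apply_Bij)
qed

lemma cayley_mult:
  fixes G (structure)
  assumes "group G" "g \<in> carrier G" "h \<in> carrier G"
  shows "cayley G (g \<otimes>\<^bsub>G\<^esub> h) = cayley G g * cayley G h"
proof -
  interpret group G by fact
  show ?thesis
    using assms(2,3) by (intro bij_eqI) (simp add: apply_cayley[OF assms(1)] m_assoc)
qed

lemma inj_cayley: fixes G (structure) assumes "group G" shows "inj_on (cayley G) (carrier G)"
proof
  interpret group G by fact
  fix g h assume gh: "g \<in> carrier G" "h \<in> carrier G" "cayley G g = cayley G h"
  then have "apply_bij (cayley G g) \<one> = apply_bij (cayley G h) \<one>" by simp
  then show "g = h" using gh(1,2) by (simp add: apply_cayley[OF assms])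
qed

text \<open>Kept apart from the bound on \<open>card\<close>, which is 0 for infinite sets.\<close>

lemma dId1_finite: assumes "dId1 G" shows "finite (carrier G)"
proof (rule ccontr)
  assume "infinite (carrier G)"
  then obtain x :: "nat \<Rightarrow> 'a" where x: "inj x" "range x \<subseteq> carrier G" using infinite_countable_subset by blast
  then have "\<forall>i\<le>360. x i \<in> carrier G" by blast
  then obtain i j where "i < j" "x i = x j" using assms unfolding dId1_def by blast
  then show False using injD[OF x(1), of i j] by simp
qed

lemma dId1_card: assumes "dId1 G" shows "card (carrier G) \<le> 360"
proof (rule ccontr)
  assume a: "\<not> card (carrier G) \<le> 360"
  have "card {..360::nat} \<le> card (carrier G)" using a by simp
  then obtain x where "x ` {..360::nat} \<subseteq> carrier G" "inj_on x {..360::nat}"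
    using card_le_inj[of "{..360::nat}" "carrier G"] dId1_finite[OF assms] by auto
  moreover then have "\<forall>i\<le>360. x i \<in> carrier G" by auto
  then obtain i j where "i < j" "j \<le> 360" "x i = x j" using assms unfolding dId1_def by blast
  ultimately show False using inj_onD[of x "{..360}" i j] by simp
qed

lemma card_dId1: assumes "finite (carrier G)" "card (carrier G) \<le> 360" shows "dId1 G"
  unfolding dId1_def
proof (intro allI impI)
  fix x :: "nat \<Rightarrow> 'a" assume x: "\<forall>i\<le>360. x i \<in> carrier G"
  have "\<not> inj_on x {..360}"
  proof
    assume "inj_on x {..360}"
    then have "card {..360::nat} \<le> card (carrier G)" using x assms(1) by (intro card_inj_on_le) auto
    then show False using assms(2) by simp
  qed
  then obtain i j where "i \<le> 360" "j \<le> 360" "x i = x j" "i \<noteq> j" by (auto simp: inj_on_def)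
  then show "\<exists>i j. i < j \<and> j \<le> 360 \<and> x i = x j" by (metis linorder_neqE_nat)
qed

text \<open>The identities are disjunctions of equations: choose preimages of the variables and
  apply the homomorphism to the disjunct that holds; (1) is a bound on the cardinality. This serves
  for the Cayley image and for the passage from \<open>A6_bij\<close> to
  \<open>alt_group 6\<close>.\<close>

lemma A6_basis_hom_image:
  fixes \<phi> :: "'a \<Rightarrow> 'c" and G :: "('a, 'b) monoid_scheme" (structure) and K :: "('c, 'd) monoid_scheme"
  assumes "group G" "group K" and basis: "A6_basis G" and K: "\<phi> ` carrier G = carrier K"
    and hom: "\<And>x y. x \<in> carrier G \<Longrightarrow> y \<in> carrier G \<Longrightarrow> \<phi> (x \<otimes> y) = \<phi> x \<otimes>\<^bsub>K\<^esub> \<phi> y"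
  shows "A6_basis K"
proof -
  interpret group G by fact
  have "\<phi> \<in> hom G K" using K hom by (auto simp: hom_def)
  then interpret h: group_hom G K \<phi> using assms(1,2) by (simp add: group_hom_def group_hom_axioms_def)
  have inv: "\<phi> (inv x) = inv\<^bsub>K\<^esub> (\<phi> x)" if "x \<in> carrier G" for x using that by simp
  have pow: "\<phi> (x [^] (n::nat)) = \<phi> x [^]\<^bsub>K\<^esub> n" if "x \<in> carrier G" for x n
    using that by (simp add: h.hom_nat_pow)
  have one: "\<phi> \<one> = \<one>\<^bsub>K\<^esub>" by simp
  note hs = hom inv pow
  have im: "w = z \<Longrightarrow> \<phi> w = \<phi> z" for w z by simp
  have pow1: "\<phi> w [^]\<^bsub>K\<^esub> n = \<one>\<^bsub>K\<^esub>" if "w [^] n = \<one>" "w \<in> carrier G" for w and n :: nat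
    using pow[OF that(2), of n] that(1) one by simp
  define y where "y = (\<lambda>x. inv_into (carrier G) \<phi> x)"
  have y: "y x \<in> carrier G" "\<phi> (y x) = x" if "x \<in> carrier K" for x
    using that K by (auto simp: y_def intro: inv_into_into f_inv_into_f)
  have d: "dId1 G" "dId2 G" "dId3 G" "dId4 G" "dId5 G" "dId6 G" "dId7 G" using basis by (simp_all add: A6_basis_def)
  have "card (carrier K) \<le> 360" "finite (carrier K)"
    using card_image_le[OF dId1_finite[OF d(1)], of \<phi>] dId1_card[OF d(1)] dId1_finite[OF d(1)] unfolding K[symmetric] by simp_all
  then have "dId1 K" by (intro card_dId1)
  moreover have "dId2 K"
    unfolding dId2_def
  proof
    fix x assume x: "x \<in> carrier K"
    show "x [^]\<^bsub>K\<^esub> (3::nat) = \<one>\<^bsub>K\<^esub> \<or> x [^]\<^bsub>K\<^esub> (4::nat) = \<one>\<^bsub>K\<^esub> \<or> x [^]\<^bsub>K\<^esub> (5::nat) = \<one>\<^bsub>K\<^esub>"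
      using d(2)[unfolded dId2_def, rule_format, OF y(1)[OF x]] pow1[OF _ y(1)[OF x]] y(2)[OF x] by metis
  qed
  moreover have "dId3 K"
    unfolding dId3_def
  proof (intro allI impI)
    fix x :: "nat \<Rightarrow> 'c" assume x: "\<forall>i\<in>{1..9}. x i \<in> carrier K"
    let ?y = "\<lambda>i. y (x i)"
    have yc: "?y i \<in> carrier G" "\<phi> (?y i) = x i" if "i \<in> {1..9}" for i using y x that by auto
    have 1: "x i [^]\<^bsub>K\<^esub> (20::nat) = \<one>\<^bsub>K\<^esub>" if "i \<in> {1..9}" "?y i [^] (20::nat) = \<one>" for i
      using pow1[OF that(2)] yc[OF that(1)] by simp
    have 2: "x i = x j" if "i \<in> {1..9}" "j \<in> {1..9}" "?y i = ?y j" for i j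
      using yc(2)[OF that(1)] yc(2)[OF that(2)] that(3) by metis
    have 3: "(x i \<otimes>\<^bsub>K\<^esub> x j) [^]\<^bsub>K\<^esub> (20::nat) = \<one>\<^bsub>K\<^esub>" if "i \<in> {1..9}" "j \<in> {1..9}" "(?y i \<otimes> ?y j) [^] (20::nat) = \<one>" for i j
      using pow1[OF that(3)] yc[OF that(1)] yc[OF that(2)] by (simp add: hs)
    have 4: "(x i \<otimes>\<^bsub>K\<^esub> x j [^]\<^bsub>K\<^esub> (2::nat)) [^]\<^bsub>K\<^esub> (20::nat) = \<one>\<^bsub>K\<^esub>" if "i \<in> {1..9}" "j \<in> {1..9}" "(?y i \<otimes> ?y j [^] (2::nat)) [^] (20::nat) = \<one>" for i j
      using pow1[OF that(3)] yc[OF that(1)] yc[OF that(2)] by (simp add: hs)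
    have "\<forall>i\<in>{1..9}. ?y i \<in> carrier G" using yc(1) by blast
    then have "(\<exists>i\<in>{1..9}. ?y i [^] (20::nat) = \<one>) \<or> (\<exists>i\<in>{1..9}. \<exists>j\<in>{1..9}. i < j \<and> ?y i = ?y j) \<or>
      (\<exists>i\<in>{1..9}. \<exists>j\<in>{1..9}. i < j \<and> (?y i \<otimes> ?y j) [^] (20::nat) = \<one>) \<or>
      (\<exists>i\<in>{1..9}. \<exists>j\<in>{1..9}. i < j \<and> (?y i \<otimes> ?y j [^] (2::nat)) [^] (20::nat) = \<one>)"
      by (rule d(3)[unfolded dId3_def, THEN spec[of _ ?y], THEN mp])
    then show "(\<exists>i\<in>{1..9}. x i [^]\<^bsub>K\<^esub> (20::nat) = \<one>\<^bsub>K\<^esub>) \<or> (\<exists>i\<in>{1..9}. \<exists>j\<in>{1..9}. i < j \<and> x i = x j) \<or>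
      (\<exists>i\<in>{1..9}. \<exists>j\<in>{1..9}. i < j \<and> (x i \<otimes>\<^bsub>K\<^esub> x j) [^]\<^bsub>K\<^esub> (20::nat) = \<one>\<^bsub>K\<^esub>) \<or>
      (\<exists>i\<in>{1..9}. \<exists>j\<in>{1..9}. i < j \<and> (x i \<otimes>\<^bsub>K\<^esub> x j [^]\<^bsub>K\<^esub> (2::nat)) [^]\<^bsub>K\<^esub> (20::nat) = \<one>\<^bsub>K\<^esub>)"
    proof (elim disjE bexE conjE)
      fix i assume i: "i \<in> {1..9}" and e: "?y i [^] (20::nat) = \<one>"
      show ?thesis using 1[OF i e] i by blast
    next
      fix i j assume ij: "i \<in> {1..9}" "j \<in> {1..9}" and l: "i < j" and e: "?y i = ?y j"
      show ?thesis using 2[OF ij e] ij l by blast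
    next
      fix i j assume ij: "i \<in> {1..9}" "j \<in> {1..9}" and l: "i < j" and e: "(?y i \<otimes> ?y j) [^] (20::nat) = \<one>"
      show ?thesis using 3[OF ij e] ij l by blast
    next
      fix i j assume ij: "i \<in> {1..9}" "j \<in> {1..9}" and l: "i < j" and e: "(?y i \<otimes> ?y j [^] (2::nat)) [^] (20::nat) = \<one>"
      show ?thesis using 4[OF ij e] ij l by blast
    qed
  qed
  moreover have "dId4 K"
    unfolding dId4_def
  proof (intro ballI)
    fix u v assume uv: "u \<in> carrier K" "v \<in> carrier K"
    note yu = y[OF uv(1)] and yv = y[OF uv(2)]
    have 1: "(u \<otimes>\<^bsub>K\<^esub> v) [^]\<^bsub>K\<^esub> (15::nat) = \<one>\<^bsub>K\<^esub>" if "(y u \<otimes> y v) [^] (15::nat) = \<one>" using pow1[OF that] yu yv by (simp add: hs)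
    have 2: "(u \<otimes>\<^bsub>K\<^esub> v [^]\<^bsub>K\<^esub> k) [^]\<^bsub>K\<^esub> (15::nat) = \<one>\<^bsub>K\<^esub>" if "(y u \<otimes> y v [^] k) [^] (15::nat) = \<one>" for k :: nat
      using pow1[OF that] yu yv by (simp add: hs)
    have "u [^]\<^bsub>K\<^esub> (30::nat) = \<one>\<^bsub>K\<^esub>" if "y u [^] (30::nat) = \<one>" using pow1[OF that yu(1)] yu(2) by simp
    moreover have "v [^]\<^bsub>K\<^esub> (30::nat) = \<one>\<^bsub>K\<^esub>" if "y v [^] (30::nat) = \<one>" using pow1[OF that yv(1)] yv(2) by simp
    ultimately show "u [^]\<^bsub>K\<^esub> (30::nat) = \<one>\<^bsub>K\<^esub> \<or> v [^]\<^bsub>K\<^esub> (30::nat) = \<one>\<^bsub>K\<^esub> \<or> (u \<otimes>\<^bsub>K\<^esub> v) [^]\<^bsub>K\<^esub> (15::nat) = \<one>\<^bsub>K\<^esub> \<or> (u \<otimes>\<^bsub>K\<^esub> v [^]\<^bsub>K\<^esub> (2::nat)) [^]\<^bsub>K\<^esub> (15::nat) = \<one>\<^bsub>K\<^esub> \<or> (u \<otimes>\<^bsub>K\<^esub> v [^]\<^bsub>K\<^esub> (3::nat)) [^]\<^bsub>K\<^esub> (15::nat) = \<one>\<^bsub>K\<^esub>"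
      using d(4)[unfolded dId4_def, THEN bspec, THEN bspec, OF yu(1) yv(1)] 1 2[of 2] 2[of 3] by argo
  qed
  moreover have "dId6 K"
    unfolding dId6_def
  proof (intro ballI)
    fix u v assume uv: "u \<in> carrier K" "v \<in> carrier K"
    note yu = y[OF uv(1)] and yv = y[OF uv(2)]
    have 1: "(u \<otimes>\<^bsub>K\<^esub> inv\<^bsub>K\<^esub> v \<otimes>\<^bsub>K\<^esub> u \<otimes>\<^bsub>K\<^esub> v) [^]\<^bsub>K\<^esub> (12::nat) = \<one>\<^bsub>K\<^esub>" if "(y u \<otimes> inv y v \<otimes> y u \<otimes> y v) [^] (12::nat) = \<one>"
      using pow1[OF that] yu yv by (simp add: hs)
    have 2: "(u \<otimes>\<^bsub>K\<^esub> inv\<^bsub>K\<^esub> v \<otimes>\<^bsub>K\<^esub> u [^]\<^bsub>K\<^esub> (3::nat) \<otimes>\<^bsub>K\<^esub> v) [^]\<^bsub>K\<^esub> (12::nat) = \<one>\<^bsub>K\<^esub>" if "(y u \<otimes> inv y v \<otimes> y u [^] (3::nat) \<otimes> y v) [^] (12::nat) = \<one>"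
      using pow1[OF that] yu yv by (simp add: hs)
    have 3: "(u [^]\<^bsub>K\<^esub> (2::nat) \<otimes>\<^bsub>K\<^esub> inv\<^bsub>K\<^esub> v \<otimes>\<^bsub>K\<^esub> u \<otimes>\<^bsub>K\<^esub> v) [^]\<^bsub>K\<^esub> (12::nat) = \<one>\<^bsub>K\<^esub>" if "(y u [^] (2::nat) \<otimes> inv y v \<otimes> y u \<otimes> y v) [^] (12::nat) = \<one>"
      using pow1[OF that] yu yv by (simp add: hs)
    have "u [^]\<^bsub>K\<^esub> (12::nat) = \<one>\<^bsub>K\<^esub>" if "y u [^] (12::nat) = \<one>" using pow1[OF that yu(1)] yu(2) by simp
    moreover have "v [^]\<^bsub>K\<^esub> (30::nat) = \<one>\<^bsub>K\<^esub>" if "y v [^] (30::nat) = \<one>" using pow1[OF that yv(1)] yv(2) by simp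
    ultimately show "u [^]\<^bsub>K\<^esub> (12::nat) = \<one>\<^bsub>K\<^esub> \<or> v [^]\<^bsub>K\<^esub> (30::nat) = \<one>\<^bsub>K\<^esub> \<or> (u \<otimes>\<^bsub>K\<^esub> inv\<^bsub>K\<^esub> v \<otimes>\<^bsub>K\<^esub> u \<otimes>\<^bsub>K\<^esub> v) [^]\<^bsub>K\<^esub> (12::nat) = \<one>\<^bsub>K\<^esub> \<or>
        (u \<otimes>\<^bsub>K\<^esub> inv\<^bsub>K\<^esub> v \<otimes>\<^bsub>K\<^esub> u [^]\<^bsub>K\<^esub> (3::nat) \<otimes>\<^bsub>K\<^esub> v) [^]\<^bsub>K\<^esub> (12::nat) = \<one>\<^bsub>K\<^esub> \<or> (u [^]\<^bsub>K\<^esub> (2::nat) \<otimes>\<^bsub>K\<^esub> inv\<^bsub>K\<^esub> v \<otimes>\<^bsub>K\<^esub> u \<otimes>\<^bsub>K\<^esub> v) [^]\<^bsub>K\<^esub> (12::nat) = \<one>\<^bsub>K\<^esub>"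
      using d(6)[unfolded dId6_def, THEN bspec, THEN bspec, OF yu(1) yv(1)] 1 2 3 by argo
  qed
  moreover have "dId7 K"
    unfolding dId7_def
  proof (intro ballI)
    fix u v assume uv: "u \<in> carrier K" "v \<in> carrier K"
    note yu = y[OF uv(1)] and yv = y[OF uv(2)]
    have 1: "(u \<otimes>\<^bsub>K\<^esub> v [^]\<^bsub>K\<^esub> k) [^]\<^bsub>K\<^esub> (12::nat) = \<one>\<^bsub>K\<^esub>" if "(y u \<otimes> y v [^] k) [^] (12::nat) = \<one>" for k :: nat
      using pow1[OF that] yu yv by (simp add: hs)
    show "u [^]\<^bsub>K\<^esub> (12::nat) = \<one>\<^bsub>K\<^esub> \<or> v [^]\<^bsub>K\<^esub> (12::nat) = \<one>\<^bsub>K\<^esub> \<or> (\<exists>k::nat\<in>{1..4}. (u \<otimes>\<^bsub>K\<^esub> v [^]\<^bsub>K\<^esub> k) [^]\<^bsub>K\<^esub> (12::nat) = \<one>\<^bsub>K\<^esub>)"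
      using d(7)[unfolded dId7_def, rule_format, OF yu(1) yv(1)] 1 pow1[OF _ yu(1), of 12] pow1[OF _ yv(1), of 12]
        yu(2) yv(2) by metis
  qed
  moreover have "dId5 K"
    unfolding dId5_def
  proof (intro allI impI)
    fix x :: "nat \<Rightarrow> 'c" assume x: "\<forall>i\<in>{1..3}. x i \<in> carrier K"
    let ?y = "\<lambda>i. y (x i)"
    have yc: "?y i \<in> carrier G" "\<phi> (?y i) = x i" if "i \<in> {1..3}" for i using y x that by auto
    have ip: "in_pow3 K (\<phi> w) (\<phi> z)" if "in_pow3 G w z" "w \<in> carrier G" "z \<in> carrier G" for w z
      using that by (auto simp: in_pow3_def one pow)
    have t1: "in_pow3 K (x i) (x j)" if "i \<in> {1..3}" "j \<in> {1..3}" "in_pow3 G (?y i) (?y j)" for i j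
      using ip[OF that(3)] yc that by simp
    have t2: "in_pow3 K (x i) (x j \<otimes>\<^bsub>K\<^esub> x k)"
      if "i \<in> {1..3}" "j \<in> {1..3}" "k \<in> {1..3}" "in_pow3 G (?y i) (?y j \<otimes> ?y k)" for i j k
      using ip[OF that(4)] yc that by (simp add: hs)
    have t3: "in_pow3 K (x i \<otimes>\<^bsub>K\<^esub> x j) (x j \<otimes>\<^bsub>K\<^esub> x k)"
      if "i \<in> {1..3}" "j \<in> {1..3}" "k \<in> {1..3}" "in_pow3 G (?y i \<otimes> ?y j) (?y j \<otimes> ?y k)" for i j k
      using ip[OF that(4)] yc that by (simp add: hs)
    have th: "theta K x" if "theta G ?y"
      using that[unfolded theta_def]
    proof (elim disjE bexE conjE)
      fix i j assume ij: "i \<in> {1..3}" "j \<in> {1..3}" "i \<noteq> j" "in_pow3 G (?y i) (?y j)"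
      show ?thesis using t1[OF ij(1,2,4)] ij unfolding theta_def by blast
    next
      fix i j k assume ij: "i \<in> {1..3}" "j \<in> {1..3}" "k \<in> {1..3}" "i \<noteq> j" "i \<noteq> k" "j \<noteq> k"
        "in_pow3 G (?y i) (?y j \<otimes> ?y k)"
      show ?thesis using t2[OF ij(1-3,7)] ij unfolding theta_def by blast
    next
      fix i j k assume ij: "i \<in> {1..3}" "j \<in> {1..3}" "k \<in> {1..3}" "i \<noteq> j" "i \<noteq> k" "j \<noteq> k"
        "in_pow3 G (?y i \<otimes> ?y j) (?y j \<otimes> ?y k)"
      show ?thesis using t3[OF ij(1-3,7)] ij unfolding theta_def by blast
    qed
    have 1: "x i [^]\<^bsub>K\<^esub> (15::nat) = \<one>\<^bsub>K\<^esub>" if "i \<in> {1..3}" "?y i [^] (15::nat) = \<one>" for i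
      using pow1[OF that(2)] yc[OF that(1)] by simp
    have 2: "(x i \<otimes>\<^bsub>K\<^esub> x j) [^]\<^bsub>K\<^esub> (15::nat) = \<one>\<^bsub>K\<^esub>" if "i \<in> {1..3}" "j \<in> {1..3}" "(?y i \<otimes> ?y j) [^] (15::nat) = \<one>" for i j
      using pow1[OF that(3)] yc[OF that(1)] yc[OF that(2)] by (simp add: hs)
    have 3: "(x i \<otimes>\<^bsub>K\<^esub> x j [^]\<^bsub>K\<^esub> k) [^]\<^bsub>K\<^esub> (15::nat) = \<one>\<^bsub>K\<^esub>" if "i \<in> {1..3}" "j \<in> {1..3}" "(?y i \<otimes> ?y j [^] k) [^] (15::nat) = \<one>" for i j and k :: nat
      using pow1[OF that(3)] yc[OF that(1)] yc[OF that(2)] by (simp add: hs)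
    have "\<forall>i\<in>{1..3}. ?y i \<in> carrier G" using yc(1) by blast
    then have "theta G ?y \<or> (\<exists>i\<in>{1..3}. ?y i [^] (15::nat) = \<one>) \<or>
      (\<exists>i\<in>{1..3}. \<exists>j\<in>{1..3}. i \<noteq> j \<and> (?y i \<otimes> ?y j) [^] (15::nat) = \<one>) \<or>
      (\<exists>i\<in>{1..3}. \<exists>j\<in>{1..3}. i \<noteq> j \<and> (?y i \<otimes> ?y j [^] (2::nat)) [^] (15::nat) = \<one>) \<or>
      (\<exists>i\<in>{1..3}. \<exists>j\<in>{1..3}. i \<noteq> j \<and> (?y i \<otimes> ?y j [^] (3::nat)) [^] (15::nat) = \<one>)"
      by (rule d(5)[unfolded dId5_def, THEN spec[of _ ?y], THEN mp])
    then show "theta K x \<or> (\<exists>i\<in>{1..3}. x i [^]\<^bsub>K\<^esub> (15::nat) = \<one>\<^bsub>K\<^esub>) \<or>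
      (\<exists>i\<in>{1..3}. \<exists>j\<in>{1..3}. i \<noteq> j \<and> (x i \<otimes>\<^bsub>K\<^esub> x j) [^]\<^bsub>K\<^esub> (15::nat) = \<one>\<^bsub>K\<^esub>) \<or>
      (\<exists>i\<in>{1..3}. \<exists>j\<in>{1..3}. i \<noteq> j \<and> (x i \<otimes>\<^bsub>K\<^esub> x j [^]\<^bsub>K\<^esub> (2::nat)) [^]\<^bsub>K\<^esub> (15::nat) = \<one>\<^bsub>K\<^esub>) \<or>
      (\<exists>i\<in>{1..3}. \<exists>j\<in>{1..3}. i \<noteq> j \<and> (x i \<otimes>\<^bsub>K\<^esub> x j [^]\<^bsub>K\<^esub> (3::nat)) [^]\<^bsub>K\<^esub> (15::nat) = \<one>\<^bsub>K\<^esub>)"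
    proof (elim disjE bexE conjE)
      assume "theta G ?y"
      then show ?thesis using th by blast
    next
      fix i assume i: "i \<in> {1..3}" and e: "?y i [^] (15::nat) = \<one>"
      show ?thesis using 1[OF i e] i by blast
    next
      fix i j assume ij: "i \<in> {1..3}" "j \<in> {1..3}" and l: "i \<noteq> j" and e: "(?y i \<otimes> ?y j) [^] (15::nat) = \<one>"
      show ?thesis using 2[OF ij e] ij l by blast
    next
      fix i j assume ij: "i \<in> {1..3}" "j \<in> {1..3}" and l: "i \<noteq> j" and e: "(?y i \<otimes> ?y j [^] (2::nat)) [^] (15::nat) = \<one>"
      show ?thesis using 3[OF ij e] ij l by blast
    next
      fix i j assume ij: "i \<in> {1..3}" "j \<in> {1..3}" and l: "i \<noteq> j" and e: "(?y i \<otimes> ?y j [^] (3::nat)) [^] (15::nat) = \<one>"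
      show ?thesis using 3[OF ij e] ij l by blast
    qed
  qed
  ultimately show ?thesis by (simp add: A6_basis_def)
qed

lemma good_cayley:
  assumes "group G" "A6_basis G" shows "good (cayley G ` carrier G)"
proof -
  interpret group G by fact
  have "sgp (cayley G ` carrier G)"
  proof (rule sgp_finite_closed)
    show "finite (cayley G ` carrier G)" using dId1_finite assms(2) by (auto simp: A6_basis_def)
    show "cayley G ` carrier G \<noteq> {}" by blast
    fix x y assume "x \<in> cayley G ` carrier G" "y \<in> cayley G ` carrier G"
    then show "x * y \<in> cayley G ` carrier G" by (auto simp flip: cayley_mult[OF assms(1)])
  qed
  then show ?thesis
    using A6_basis_hom_image[OF assms(1) group_group_of assms(2), of _ "cayley G"] cayley_mult[OF assms(1)]
    by (simp add: good_def)
qed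

section \<open>Embeddings as sections\<close>

lemma section_of_embedding:
  assumes G: "group G" and A: "group A" and f: "f \<in> hom G A" "inj_on f (carrier G)"
  shows "is_section_of G A"
proof -
  let ?L = "A\<lparr>carrier := f ` carrier G\<rparr>"
  interpret f: group_hom G A f using G A f(1) by (simp add: group_hom_def group_hom_axioms_def)
  have K: "subgroup (f ` carrier G) A" by (rule f.img_is_subgroup)
  have L: "group ?L" using group.subgroup_imp_group[OF A K] .
  have "f \<in> iso G ?L" using f by (auto simp: iso_def hom_def bij_betw_def)
  then have GL: "G \<cong> ?L" by (auto simp: is_iso_def)
  have N: "normal {\<one>\<^bsub>A\<^esub>} ?L" using group.one_is_normal[OF L] by simp
  have "?L Mod {\<one>\<^bsub>A\<^esub>} \<cong> ?L" using group.trivial_factor_iso[OF L] by (auto simp: is_iso_def)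
  then have "?L \<cong> ?L Mod {\<one>\<^bsub>A\<^esub>}"
    using group.iso_sym[OF normal.factorgroup_is_group[OF N]] by blast
  then have "G \<cong> ?L Mod {\<one>\<^bsub>A\<^esub>}" using iso_trans[OF GL] by blast
  then show ?thesis using K N unfolding is_section_of_def by blast
qed

text \<open>Order 360 is where the first hypothesis enters: the Cayley image of
  \<open>alt_group 6\<close> is then \<open>good\<close> and of order 360 as well, so
  \<open>order_360_unique\<close> identifies the two.\<close>

lemma section_of_A6:
  fixes G :: "('a, 'b) monoid_scheme" (structure)
  assumes "A6_basis (alt_group 6)" "group G" "A6_basis G"
  shows "is_section_of G (alt_group 6)"
proof -
  let ?A = "alt_group 6"
  interpret group G by fact
  let ?H = "cayley G ` carrier G" and ?H' = "cayley ?A ` carrier ?A"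
  have A: "group ?A" by (rule alt_group_is_group)
  note g = good_cayley[OF assms(2,3)] and g' = good_cayley[OF A assms(1)]
  have "\<exists>f\<in>hom G ?A. inj_on f (carrier G)"
  proof (cases "card ?H = 360")
    case True
    have "2 * card (carrier ?A) = 720" using alt_group_card_carrier[of 6] by (simp add: fact_numeral)
    then have "card ?H' = 360" using card_image[OF inj_cayley[OF A]] by simp
    then obtain \<psi> where \<psi>: "is_emb \<psi> ?H" "\<psi> ` ?H = ?H'" using order_360_unique[OF g True g'] by blast
    define f where "f = (\<lambda>x. inv_into (carrier ?A) (cayley ?A) (\<psi> (cayley G x)))"
    have f: "f x \<in> carrier ?A" "cayley ?A (f x) = \<psi> (cayley G x)" if "x \<in> carrier G" for x
    proof -
      have "\<psi> (cayley G x) \<in> ?H'" using \<psi>(2) that by blast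
      then show "f x \<in> carrier ?A" "cayley ?A (f x) = \<psi> (cayley G x)"
        by (simp_all add: f_def inv_into_into f_inv_into_f)
    qed
    have "f (x \<otimes> y) = f x \<otimes>\<^bsub>?A\<^esub> f y" if xy: "x \<in> carrier G" "y \<in> carrier G" for x y
    proof (rule inj_onD[OF inj_cayley[OF A]])
      show "cayley ?A (f (x \<otimes> y)) = cayley ?A (f x \<otimes>\<^bsub>?A\<^esub> f y)"
        using xy f \<psi>(1) by (simp add: cayley_mult[OF A] cayley_mult[OF assms(2)] is_emb_def)
      show "f (x \<otimes> y) \<in> carrier ?A" "f x \<otimes>\<^bsub>?A\<^esub> f y \<in> carrier ?A"
        using xy f(1) monoid.m_closed[OF group.is_monoid[OF A]] by simp_all
    qed
    moreover have "inj_on f (carrier G)"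
    proof
      fix x y assume xy: "x \<in> carrier G" "y \<in> carrier G" "f x = f y"
      then have "\<psi> (cayley G x) = \<psi> (cayley G y)" using f(2) by metis
      then have "cayley G x = cayley G y" using \<psi>(1) xy(1,2) by (auto simp: is_emb_def dest: inj_onD)
      then show "x = y" using inj_onD[OF inj_cayley[OF assms(2)]] xy by blast
    qed
    ultimately show ?thesis using f(1) by (intro bexI[of _ f]) (auto simp: hom_def)
  next
    case False
    then obtain \<psi> where \<psi>: "is_emb \<psi> ?H" "\<psi> ` ?H \<subseteq> A6_bij" using embeds_if_not_360[OF g] unfolding embeds_A6_def by blast
    define f where "f = (\<lambda>x. apply_bij (\<psi> (cayley G x)))"
    have "f (x \<otimes> y) = f x \<circ> f y" if "x \<in> carrier G" "y \<in> carrier G" for x y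
      using that \<psi>(1) by (simp add: f_def cayley_mult[OF assms(2)] is_emb_def apply_bij_mult)
    moreover have "f x \<in> carrier ?A" if "x \<in> carrier G" for x
      using \<psi>(2) that by (auto simp: f_def A6_bij_def alt_group_carrier)
    moreover have "inj_on f (carrier G)"
    proof
      fix x y assume xy: "x \<in> carrier G" "y \<in> carrier G" "f x = f y"
      then have "cayley G x = cayley G y" using \<psi>(1) by (auto simp: f_def apply_bij_inject is_emb_def dest: inj_onD)
      then show "x = y" using inj_onD[OF inj_cayley[OF assms(2)]] xy by blast
    qed
    ultimately show ?thesis by (intro bexI[of _ f]) (auto simp: hom_def alt_group_mult)
  qed
  then show ?thesis using section_of_embedding[OF assms(2) A] by blast
qed

subsection \<open>The identities hold in the alternating group\<close>

text \<open>Constructor terms for permutations of six points, so that products and equality are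
  evaluated by rewriting in the finite checks.\<close>

datatype point = P1 | P2 | P3 | P4 | P5 | P6
datatype table = T point point point point point point

fun app :: "table \<Rightarrow> point \<Rightarrow> point" where
  "app (T a b c d e f) P1 = a" | "app (T a b c d e f) P2 = b" | "app (T a b c d e f) P3 = c"
| "app (T a b c d e f) P4 = d" | "app (T a b c d e f) P5 = e" | "app (T a b c d e f) P6 = f"

fun table_comp :: "table \<Rightarrow> table \<Rightarrow> table" where
  "table_comp p (T a b c d e f) = T (app p a) (app p b) (app p c) (app p d) (app p e) (app p f)"

definition point_of :: "nat \<Rightarrow> point" where
  "point_of n = (if n = 1 then P1 else if n = 2 then P2 else if n = 3 then P3 else if n = 4 then P4
    else if n = 5 then P5 else P6)"

fun nat_of :: "point \<Rightarrow> nat" where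
  "nat_of P1 = 1" | "nat_of P2 = 2" | "nat_of P3 = 3" | "nat_of P4 = 4" | "nat_of P5 = 5" | "nat_of P6 = 6"

definition points :: "point list" where "points = [P1, P2, P3, P4, P5, P6]"

definition table_of :: "(nat \<Rightarrow> nat) \<Rightarrow> table" where
  "table_of f = T (point_of (f 1)) (point_of (f 2)) (point_of (f 3)) (point_of (f 4)) (point_of (f 5)) (point_of (f 6))"

lemma nat_6_cases: "k \<in> {1..6} \<longleftrightarrow> k \<in> {1,2,3,4,5,6::nat}"
  by auto

lemma nat_of_point_of: "k \<in> {1..6} \<Longrightarrow> nat_of (point_of k) = k"
  unfolding nat_6_cases by (auto simp: point_of_def)

lemma point_of_nat_of [simp]: "point_of (nat_of x) = x"
  by (cases x) (simp_all add: point_of_def)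

lemma nat_of_range: "nat_of x \<in> {1..6}"
  by (cases x) simp_all

lemma app_table_of: "app (table_of f) x = point_of (f (nat_of x))"
  by (cases x) (simp_all add: table_of_def)

lemma table_eqI: "(\<And>x. app p x = app q x) \<Longrightarrow> p = q"
  by (cases p; cases q) (metis app.simps)

lemma app_comp [simp]: "app (table_comp p q) x = app p (app q x)"
  by (cases q; cases x) simp_all

lemma table_of_comp:
  assumes "g permutes {1..6}" shows "table_of (f \<circ> g) = table_comp (table_of f) (table_of g)"
proof (rule table_eqI)
  fix x
  have "g (nat_of x) \<in> {1..6}" using permutes_in_image[OF assms] nat_of_range by blast
  then show "app (table_of (f \<circ> g)) x = app (table_comp (table_of f) (table_of g)) x"
    by (simp add: app_table_of nat_of_point_of)
qed

lemma table_of_inject: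
  assumes "f permutes {1..6}" "g permutes {1..6}" "table_of f = table_of g" shows "f = g"
proof
  fix k
  show "f k = g k"
  proof (cases "k \<in> {1..6}")
    case True
    have "point_of (f k) = point_of (g k)"
      using app_table_of[of f "point_of k"] app_table_of[of g "point_of k"] assms(3) nat_of_point_of[OF True] by simp
    moreover have "f k \<in> {1..6}" "g k \<in> {1..6}" using permutes_in_image assms(1,2) True by metis+
    ultimately show ?thesis by (metis nat_of_point_of)
  qed (use assms permutes_not_in in metis)
qed

definition identity_table :: table where "identity_table = T P1 P2 P3 P4 P5 P6"

lemma table_of_id: "table_of id = identity_table"
  by (simp add: table_of_def identity_table_def point_of_def)

lemma app_identity_table [simp]: "app identity_table x = x"
  by (cases x) (simp_all add: identity_table_def)

definition swap_point :: "point \<Rightarrow> point \<Rightarrow> point \<Rightarrow> point" where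
  "swap_point a b c = (if c = a then b else if c = b then a else c)"

definition swap_table :: "point \<Rightarrow> point \<Rightarrow> table" where
  "swap_table a b = T (swap_point a b P1) (swap_point a b P2) (swap_point a b P3)
     (swap_point a b P4) (swap_point a b P5) (swap_point a b P6)"

lemma app_swap_table: "app (swap_table a b) x = swap_point a b x"
  by (cases x) (simp_all add: swap_table_def)

lemma table_of_transpose: "table_of (transpose (nat_of a) (nat_of b)) = swap_table a b"
proof (rule table_eqI)
  fix x
  have "nat_of x = nat_of y \<longleftrightarrow> x = y" for y by (metis point_of_nat_of)
  then show "app (table_of (transpose (nat_of a) (nat_of b))) x = app (swap_table a b) x"
    by (simp add: app_table_of app_swap_table swap_point_def transpose_def)
qed

text \<open>The even permutations of the given points, and the odd ones.\<close>
fun parity_tables :: "point list \<Rightarrow> table list \<times> table list" where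
  "parity_tables [] = ([identity_table], [])"
| "parity_tables (a # as) = (case parity_tables as of (E, D) \<Rightarrow>
     (E @ concat (map (\<lambda>b. map (table_comp (swap_table a b)) D) as), D @ concat (map (\<lambda>b. map (table_comp (swap_table a b)) E) as)))"

text \<open>A permutation of \<open>a # as\<close> is a permutation of \<open>as\<close>, possibly
  followed by a transposition of \<open>a\<close> with a point of \<open>as\<close>, which changes
  the sign. Hence even and odd permutations are listed by one simultaneous recursion.\<close>

lemma table_of_parity_tables:
  assumes "f permutes nat_of ` set as"
  shows "(evenperm f \<longrightarrow> table_of f \<in> set (fst (parity_tables as))) \<and>
    (\<not> evenperm f \<longrightarrow> table_of f \<in> set (snd (parity_tables as)))"
  using assms
proof (induct as arbitrary: f)
  case Nil
  then have f: "f = id" by simp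
  show ?case unfolding f table_of_id using evenperm_id by simp
next
  case (Cons a as)
  obtain E D where ED: "parity_tables as = (E, D)" by fastforce
  have "f \<in> {p. p permutes insert (nat_of a) (nat_of ` set as)}" using Cons(2) by simp
  then obtain b q where bq: "b \<in> insert (nat_of a) (nat_of ` set as)" "q permutes nat_of ` set as"
      "f = transpose (nat_of a) b \<circ> q"
    unfolding permutes_insert by auto
  have q6: "q permutes {1..6}" using bq(2) by (rule permutes_subset) (use nat_of_range in blast)
  have pq: "permutation q" using bq(2) by (auto simp: permutation_permutes)
  show ?case
  proof (cases "b = nat_of a")
    case True
    then have "f = q" using bq(3) by simp
    then show ?thesis using Cons(1)[OF bq(2)] ED by auto
  next
    case False
    then obtain c where c: "c \<in> set as" "b = nat_of c" using bq(1) by auto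
    have t: "table_of f = table_comp (swap_table a c) (table_of q)"
      unfolding bq(3) c(2) table_of_comp[OF q6] table_of_transpose ..
    have "evenperm f \<longleftrightarrow> \<not> evenperm q"
      using False pq by (simp add: bq(3) evenperm_comp permutation_swap_id evenperm_swap)
    then show ?thesis using Cons(1)[OF bq(2)] ED c(1) t by auto
  qed
qed

definition even_tables :: "table list" where "even_tables = fst (parity_tables points)"

abbreviation tab :: "nat bij \<Rightarrow> table" where "tab x \<equiv> table_of (apply_bij x)"

definition S6_bij :: "nat bij set" where "S6_bij = {g. apply_bij g permutes {1..6}}"

lemma A6_subset_S6: "A6_bij \<subseteq> S6_bij"
  by (auto simp: A6_bij_def S6_bij_def)

lemma tab_even: "x \<in> A6_bij \<Longrightarrow> tab x \<in> set even_tables"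
proof -
  assume x: "x \<in> A6_bij"
  have "nat_of ` set points = {1..6}" unfolding set_eq_iff nat_6_cases by (auto simp: points_def)
  then show ?thesis
    using table_of_parity_tables[of "apply_bij x" points] x by (simp add: A6_bij_def even_tables_def)
qed

lemma tab_mult: "y \<in> S6_bij \<Longrightarrow> tab (x * y) = table_comp (tab x) (tab y)"
  by (simp add: S6_bij_def apply_bij_mult table_of_comp)

lemma tab_one: "tab 1 = identity_table"
  by (simp add: apply_bij_one table_of_id)

lemma tab_inject: "x \<in> S6_bij \<Longrightarrow> y \<in> S6_bij \<Longrightarrow> tab x = tab y \<Longrightarrow> x = y"
  using table_of_inject by (auto simp: S6_bij_def apply_bij_inject[symmetric])

lemma S6_closed: "1 \<in> S6_bij" "x \<in> S6_bij \<Longrightarrow> y \<in> S6_bij \<Longrightarrow> x * y \<in> S6_bij" "x \<in> S6_bij \<Longrightarrow> inverse x \<in> S6_bij"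
  by (auto simp: S6_bij_def apply_bij_one apply_bij_mult apply_bij_inverse permutes_id permutes_compose permutes_inv)

lemma conj_A6: assumes "g \<in> S6_bij" "x \<in> A6_bij" shows "conj_by g x \<in> A6_bij"
proof -
  have "permutation (apply_bij g)" "permutation (apply_bij x)"
    using assms by (auto simp: S6_bij_def A6_bij_def permutes_imp_permutation_nat)
  then have "evenperm (apply_bij (conj_by g x))"
    using assms(2) by (simp add: apply_bij_mult apply_bij_inverse evenperm_comp evenperm_inv permutation_compose
        permutation_inverse A6_bij_def)
  moreover have "conj_by g x \<in> S6_bij" using assms A6_subset_S6 S6_closed by blast
  ultimately show ?thesis by (simp add: A6_bij_def S6_bij_def)
qed

lemma exists_tab:
  assumes "distinct [a, b, c, d, e, f]"
  obtains g where "g \<in> S6_bij" "tab g = T a b c d e f"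
proof -
  let ?p = "T a b c d e f"
  have inj: "x = y" if "app ?p x = app ?p y" for x y
    using that assms by (cases x; cases y) auto
  define h where "h = (\<lambda>k. if k \<in> {1..6} then nat_of (app ?p (point_of k)) else k)"
  have hr: "h k \<in> {1..6}" if "k \<in> {1..6}" for k using that nat_of_range by (simp add: h_def)
  have "inj_on h {1..6}"
  proof
    fix k l assume kl: "k \<in> {1..6}" "l \<in> {1..6}" "h k = h l"
    then have "app ?p (point_of k) = app ?p (point_of l)" unfolding h_def by (metis point_of_nat_of)
    then have "point_of k = point_of l" by (rule inj)
    then show "k = l" using kl nat_of_point_of by metis
  qed
  moreover then have "h ` {1..6} = {1..6}" using hr by (intro endo_inj_surj) auto
  ultimately have h: "h permutes {1..6}" by (intro bij_imp_permutes) (auto simp: bij_betw_def h_def)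
  have ah: "apply_bij (Bij h) = h" using permutes_bij[OF h] by (rule apply_Bij)
  have "tab (Bij h) = ?p"
    unfolding ah by (rule table_eqI) (simp only: app_table_of h_def nat_of_range if_True point_of_nat_of)
  moreover have "Bij h \<in> S6_bij" using h ah by (simp add: S6_bij_def)
  ultimately show thesis using that by blast
qed

text \<open>Four images after the starting point are enough, because an even permutation of six
  points has no cycle of length 6.\<close>

definition cycle_of :: "table \<Rightarrow> point \<Rightarrow> point list" where
  "cycle_of p a = a # takeWhile (\<lambda>x. x \<noteq> a)
     [app p a, app p (app p a), app p (app p (app p a)), app p (app p (app p (app p a)))]"

text \<open>A point with \<open>app p (app p x) \<noteq> x\<close> lies on a cycle of length at
  least 3; starting there puts a 4-cycle before a 2-cycle. The final \<open>points\<close> keeps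
  \<open>hd\<close> defined for the identity.\<close>

definition first_cycle :: "table \<Rightarrow> point list" where
  "first_cycle p = cycle_of p (hd (filter (\<lambda>x. app p (app p x) \<noteq> x) points @ filter (\<lambda>x. app p x \<noteq> x) points @ points))"

fun second_cycle :: "table \<Rightarrow> point list \<Rightarrow> point list" where
  "second_cycle p [] = []" | "second_cycle p (c # cs) = cycle_of p c"

text \<open>The points in the order of the cycles of \<open>p\<close>, the longest cycle first; as a permutation this
  list conjugates a representative of its cycle type to \<open>p\<close>.\<close>
definition cycle_order :: "table \<Rightarrow> point list" where
  "cycle_order p = (\<lambda>c1. (\<lambda>c2. c1 @ c2 @ filter (\<lambda>x. x \<notin> set (c1 @ c2)) points)
     (second_cycle p (filter (\<lambda>x. x \<notin> set c1 \<and> app p x \<noteq> x) points))) (first_cycle p)"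

text \<open>The nontrivial cycle types of even permutations of six points. Conjugation is taken in
  the symmetric group, where each type is a single class; in the alternating group the 5-cycles
  split into two.\<close>

definition "rep_22 = T P2 P1 P4 P3 P5 P6"
definition "rep_3 = T P2 P3 P1 P4 P5 P6"
definition "rep_33 = T P2 P3 P1 P5 P6 P4"
definition "rep_42 = T P2 P3 P4 P1 P6 P5"
definition "rep_5 = T P2 P3 P4 P5 P1 P6"
definition "reps = [rep_22, rep_3, rep_33, rep_42, rep_5]"

fun conjugates_rep :: "table \<Rightarrow> point list \<Rightarrow> bool" where
  "conjugates_rep p [a, b, c, d, e, f] \<longleftrightarrow> distinct [a, b, c, d, e, f] \<and>
     list_ex (\<lambda>r. table_comp p (T a b c d e f) = table_comp (T a b c d e f) r) reps"
| "conjugates_rep p _ \<longleftrightarrow> False"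

lemma conjugates_rep_even: "list_all (\<lambda>p. p = identity_table \<or> conjugates_rep p (cycle_order p)) even_tables"
  by code_simp

lemma conjugate_to_rep:
  assumes x: "x \<in> A6_bij" "x \<noteq> 1"
  obtains g r where "g \<in> S6_bij" "r \<in> A6_bij" "tab r \<in> set reps" "x = conj_by g r"
proof -
  have xS: "x \<in> S6_bij" using x A6_subset_S6 by blast
  have "tab x \<noteq> identity_table" using tab_inject[OF xS S6_closed(1)] tab_one x(2) by metis
  then have "conjugates_rep (tab x) (cycle_order (tab x))"
    using conjugates_rep_even tab_even[OF x(1)] by (auto simp: list_all_iff)
  then obtain a b c d e f where l: "conjugates_rep (tab x) [a, b, c, d, e, f]"
    by (elim conjugates_rep.elims(2)) auto
  obtain g where g: "g \<in> S6_bij" "tab g = T a b c d e f" by (rule exists_tab[of a b c d e f]) (use l in auto)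
  obtain r0 where r0: "r0 \<in> set reps" "table_comp (tab x) (tab g) = table_comp (tab g) r0"
    using l g(2) by (auto simp: list_ex_iff)
  define r where "r = conj_by (inverse g) x"
  have rA: "r \<in> A6_bij" unfolding r_def using g x(1) S6_closed(3) conj_A6 by blast
  have rS: "r \<in> S6_bij" using rA A6_subset_S6 by blast
  have xr: "x = conj_by g r" by (simp add: r_def mult.assoc)
  have "g * r = x * g" by (simp add: r_def mult.assoc)
  then have "table_comp (tab g) (tab r) = table_comp (tab g) r0" using tab_mult[OF rS, of g] tab_mult[OF g(1), of x] r0(2) by simp
  then have "table_comp (tab (inverse g)) (table_comp (tab g) (tab r)) = table_comp (tab (inverse g)) (table_comp (tab g) r0)" by simp
  \<comment> \<open>Cancels \<open>tab g\<close> on the left, which identifies the table of the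
    bijection \<open>r\<close> with the representative \<open>r0\<close>.\<close>
  moreover have "table_comp (tab (inverse g)) (table_comp (tab g) q) = q" for q
  proof -
    have "table_comp (tab (inverse g)) (tab g) = identity_table" using tab_mult[OF g(1), of "inverse g"] tab_one by simp
    moreover have "table_comp (table_comp u v) w = table_comp u (table_comp v w)" "table_comp identity_table w = w" for u v w
      by (rule table_eqI, simp)+
    ultimately show ?thesis by metis
  qed
  ultimately have "tab r = r0" by simp
  then show thesis using that[OF g(1) rA _ xr] r0(1) by simp
qed

section \<open>Executable forms of the identities\<close>

definition "is_pow2 p \<longleftrightarrow> table_comp p p = identity_table"
definition "is_pow3 p \<longleftrightarrow> table_comp p (table_comp p p) = identity_table"
definition "is_pow4 p \<longleftrightarrow> is_pow2 (table_comp p p)"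
definition "is_pow5 p \<longleftrightarrow> (\<lambda>q. table_comp p (table_comp q q) = identity_table) (table_comp p p)"
definition "odd_order p \<longleftrightarrow> is_pow3 p \<or> is_pow5 p"

lemma tab_pow:
  assumes "x \<in> S6_bij"
  shows "is_pow2 (tab x) \<longleftrightarrow> x ^ 2 = 1" "is_pow3 (tab x) \<longleftrightarrow> x ^ 3 = 1"
    "is_pow4 (tab x) \<longleftrightarrow> x ^ 4 = 1" "is_pow5 (tab x) \<longleftrightarrow> x ^ 5 = 1"
proof -
  have one: "tab y = identity_table \<longleftrightarrow> y = 1" if "y \<in> S6_bij" for y
    using tab_inject[OF that S6_closed(1)] tab_one by metis
  note s = one tab_mult[symmetric] S6_closed assms
  show "is_pow2 (tab x) \<longleftrightarrow> x ^ 2 = 1" "is_pow3 (tab x) \<longleftrightarrow> x ^ 3 = 1"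
    "is_pow4 (tab x) \<longleftrightarrow> x ^ 4 = 1" "is_pow5 (tab x) \<longleftrightarrow> x ^ 5 = 1"
    by (simp_all add: is_pow2_def is_pow3_def is_pow4_def is_pow5_def s eval_nat_numeral mult.assoc)
qed

lemma pow_multiple: "x ^ m = 1 \<Longrightarrow> m dvd n \<Longrightarrow> x ^ n = (1::'a::monoid_mult)"
  by (auto simp: power_mult)

lemma even_orders: "list_all (\<lambda>p. is_pow3 p \<or> is_pow4 p \<or> is_pow5 p) even_tables"
  by code_simp

definition "pow3_table p = table_comp p (table_comp p p)"

definition check4 :: "table \<Rightarrow> table \<Rightarrow> table \<Rightarrow> table \<Rightarrow> bool" where
  "check4 r r2 r3 p \<longleftrightarrow> is_pow2 p \<or> odd_order p \<or> odd_order (table_comp p r) \<or> odd_order (table_comp p r2) \<or> odd_order (table_comp p r3)"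

text \<open>The inner variable \<open>c\<close> is \<open>p\<close> conjugated by the inverse of
  \<open>r\<close>; as \<open>r\<close> has order 4 in use, \<open>r3\<close> serves as that
  inverse. The three pairs of tests belong to the three words of (6).\<close>

definition check6 :: "table \<Rightarrow> table \<Rightarrow> table \<Rightarrow> bool" where
  "check6 r r3 p \<longleftrightarrow> is_pow3 p \<or> is_pow4 p \<or>
     (\<lambda>c. is_pow3 (table_comp p c) \<or> is_pow4 (table_comp p c) \<or>
       is_pow3 (table_comp p (pow3_table c)) \<or> is_pow4 (table_comp p (pow3_table c)) \<or>
       is_pow3 (table_comp (table_comp p p) c) \<or> is_pow4 (table_comp (table_comp p p) c)) (table_comp r3 (table_comp p r))"

definition check7 :: "table list \<Rightarrow> table \<Rightarrow> bool" where
  "check7 rs p \<longleftrightarrow> is_pow3 p \<or> is_pow4 p \<or> list_ex (\<lambda>r. (\<lambda>q. is_pow3 q \<or> is_pow4 q) (table_comp p r)) rs"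

text \<open>The possible values of the nine variables in a counterexample to (3) whose first
  variable is \<open>r\<close>; the disjunct \<open>p = r\<close> admits that variable
  itself.\<close>

definition near3 :: "table \<Rightarrow> table \<Rightarrow> bool" where
  "near3 r p \<longleftrightarrow> p = r \<or> \<not> is_pow4 p \<and> \<not> is_pow5 p \<and>
     (\<lambda>q. \<not> is_pow4 q \<and> \<not> is_pow5 q) (table_comp r p) \<and> (\<lambda>q. \<not> is_pow4 q \<and> \<not> is_pow5 q) (table_comp r (table_comp p p))"

definition in_pow3_table :: "table \<Rightarrow> table \<Rightarrow> bool" where
  "in_pow3_table p q \<longleftrightarrow> p = identity_table \<or> p = q \<or> p = table_comp q q \<or> p = pow3_table q"

text \<open>The pairs for which all two-variable disjuncts of (5) fail, including those inside
  \<open>theta\<close>.\<close>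

definition even_pair :: "table \<Rightarrow> table \<Rightarrow> bool" where
  "even_pair p q \<longleftrightarrow> \<not> odd_order (table_comp p q) \<and> \<not> odd_order (table_comp p (table_comp q q)) \<and> \<not> odd_order (table_comp p (pow3_table q)) \<and>
     \<not> odd_order (table_comp q p) \<and> \<not> odd_order (table_comp q (table_comp p p)) \<and> \<not> odd_order (table_comp q (pow3_table p)) \<and>
     \<not> in_pow3_table p q \<and> \<not> in_pow3_table q p"

text \<open>Only the disjuncts of \<open>theta\<close> in three variables; those in two are part of
  \<open>even_pair\<close>.\<close>

definition theta_table :: "table \<Rightarrow> table \<Rightarrow> table \<Rightarrow> bool" where
  "theta_table a b c \<longleftrightarrow>
     in_pow3_table a (table_comp b c) \<or> in_pow3_table a (table_comp c b) \<or> in_pow3_table b (table_comp a c) \<or>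
     in_pow3_table b (table_comp c a) \<or> in_pow3_table c (table_comp a b) \<or> in_pow3_table c (table_comp b a) \<or>
     in_pow3_table (table_comp a b) (table_comp b c) \<or> in_pow3_table (table_comp a c) (table_comp c b) \<or> in_pow3_table (table_comp b a) (table_comp a c) \<or>
     in_pow3_table (table_comp b c) (table_comp c a) \<or> in_pow3_table (table_comp c a) (table_comp a b) \<or> in_pow3_table (table_comp c b) (table_comp b a)"

text \<open>In use, \<open>ps\<close> holds the elements compatible with \<open>r\<close> in the
  sense of \<open>even_pair\<close>, so the search runs over pairs from a filtered list.\<close>

definition check5 :: "table \<Rightarrow> table list \<Rightarrow> bool" where
  "check5 r ps \<longleftrightarrow> list_all (\<lambda>p. list_all (\<lambda>q. even_pair p q \<longrightarrow> theta_table r p q) ps) ps"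

text \<open>In turn for (4) and (6), for (7), for (3), and for (5): apart from the named ones, the
  representatives satisfy a one-variable disjunct, so only the named ones enter the searches
  below.\<close>

lemma check_reps:
  "list_all (\<lambda>r. r = rep_42 \<or> is_pow2 r \<or> is_pow3 r \<or> is_pow5 r) reps"
  "list_all (\<lambda>r. r = rep_5 \<or> is_pow3 r \<or> is_pow4 r) reps"
  "list_all (\<lambda>r. r = rep_3 \<or> r = rep_33 \<or> is_pow4 r \<or> is_pow5 r) reps"
  "list_all (\<lambda>r. r = rep_22 \<or> r = rep_42 \<or> odd_order r) reps"
  by code_simp+

lemma check4_even: "list_all (check4 rep_42 (table_comp rep_42 rep_42) (pow3_table rep_42)) even_tables"
  by code_simp

lemma check6_even: "list_all (check6 rep_42 (pow3_table rep_42)) even_tables"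
  by code_simp

lemma check7_even: "list_all (check7 [rep_5, table_comp rep_5 rep_5, pow3_table rep_5, table_comp rep_5 (pow3_table rep_5)]) even_tables"
  by code_simp

text \<open>With fewer than nine candidates, (3) cannot fail at nine distinct values.\<close>

lemma near3_even: "length (filter (near3 rep_3) even_tables) \<le> 8" "length (filter (near3 rep_33) even_tables) \<le> 8"
  by code_simp+

lemma check5_even:
  "check5 rep_22 (filter (\<lambda>p. \<not> odd_order p \<and> even_pair rep_22 p) even_tables)"
  "check5 rep_42 (filter (\<lambda>p. \<not> odd_order p \<and> even_pair rep_42 p) even_tables)"
  by code_simp+

section \<open>From the table checks to the identities\<close>

lemma conj_by_power_eq_1: "conj_by g x ^ n = 1 \<longleftrightarrow> x ^ n = 1"
  using conj_by_eq_iff[of g "x ^ n" 1] by (simp add: conj_by_power)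

text \<open>Conjugating all variables by one \<open>g\<close> preserves the truth of an identity and
  membership in \<open>A6_bij\<close>, so one variable may be taken to be a representative.\<close>

lemma rep_A6:
  assumes x: "x \<in> A6_bij" "x \<noteq> 1"
  obtains g r where "g \<in> S6_bij" "r \<in> A6_bij" "tab r \<in> set reps" "x = conj_by g r"
    "\<And>y. y \<in> A6_bij \<Longrightarrow> \<exists>y'\<in>A6_bij. y = conj_by g y'"
proof -
  obtain g r where gr: "g \<in> S6_bij" "r \<in> A6_bij" "tab r \<in> set reps" "x = conj_by g r" using conjugate_to_rep[OF x] .
  have "\<exists>y'\<in>A6_bij. y = conj_by g y'" if "y \<in> A6_bij" for y
  proof
    show "conj_by (inverse g) y \<in> A6_bij" using conj_A6[OF S6_closed(3)[OF gr(1)] that] .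
    show "y = conj_by g (conj_by (inverse g) y)" by (simp add: mult.assoc)
  qed
  then show thesis using that gr by blast
qed

lemma A6_S6: "x \<in> A6_bij \<Longrightarrow> x \<in> S6_bij"
  using A6_subset_S6 by blast

lemmas A6_tab_pow = tab_pow[OF A6_S6]

lemma odd_order_15: "x \<in> A6_bij \<Longrightarrow> odd_order (tab x) \<Longrightarrow> x ^ 15 = 1"
  unfolding odd_order_def A6_tab_pow using pow_multiple[of x 3 15] pow_multiple[of x 5 15] by auto

lemma even_order_30: "x \<in> A6_bij \<Longrightarrow> is_pow2 (tab x) \<or> odd_order (tab x) \<Longrightarrow> x ^ 30 = 1"
  unfolding odd_order_def A6_tab_pow using pow_multiple[of x 2 30] pow_multiple[of x 3 30] pow_multiple[of x 5 30] by auto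

lemma not_5_12: "x \<in> A6_bij \<Longrightarrow> is_pow3 (tab x) \<or> is_pow4 (tab x) \<Longrightarrow> x ^ 12 = 1"
  unfolding A6_tab_pow using pow_multiple[of x 3 12] pow_multiple[of x 4 12] by auto

lemma not_3_20: "x \<in> A6_bij \<Longrightarrow> is_pow4 (tab x) \<or> is_pow5 (tab x) \<Longrightarrow> x ^ 20 = 1"
  unfolding A6_tab_pow using pow_multiple[of x 4 20] pow_multiple[of x 5 20] by auto

lemma A6_tab_mult: "y \<in> A6_bij \<Longrightarrow> tab (x * y) = table_comp (tab x) (tab y)"
  by (rule tab_mult[OF A6_S6])

lemma A6_tab_square: "x \<in> A6_bij \<Longrightarrow> tab (x ^ 2) = table_comp (tab x) (tab x)"
  by (simp add: power2_eq_square A6_tab_mult)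

lemma A6_tab_cube: "x \<in> A6_bij \<Longrightarrow> tab (x ^ 3) = pow3_table (tab x)"
  by (simp add: power3_eq_cube A6_tab_mult pow3_table_def sgpD(3)[OF sgp_A6_bij] mult.assoc)

lemmas A6_tab = A6_tab_mult A6_tab_square A6_tab_cube sgpD(3,4)[OF sgp_A6_bij] sgp_power[OF sgp_A6_bij]

lemma A6_dId2: "dId2 (group_of A6_bij)"
  unfolding dId2_def group_of_simps pow_group_of
proof
  fix x assume x: "x \<in> A6_bij"
  then show "x ^ 3 = 1 \<or> x ^ 4 = 1 \<or> x ^ 5 = 1"
    using even_orders tab_even[OF x] by (auto simp: list_all_iff A6_tab_pow)
qed

lemma A6_dId4: "dId4 (group_of A6_bij)"
  unfolding dId4_def group_of_simps pow_group_of
proof (intro ballI)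
  fix x y assume xy: "x \<in> A6_bij" "y \<in> A6_bij"
  show "x ^ 30 = 1 \<or> y ^ 30 = 1 \<or> (x * y) ^ 15 = 1 \<or> (x * y ^ 2) ^ 15 = 1 \<or> (x * y ^ 3) ^ 15 = 1"
  proof (cases "y = 1")
    case False
    obtain g r where g: "r \<in> A6_bij" "tab r \<in> set reps" "y = conj_by g r"
      "\<And>z. z \<in> A6_bij \<Longrightarrow> \<exists>z'\<in>A6_bij. z = conj_by g z'" using rep_A6[OF xy(2) False] by metis
    obtain p where p: "p \<in> A6_bij" "x = conj_by g p" using g(4)[OF xy(1)] by blast
    show ?thesis
    \<comment> \<open>Elements conjugate to \<open>rep_42\<close> are those of order 4; for the
      other representatives the disjunct \<open>y ^ 30 = 1\<close> holds.\<close>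
    proof (cases "tab r = rep_42")
      case True
      have "check4 (tab r) (tab (r ^ 2)) (tab (r ^ 3)) (tab p)"
        using check4_even tab_even[OF p(1)] True g(1) by (simp add: list_all_iff A6_tab)
      then have "is_pow2 (tab p) \<or> odd_order (tab p) \<or> odd_order (tab (p * r)) \<or> odd_order (tab (p * r ^ 2)) \<or>
          odd_order (tab (p * r ^ 3))"
        using p(1) g(1) by (simp add: check4_def A6_tab)
      then have "p ^ 30 = 1 \<or> (p * r) ^ 15 = 1 \<or> (p * r ^ 2) ^ 15 = 1 \<or> (p * r ^ 3) ^ 15 = 1"
        using even_order_30[OF p(1)] odd_order_15 p(1) g(1) A6_tab(4,6) by blast
      then show ?thesis
        unfolding p(2) g(3) conj_by_power conj_by_prod[symmetric] conj_by_power_eq_1[unfolded conj_by_power] by blast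
    next
      case False
      then have "r ^ 30 = 1"
        using check_reps(1) g(1,2) by (intro even_order_30) (auto simp: list_all_iff odd_order_def)
      then show ?thesis unfolding g(3) conj_by_power_eq_1 by blast
    qed
  qed simp
qed

lemma A6_dId6: "dId6 (group_of A6_bij)"
  unfolding dId6_def group_of_simps pow_group_of
proof (intro ballI)
  fix x y assume xy: "x \<in> A6_bij" "y \<in> A6_bij"
  have "x ^ 12 = 1 \<or> y ^ 30 = 1 \<or> (x * inverse y * x * y) ^ 12 = 1 \<or> (x * inverse y * x ^ 3 * y) ^ 12 = 1 \<or>
    (x ^ 2 * inverse y * x * y) ^ 12 = 1"
  proof (cases "y = 1")
    case False
    obtain g r where g: "r \<in> A6_bij" "tab r \<in> set reps" "y = conj_by g r"
      "\<And>z. z \<in> A6_bij \<Longrightarrow> \<exists>z'\<in>A6_bij. z = conj_by g z'" using rep_A6[OF xy(2) False] by metis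
    obtain p where p: "p \<in> A6_bij" "x = conj_by g p" using g(4)[OF xy(1)] by blast
    show ?thesis
    proof (cases "tab r = rep_42")
      case True
      have "is_pow4 (tab r)" unfolding True by code_simp
      then have "r * r ^ 3 = 1" using g(1) by (simp add: A6_tab_pow flip: power_Suc)
      then have ri: "r ^ 3 = inverse r" by (simp only: mult_eq_one_iff)
      \<comment> \<open>All three words of (6) are products of a power of \<open>p\<close> with
        \<open>c\<close> or \<open>c ^ 3\<close>.\<close>
      define c where "c = inverse r * (p * r)"
      have c: "c \<in> A6_bij" using p(1) g(1) by (simp add: c_def A6_tab)
      have tc: "tab c = table_comp (tab (r ^ 3)) (table_comp (tab p) (tab r))" unfolding c_def ri[symmetric] using p(1) g(1) by (simp add: A6_tab)
      have c3: "c ^ 3 = inverse r * p ^ 3 * r" by (simp add: c_def power3_eq_cube mult.assoc)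
      have "check6 (tab r) (tab (r ^ 3)) (tab p)"
        using check6_even tab_even[OF p(1)] True g(1) by (simp add: list_all_iff A6_tab)
      then have "is_pow3 (tab p) \<or> is_pow4 (tab p) \<or> is_pow3 (tab (p * c)) \<or> is_pow4 (tab (p * c)) \<or>
          is_pow3 (tab (p * c ^ 3)) \<or> is_pow4 (tab (p * c ^ 3)) \<or> is_pow3 (tab (p ^ 2 * c)) \<or> is_pow4 (tab (p ^ 2 * c))"
        using p(1) c by (simp add: check6_def tc[symmetric] A6_tab)
      then have "p ^ 12 = 1 \<or> (p * c) ^ 12 = 1 \<or> (p * c ^ 3) ^ 12 = 1 \<or> (p ^ 2 * c) ^ 12 = 1"
        using not_5_12 p(1) c A6_tab(4,6) by metis
      then have "p ^ 12 = 1 \<or> (p * inverse r * p * r) ^ 12 = 1 \<or> (p * inverse r * p ^ 3 * r) ^ 12 = 1 \<or>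
          (p ^ 2 * inverse r * p * r) ^ 12 = 1"
        by (simp add: c3 mult.assoc) (simp add: c_def)
      then show ?thesis
        unfolding p(2) g(3) conj_by_inverse[symmetric] conj_by_power conj_by_prod[symmetric]
          conj_by_power_eq_1[unfolded conj_by_power] by blast
    next
      case False
      then have "r ^ 30 = 1"
        using check_reps(1) g(1,2) by (intro even_order_30) (auto simp: list_all_iff odd_order_def)
      then show ?thesis unfolding g(3) conj_by_power_eq_1 by blast
    qed
  qed simp
  then show "x ^ 12 = 1 \<or> y ^ 30 = 1 \<or> (x * inv\<^bsub>group_of A6_bij\<^esub> y * x * y) ^ 12 = 1 \<or>
      (x * inv\<^bsub>group_of A6_bij\<^esub> y * x ^ 3 * y) ^ 12 = 1 \<or> (x ^ 2 * inv\<^bsub>group_of A6_bij\<^esub> y * x * y) ^ 12 = 1"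
    unfolding inv_group_of[OF sgp_A6_bij xy(2)] .
qed

lemma A6_dId7: "dId7 (group_of A6_bij)"
  unfolding dId7_def group_of_simps pow_group_of
proof (intro ballI)
  fix x y assume xy: "x \<in> A6_bij" "y \<in> A6_bij"
  show "x ^ 12 = 1 \<or> y ^ 12 = 1 \<or> (\<exists>d::nat\<in>{1..4}. (x * y ^ d) ^ 12 = 1)"
  proof (cases "y = 1")
    case False
    obtain g r where g: "r \<in> A6_bij" "tab r \<in> set reps" "y = conj_by g r"
      "\<And>z. z \<in> A6_bij \<Longrightarrow> \<exists>z'\<in>A6_bij. z = conj_by g z'" using rep_A6[OF xy(2) False] by metis
    obtain p where p: "p \<in> A6_bij" "x = conj_by g p" using g(4)[OF xy(1)] by blast
    show ?thesis
    proof (cases "tab r = rep_5")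
      case True
      have t4: "tab (r ^ 4) = table_comp (tab r) (pow3_table (tab r))"
        using g(1) A6_tab(1)[of "r ^ 3" r] by (simp add: A6_tab flip: power_Suc)
      have "check7 [tab (r ^ 1), tab (r ^ 2), tab (r ^ 3), tab (r ^ 4)] (tab p)"
        using check7_even tab_even[OF p(1)] True g(1) t4 by (simp add: list_all_iff A6_tab)
      then have "is_pow3 (tab p) \<or> is_pow4 (tab p) \<or> (\<exists>d\<in>{1,2,3,4}. is_pow3 (tab (p * r ^ d)) \<or> is_pow4 (tab (p * r ^ d)))"
        using p(1) g(1) A6_tab(1)[of "r ^ _" p] by (simp add: check7_def sgp_power[OF sgp_A6_bij])
      moreover have "p * r ^ d \<in> A6_bij" for d using p(1) g(1) by (simp add: A6_tab)
      ultimately have "p ^ 12 = 1 \<or> (\<exists>d\<in>{1,2,3,4}. (p * r ^ d) ^ 12 = 1)"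
        using not_5_12 p(1) by blast
      then have "p ^ 12 = 1 \<or> (\<exists>d::nat\<in>{1..4}. (p * r ^ d) ^ 12 = 1)" by force
      then show ?thesis
        unfolding p(2) g(3) conj_by_power conj_by_prod[symmetric] conj_by_power_eq_1[unfolded conj_by_power] by blast
    next
      case False
      then have "r ^ 12 = 1" using check_reps(2) g(1,2) by (intro not_5_12) (auto simp: list_all_iff)
      then show ?thesis unfolding g(3) conj_by_power_eq_1 by blast
    qed
  qed simp
qed

lemma A6_dId3: "dId3 (group_of A6_bij)"
  unfolding dId3_def group_of_simps pow_group_of
proof (intro allI impI, rule ccontr)
  fix x :: "nat \<Rightarrow> nat bij" assume x: "\<forall>i\<in>{1..9}. x i \<in> A6_bij"
  assume neg: "\<not> ((\<exists>i\<in>{1..9}. x i ^ 20 = 1) \<or> (\<exists>i\<in>{1..9}. \<exists>j\<in>{1..9}. i < j \<and> x i = x j) \<or>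
      (\<exists>i\<in>{1..9}. \<exists>j\<in>{1..9}. i < j \<and> (x i * x j) ^ 20 = 1) \<or>
      (\<exists>i\<in>{1..9}. \<exists>j\<in>{1..9}. i < j \<and> (x i * x j ^ 2) ^ 20 = 1))"
  have one: "(1::nat) \<in> {1..9}" by simp
  then have x1: "x 1 \<in> A6_bij" "x 1 ^ 20 \<noteq> 1" using x neg by blast+
  then have "x 1 \<noteq> 1" by auto
  then obtain g r where g: "r \<in> A6_bij" "tab r \<in> set reps" "x 1 = conj_by g r"
    "\<And>z. z \<in> A6_bij \<Longrightarrow> \<exists>z'\<in>A6_bij. z = conj_by g z'" using rep_A6[OF x1(1)] by metis
  have "\<exists>z. \<forall>i\<in>{1..9}. z i \<in> A6_bij \<and> x i = conj_by g (z i)"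
    using g(4) x by (intro bchoice) blast
  then obtain z where z: "\<And>i. i \<in> {1..9} \<Longrightarrow> z i \<in> A6_bij" "\<And>i. i \<in> {1..9} \<Longrightarrow> x i = conj_by g (z i)" by blast
  have z1: "z 1 = r" using z(2)[OF one] g(3) by simp
  have "r ^ 20 \<noteq> 1" using x1(2) unfolding g(3) conj_by_power_eq_1 .
  then have "\<not> (is_pow4 (tab r) \<or> is_pow5 (tab r))" using not_3_20[OF g(1)] by blast
  then have "tab r = rep_3 \<or> tab r = rep_33" using check_reps(3) g(2) by (auto simp: list_all_iff)
  then have len: "length (filter (near3 (tab r)) even_tables) \<le> 8" using near3_even by auto
  have "tab (z i) \<in> set (filter (near3 (tab r)) even_tables)" if i: "i \<in> {1..9}" for i
  proof (cases "i = 1")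
    case True
    then show ?thesis using tab_even[OF g(1)] z1 by (simp add: near3_def)
  next
    case False
    \<comment> \<open>Only products with the first variable are used; as \<open>1 < i\<close>, they
      occur in (3) with \<open>x 1\<close> on the left.\<close>
    then have "1 < i" using i by simp
    then have "x i ^ 20 \<noteq> 1" "(x 1 * x i) ^ 20 \<noteq> 1" "(x 1 * x i ^ 2) ^ 20 \<noteq> 1" using neg i one by blast+
    then have "z i ^ 20 \<noteq> 1" "(r * z i) ^ 20 \<noteq> 1" "(r * z i ^ 2) ^ 20 \<noteq> 1"
      unfolding z(2)[OF i] g(3) conj_by_power conj_by_prod[symmetric] conj_by_power_eq_1[unfolded conj_by_power]
      by blast+
    moreover have "z i \<in> A6_bij" "r * z i \<in> A6_bij" "r * z i ^ 2 \<in> A6_bij" using z(1)[OF i] g(1) by (simp_all add: A6_tab)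
    ultimately have "\<not> (is_pow4 (tab (z i)) \<or> is_pow5 (tab (z i)))" "\<not> (is_pow4 (tab (r * z i)) \<or> is_pow5 (tab (r * z i)))"
      "\<not> (is_pow4 (tab (r * z i ^ 2)) \<or> is_pow5 (tab (r * z i ^ 2)))" using not_3_20 by blast+
    then have "near3 (tab r) (tab (z i))" using z(1)[OF i] by (simp add: near3_def A6_tab)
    then show ?thesis using tab_even[OF z(1)[OF i]] by simp
  qed
  then have "(\<lambda>i. tab (z i)) ` {1..9} \<subseteq> set (filter (near3 (tab r)) even_tables)" by blast
  then have "card ((\<lambda>i. tab (z i)) ` {1..9}) \<le> card (set (filter (near3 (tab r)) even_tables))" by (intro card_mono) simp_all
  also have "\<dots> \<le> 8" using len card_length le_trans by blast
  finally have le: "card ((\<lambda>i. tab (z i)) ` {1..9}) \<le> 8" .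
  \<comment> \<open>Nine distinct tables would have to fit into a list of length at most 8.\<close>
  have "inj_on (\<lambda>i. tab (z i)) {1..9}"
  proof (rule linorder_inj_onI)
    fix i j :: nat assume ij: "i < j" "i \<in> {1..9}" "j \<in> {1..9}"
    then have "x i \<noteq> x j" using neg by blast
    then have "z i \<noteq> z j" using z(2) ij by auto
    then show "tab (z i) \<noteq> tab (z j)" using tab_inject[OF A6_S6 A6_S6] z(1) ij by blast
  qed auto
  then show False using le by (simp add: card_image)
qed

lemma A6_dId5: "dId5 (group_of A6_bij)"
  unfolding dId5_def group_of_simps pow_group_of
proof (intro allI impI, rule ccontr)
  fix x :: "nat \<Rightarrow> nat bij" assume x: "\<forall>i\<in>{1..3}. x i \<in> A6_bij"
  assume neg: "\<not> (theta (group_of A6_bij) x \<or> (\<exists>i\<in>{1..3}. x i ^ 15 = 1) \<or>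
      (\<exists>i\<in>{1..3}. \<exists>j\<in>{1..3}. i \<noteq> j \<and> (x i * x j) ^ 15 = 1) \<or>
      (\<exists>i\<in>{1..3}. \<exists>j\<in>{1..3}. i \<noteq> j \<and> (x i * x j ^ 2) ^ 15 = 1) \<or>
      (\<exists>i\<in>{1..3}. \<exists>j\<in>{1..3}. i \<noteq> j \<and> (x i * x j ^ 3) ^ 15 = 1))"
  have idx: "(1::nat) \<in> {1..3}" "(2::nat) \<in> {1..3}" "(3::nat) \<in> {1..3}" by simp_all
  have x1: "x 1 \<in> A6_bij" "x 1 ^ 15 \<noteq> 1" using x neg idx by blast+
  then have "x 1 \<noteq> 1" by auto
  then obtain g r where g: "r \<in> A6_bij" "tab r \<in> set reps" "x 1 = conj_by g r"
    "\<And>z. z \<in> A6_bij \<Longrightarrow> \<exists>z'\<in>A6_bij. z = conj_by g z'" using rep_A6[OF x1(1)] by metis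
  have "\<exists>z. \<forall>i\<in>{1..3}. z i \<in> A6_bij \<and> x i = conj_by g (z i)"
    using g(4) x by (intro bchoice) blast
  then obtain z where z: "\<And>i. i \<in> {1..3} \<Longrightarrow> z i \<in> A6_bij" "\<And>i. i \<in> {1..3} \<Longrightarrow> x i = conj_by g (z i)" by blast
  have z1: "z 1 = r" using z(2)[OF idx(1)] g(3) by simp
  have zA: "z i * z j \<in> A6_bij" if "i \<in> {1..3}" "j \<in> {1..3}" for i j using z(1) that by (simp add: A6_tab)
  have in_pow: "in_pow3 (group_of A6_bij) (conj_by g u) (conj_by g v)"
    if t: "in_pow3_table (tab u) (tab v)" and u: "u \<in> A6_bij" "v \<in> A6_bij" for u v
  proof -
    have "tab u = tab 1 \<or> tab u = tab v \<or> tab u = tab (v ^ 2) \<or> tab u = tab (v ^ 3)"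
      using t u by (simp add: in_pow3_table_def tab_one A6_tab)
    then have "u = 1 \<or> u = v \<or> u = v ^ 2 \<or> u = v ^ 3"
      using tab_inject[OF A6_S6[OF u(1)]] A6_S6[OF u(2)] S6_closed(1) A6_S6 A6_tab(6)[OF u(2)] by metis
    then show ?thesis by (auto simp: in_pow3_def pow_group_of conj_by_power)
  qed
  have odd1: "\<not> odd_order (tab (z i))" if i: "i \<in> {1..3}" for i
  proof
    assume "odd_order (tab (z i))"
    then have "z i ^ 15 = 1" by (rule odd_order_15[OF z(1)[OF i]])
    then have "x i ^ 15 = 1" unfolding z(2)[OF i] conj_by_power_eq_1 .
    then show False using neg i by blast
  qed
  have odd2: "\<not> odd_order (tab (z i * z j ^ k))" if ij: "i \<in> {1..3}" "j \<in> {1..3}" "i \<noteq> j" "k \<in> {1,2,3}" for i j k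
  proof
    assume "odd_order (tab (z i * z j ^ k))"
    moreover have "z i * z j ^ k \<in> A6_bij" using z(1) ij by (simp add: A6_tab)
    ultimately have "(z i * z j ^ k) ^ 15 = 1" using odd_order_15 by blast
    then have "(x i * x j ^ k) ^ 15 = 1"
      unfolding z(2)[OF ij(1)] z(2)[OF ij(2)] conj_by_power conj_by_prod[symmetric] conj_by_power_eq_1[unfolded conj_by_power]
      by blast
    moreover have "(x i * x j) ^ 15 \<noteq> 1" "(x i * x j ^ 2) ^ 15 \<noteq> 1" "(x i * x j ^ 3) ^ 15 \<noteq> 1"
      using neg ij(1-3) by blast+
    moreover have "k = 1 \<or> k = 2 \<or> k = 3" using ij(4) by simp
    ultimately show False by auto
  qed
  have th: "\<not> theta (group_of A6_bij) x" using neg by blast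
  have np: "\<not> in_pow3_table (tab (z i)) (tab (z j))" if ij: "i \<in> {1..3}" "j \<in> {1..3}" "i \<noteq> j" for i j
  proof
    assume "in_pow3_table (tab (z i)) (tab (z j))"
    then have "in_pow3 (group_of A6_bij) (x i) (x j)" using in_pow z ij by metis
    then show False using th ij unfolding theta_def by blast
  qed
  have np2: "\<not> in_pow3_table (tab (z i)) (tab (z j * z k))"
    if ij: "i \<in> {1..3}" "j \<in> {1..3}" "k \<in> {1..3}" "i \<noteq> j" "i \<noteq> k" "j \<noteq> k" for i j k
  proof
    assume "in_pow3_table (tab (z i)) (tab (z j * z k))"
    then have "in_pow3 (group_of A6_bij) (conj_by g (z i)) (conj_by g (z j * z k))" using in_pow z(1) zA ij by blast
    then have "in_pow3 (group_of A6_bij) (x i) (x j * x k)" unfolding conj_by_prod using z(2) ij by simp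
    then show False using th ij unfolding theta_def group_of_simps by blast
  qed
  have np3: "\<not> in_pow3_table (tab (z i * z j)) (tab (z j * z k))"
    if ij: "i \<in> {1..3}" "j \<in> {1..3}" "k \<in> {1..3}" "i \<noteq> j" "i \<noteq> k" "j \<noteq> k" for i j k
  proof
    assume "in_pow3_table (tab (z i * z j)) (tab (z j * z k))"
    then have "in_pow3 (group_of A6_bij) (conj_by g (z i * z j)) (conj_by g (z j * z k))" using in_pow zA ij by blast
    then have "in_pow3 (group_of A6_bij) (x i * x j) (x j * x k)" unfolding conj_by_prod using z(2) ij by simp
    then show False using th ij unfolding theta_def group_of_simps by blast
  qed
  have ev: "even_pair (tab (z i)) (tab (z j))" if ij: "i \<in> {1..3}" "j \<in> {1..3}" "i \<noteq> j" for i j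
    unfolding even_pair_def
    using odd2[OF ij, of 1] odd2[OF ij, of 2] odd2[OF ij, of 3] odd2[OF ij(2,1), of 1] odd2[OF ij(2,1), of 2]
      odd2[OF ij(2,1), of 3] np[OF ij] np[OF ij(2,1)] ij(3) z(1)[OF ij(1)] z(1)[OF ij(2)]
    by (simp add: A6_tab)
  have "odd_order (tab r) = False" using odd1[OF idx(1)] z1 by simp
  then have "tab r = rep_22 \<or> tab r = rep_42" using check_reps(4) g(2) by (auto simp: list_all_iff)
  then have "check5 (tab r) (filter (\<lambda>p. \<not> odd_order p \<and> even_pair (tab r) p) even_tables)" using check5_even by auto
  moreover have "tab (z i) \<in> set (filter (\<lambda>p. \<not> odd_order p \<and> even_pair (tab r) p) even_tables)" if "i \<in> {2, 3}" for i
  proof -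
    have "i \<in> {1..3}" "1 \<noteq> i" using that by auto
    then show ?thesis using odd1 ev[OF idx(1), of i] z1 tab_even[OF z(1)] by simp
  qed
  ultimately have "even_pair (tab (z 2)) (tab (z 3)) \<longrightarrow> theta_table (tab r) (tab (z 2)) (tab (z 3))"
    unfolding check5_def list_all_iff by blast
  then have "theta_table (tab (z 1)) (tab (z 2)) (tab (z 3))" using ev[OF idx(2,3)] z1 by simp
  then show False
    unfolding theta_table_def
    using np2[OF idx(1,2,3)] np2[OF idx(1,3,2)] np2[OF idx(2,1,3)] np2[OF idx(2,3,1)] np2[OF idx(3,1,2)] np2[OF idx(3,2,1)]
      np3[OF idx(1,2,3)] np3[OF idx(1,3,2)] np3[OF idx(2,1,3)] np3[OF idx(2,3,1)] np3[OF idx(3,1,2)] np3[OF idx(3,2,1)]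
      z(1)[OF idx(1)] z(1)[OF idx(2)] z(1)[OF idx(3)]
    by (simp add: A6_tab)
qed

lemma Bij_A6: "apply_bij ` A6_bij = carrier (alt_group 6)"
proof
  show "apply_bij ` A6_bij \<subseteq> carrier (alt_group 6)" by (auto simp: A6_bij_def alt_group_carrier)
  show "carrier (alt_group 6) \<subseteq> apply_bij ` A6_bij"
  proof
    fix f assume "f \<in> carrier (alt_group 6)"
    then have f: "f permutes {1..6}" "evenperm f" by (simp_all add: alt_group_carrier)
    have a: "apply_bij (Bij f) = f" using permutes_bij[OF f(1)] by (rule apply_Bij)
    have "Bij f \<in> A6_bij" using f by (simp add: A6_bij_def a)
    then show "f \<in> apply_bij ` A6_bij" using a by (metis imageI)
  qed
qed

text \<open>(1) holds because there are exactly 360 elements; all seven identities pass from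
  \<open>A6_bij\<close> along the homomorphism \<open>apply_bij\<close>.\<close>

lemma A6_basis_alt_group: "A6_basis (alt_group 6)"
proof (rule A6_basis_hom_image[of "group_of A6_bij" _ apply_bij])
  show "group (group_of A6_bij)" by (rule group_group_of[OF sgp_A6_bij])
  show "group (alt_group 6)" by (rule alt_group_is_group)
  show "apply_bij ` carrier (group_of A6_bij) = carrier (alt_group 6)" by (simp add: Bij_A6)
  have "2 * card (carrier (alt_group 6)) = 720" using alt_group_card_carrier[of 6] by (simp add: fact_numeral)
  moreover have "card (carrier (alt_group 6)) = card A6_bij"
    unfolding Bij_A6[symmetric] by (rule card_image) (simp add: inj_on_def apply_bij_inject)
  ultimately have "dId1 (group_of A6_bij)" using sgpD(1)[OF sgp_A6_bij] by (intro card_dId1) simp_all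
  then show "A6_basis (group_of A6_bij)"
    using A6_dId2 A6_dId3 A6_dId4 A6_dId5 A6_dId6 A6_dId7 by (simp add: A6_basis_def)
qed (simp add: alt_group_mult apply_bij_mult)

theorem theorem3:
  fixes G :: "('a, 'b) monoid_scheme"
  shows "A6_basis (alt_group 6) \<and> ((group G \<and> A6_basis G) \<longrightarrow> is_section_of G (alt_group 6))"
  using A6_basis_alt_group section_of_A6 by blast

end
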